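(* For a positive integer $n$ and a complex number $s$ let $\psi_s(n):=\sum_{j^2\mid n}j^s$. Let $\alpha>0$ and $\beta>0$ be such that $\alpha\beta=4\pi^3$. Then, for $s\in\mathbb{C}$ with $\operatorname{Re}s>0$, \begin{align*} &\sum_{n=1}^{\infty}\frac{\psi_s(n)}{\sqrt n}e^{-\sqrt{n\beta}}\sin\left(\frac\pi4-\sqrt{n\beta}\right)\\ &=\frac{\sqrt\beta}{\sqrt2}\zeta(-s)+\Gamma(s)\cos\left(\frac\pi4+\frac{\pi s}{4}\right)\zeta\left(\frac{1+s}{2}\right)(2\beta)^{-\frac12 s}+\frac1{\sqrt2}\zeta\left(\tfrac12\right)\zeta(1-s)\\ &\quad+2^{-s-\frac12}\pi^{-s-2}\sqrt\beta\sum_{n=1}^{\infty}\frac{\psi_{1-s}(n)}{n}\Bigg\{\frac{-\pi^3\sqrt n}{\sqrt\beta\,\Gamma(1-s)\sin\left(\frac{\pi s}{2}\right)}\\ &\qquad+2^{2s}\pi^{\frac32 s+2}\left(\frac n\beta\right)^{(s+1)/2}\Gamma\left(\frac s2\right){}_1F_1\left(\frac s2;\frac12;-n\alpha\right)\Bigg\}. \end{align*}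
   Context: The sum defining $\psi_s(n)$ is over positive integers $j$ with $j^2\mid n$; $\zeta$ is the Riemann zeta function; ${}_1F_1(a;c;z)=\sum_{k\ge0}\frac{(a)_k}{(c)_k}\frac{z^k}{k!}$ is Kummer's confluent hypergeometric function. At values of $s$ where individual factors are singular (positive integers: e.g. $\Gamma(1-s)\sin(\pi s/2)$, or $\cos(\frac\pi4+\frac{\pi s}4)\zeta(\frac{1+s}2)$ at $s=1$), the expressions are understood as limiting values in $s$. *)

theory Defs
  imports "HOL-Complex_Analysis.Complex_Analysis"
begin

text \<open>
  The Riemann zeta function is the analytic continuation of its Dirichlet series to the plane
  punctured at 1. The continuation is unique on that connected open set; the value at the
  pole 1 is left unspecified.
\<close>

definition zeta :: "complex \<Rightarrow> complex" where
  "zeta = (SOME f. f holomorphic_on (- {1}) \<and>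
             (\<forall>s. Re s > 1 \<longrightarrow> (\<lambda>n. 1 / of_nat (Suc n) powr s) sums f s))"

definition psi :: "complex \<Rightarrow> nat \<Rightarrow> complex" where
  "psi s n = (\<Sum>j | 0 < j \<and> j\<^sup>2 dvd n. of_nat j powr s)"

definition kummer_1F1 :: "complex \<Rightarrow> complex \<Rightarrow> complex \<Rightarrow> complex" where
  "kummer_1F1 a c z = (\<Sum>k. pochhammer a k / pochhammer c k * (z ^ k / fact k))"

text \<open>
  The value at \<open>s\<close> of an expression \<open>F\<close> that may have a removable singularity there.
  The limit is over the punctured neighbourhood, so the junk values of division by zero and
  of \<open>Gamma\<close> at its poles do not matter. Where \<open>F\<close> is continuous, this is \<open>F s\<close>.
\<close>

definition limiting_value :: "(complex \<Rightarrow> complex) \<Rightarrow> complex \<Rightarrow> complex" where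
  "limiting_value F s = Lim (at s) F"

lemma limiting_value_eq: "isCont F s \<Longrightarrow> limiting_value F s = F s"
  unfolding limiting_value_def isCont_def by (rule tendsto_Lim) auto

definition lhs_term :: "complex \<Rightarrow> real \<Rightarrow> nat \<Rightarrow> complex" where
  "lhs_term s \<beta> n =
     psi s n / of_real (sqrt (real n)) *
     of_real (exp (- sqrt (real n * \<beta>)) * sin (pi / 4 - sqrt (real n * \<beta>)))"

text \<open>
  The first summand in braces has removable singularities at the even positive integers
  (\<open>sin (\<pi> s / 2) = 0\<close>) and at the odd ones (poles of \<open>\<Gamma>(1 - s)\<close>).
\<close>

definition rhs_term :: "complex \<Rightarrow> real \<Rightarrow> real \<Rightarrow> nat \<Rightarrow> complex" where
  "rhs_term s \<alpha> \<beta> n =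
     psi (1 - s) n / of_nat n *
     (limiting_value (\<lambda>w. of_real (- (pi ^ 3) * sqrt (real n)) /
         (of_real (sqrt \<beta>) * Gamma (1 - w) * sin (of_real pi * w / 2))) s
      + 2 powr (2 * s) * of_real pi powr (3 / 2 * s + 2)
        * of_real (real n / \<beta>) powr ((s + 1) / 2)
        * Gamma (s / 2) * kummer_1F1 (s / 2) (1 / 2) (- of_real (real n * \<alpha>)))"

end

theory Submission
  imports Defs "HOL-Real_Asymp.Real_Asymp"
begin

text \<open>
  Let \<open>a > 0\<close>. Poisson summation of \<open>x powr (- 1 / 2) * exp (- a\<^sup>2 / (4 * pi * x))\<close> turns
  \<open>\<Sum>m. m powr (- 1 / 2) * exp (- a * sqrt m) * sin (pi / 4 - a * sqrt m)\<close> into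
  \<open>a + zeta (1 / 2) + (\<Sum>k. k powr (- 1 / 2) * (exp (- a\<^sup>2 / (4 * pi * k)) - 1))\<close>, up to the factor \<open>sqrt 2\<close>.
  Writing \<open>n = m * j\<^sup>2\<close> on the left and summing over \<open>a = j * sqrt \<beta>\<close> with weight \<open>j powr (s - 1)\<close>
  leaves the Gaussian sums \<open>\<Sum>j. j powr (s - 1) * exp (- c * j\<^sup>2)\<close>. A second Poisson summation
  expresses them by the cosine transform of a power times a Gaussian, which is
  \<open>Gamma (s / 2)\<close> times a Kummer function. Its asymptotic expansion, obtained by rotating the ray of
  integration by \<open>\<plusminus>pi / 8\<close>, makes the remainder summable; as \<open>c\<close> tends to \<open>0\<close> the same expansion yields the
  continuation of \<open>zeta\<close> and its functional equation. The interchange of the sums is absolutely convergent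
  only for \<open>- 2 < Re s < - 1\<close>; both sides then continue analytically to \<open>Re s > 0\<close>.
\<close>

section \<open>Holomorphy under integral and sum\<close>

text \<open>The interchange needs \<open>Re s < -1\<close>, because the weight
  \<open>1 / sqrt k\<close> forces a power of \<open>j\<^sup>2 / k\<close> above one half. This
  dictates how many terms are split off: after removal of p asymptotic terms the remainder at
  frequency m decays like m to the power - Re s - 2 p, which is summable for Re s > 1 - 2 p. One
  term reaches only \<open>Re s > -1\<close>; two terms reach \<open>Re s > -3\<close> and overlap
  the region of interchange. Summed over m, the first term becomes \<open>zeta (1 - s)\<close>
  through the functional equation; the second leads to \<open>zeta (s + 2) * zeta (3 / 2)\<close>.
  Once \<open>Re s > 0\<close> is reached, the second term and the remainder are put back together,
  so that only the first stays subtracted. It is the summand with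
  \<open>Gamma (1 - s) * sin (pi * s / 2)\<close> in the denominator. The condition
  \<open>\<alpha> * \<beta> = 4 * pi ^ 3\<close> normalizes the Kummer argument: a Gaussian of scale
  \<open>\<beta> / (4 * pi * k)\<close> at frequency \<open>2 * pi * m\<close> yields
  \<open>- 4 * pi ^ 3 * k * m\<^sup>2 / \<beta>\<close>, that is \<open>- n * \<alpha>\<close> with
  \<open>n = k * m\<^sup>2\<close>.\<close>

lemma tendsto_integral_dominated_within:
  fixes f :: "'b::first_countable_topology \<Rightarrow> 'a \<Rightarrow> 'c::{banach, second_countable_topology}"
  assumes meas: "f0 \<in> borel_measurable M"
    and ev: "eventually (\<lambda>z. f z \<in> borel_measurable M \<and> (AE x in M. norm (f z x) \<le> w x)) (at a within S)"
    and lim: "AE x in M. ((\<lambda>z. f z x) \<longlongrightarrow> f0 x) (at a within S)"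
    and w: "integrable M w"
  shows "((\<lambda>z. integral\<^sup>L M (f z)) \<longlongrightarrow> integral\<^sup>L M f0) (at a within S)"
  unfolding tendsto_at_iff_sequentially
proof (intro allI impI)
  fix X :: "nat \<Rightarrow> 'b" assume X: "\<forall>i. X i \<in> S - {a}" and Xa: "X \<longlonglongrightarrow> a"
  have fl: "filterlim X (at a within S) sequentially"
    using X Xa by (auto simp: filterlim_at)
  have "eventually (\<lambda>n. f (X n) \<in> borel_measurable M \<and> (AE x in M. norm (f (X n) x) \<le> w x)) sequentially"
    using filterlim_iff[THEN iffD1, OF fl] ev by blast
  then obtain N where N: "\<And>n. n \<ge> N \<Longrightarrow> f (X n) \<in> borel_measurable M \<and> (AE x in M. norm (f (X n) x) \<le> w x)"
    by (auto simp: eventually_sequentially)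
  have "(\<lambda>n. integral\<^sup>L M (f (X (n + N)))) \<longlonglongrightarrow> integral\<^sup>L M f0"
  proof (rule integral_dominated_convergence[where w = w])
    show "AE x in M. (\<lambda>n. f (X (n + N)) x) \<longlonglongrightarrow> f0 x"
      using lim
    proof eventually_elim
      case (elim x)
      have "(\<lambda>n. f (X n) x) \<longlonglongrightarrow> f0 x"
        using filterlim_compose[OF elim fl] .
      thus ?case using LIMSEQ_ignore_initial_segment[of "\<lambda>n. f (X n) x" "f0 x" N] by simp
    qed
  qed (use N meas w in auto)
  thus "((\<lambda>z. integral\<^sup>L M (f z)) \<circ> X) \<longlonglongrightarrow> integral\<^sup>L M f0"
    unfolding o_def by (rule LIMSEQ_offset[where k = N])
qed

text \<open>Difference quotients are dominated by Cauchy's inequality: on discs of radius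
  \<open>r / 2\<close> inside \<open>cball a r\<close> the derivative in \<open>z\<close> is at most
  \<open>2 / r * w x\<close>, so the majorant of \<open>f\<close> also serves the quotients. The
  Gamma, ray and Laplace integrals below are holomorphic for this reason.\<close>

lemma holomorphic_on_integral:
  fixes f :: "complex \<Rightarrow> 'a \<Rightarrow> complex"
  assumes "open U"
    and meas: "\<And>z. z \<in> U \<Longrightarrow> f z \<in> borel_measurable M"
    and hol: "\<And>x. x \<in> space M \<Longrightarrow> (\<lambda>z. f z x) holomorphic_on U"
    and dom: "\<And>a. a \<in> U \<Longrightarrow> \<exists>r>0. \<exists>w. cball a r \<subseteq> U \<and> integrable M w \<and>
                (\<forall>z\<in>cball a r. \<forall>x\<in>space M. norm (f z x) \<le> w x)"
  shows "(\<lambda>z. integral\<^sup>L M (f z)) holomorphic_on U"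
proof -
  have "\<exists>D. ((\<lambda>z. integral\<^sup>L M (f z)) has_field_derivative D) (at a)" if a: "a \<in> U" for a
  proof -
    obtain r w where r: "r > 0" "cball a r \<subseteq> U" and w: "integrable M w"
      and bd: "\<And>z x. z \<in> cball a r \<Longrightarrow> x \<in> space M \<Longrightarrow> norm (f z x) \<le> w x"
      using dom[OF a] by blast
    have int: "integrable M (f z)" if "z \<in> cball a r" for z
      by (rule Bochner_Integration.integrable_bound[OF w meas])
         (use that r bd in \<open>auto intro!: AE_I2 order.trans[OF bd]\<close>)
    define D where "D = (\<lambda>x. deriv (\<lambda>z. f z x) a)"
    define q where "q = (\<lambda>z x. (f z x - f a x) / (z - a))"
    have lim: "((\<lambda>z. q z x) \<longlongrightarrow> D x) (at a)" if "x \<in> space M" for x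
      using holomorphic_derivI[OF hol[OF that] \<open>open U\<close> a] unfolding q_def D_def has_field_derivative_iff .
    have ball: "ball a r \<subseteq> U" using r(2) ball_subset_cball by blast
    have q_meas: "q z \<in> borel_measurable M" if "z \<in> ball a r" for z
      unfolding q_def using meas[of z] meas[of a] a that ball by (intro borel_measurable_divide borel_measurable_diff) auto
    \<comment> \<open>Measurability in \<open>x\<close> is given for \<open>f\<close> only;
      \<open>D\<close> inherits it as the pointwise limit of quotients along real shifts smaller
      than \<open>r\<close>.\<close>
    have D_meas: "D \<in> borel_measurable M"
    proof (rule borel_measurable_LIMSEQ_metric)
      let ?X = "\<lambda>n::nat. a + of_real (r / (real n + 2))"
      show "q (?X n) \<in> borel_measurable M" for n
      proof (rule q_meas)
        have "r / (real n + 2) < r" using r(1) by (simp add: field_simps add_pos_nonneg)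
        thus "?X n \<in> ball a r" using r(1) by (simp add: dist_norm del: of_real_divide)
      qed
      show "(\<lambda>n. q (?X n) x) \<longlonglongrightarrow> D x" if "x \<in> space M" for x
      proof (rule filterlim_compose[OF lim[OF that]])
        have "(\<lambda>n. r / (real n + 2)) \<longlonglongrightarrow> 0" by real_asymp
        hence "?X \<longlonglongrightarrow> a + of_real 0" by (intro tendsto_intros)
        thus "filterlim ?X (at a) sequentially" using r(1)
          by (auto simp: filterlim_at add_eq_0_iff simp flip: of_real_add)
      qed
    qed
    have q_bd: "norm (q z x) \<le> 2 / r * w x" if z: "z \<in> ball a (r/2)" "z \<noteq> a" and x: "x \<in> space M" for z x
    proof -
      have "norm (f z x - f a x) \<le> (w x / (r/2)) * norm (z - a)"
      proof (rule field_differentiable_bound[where S = "ball a (r/2)" and f = "\<lambda>z. f z x" and f' = "deriv (\<lambda>z. f z x)"])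
        fix y assume y: "y \<in> ball a (r/2)"
        have sub: "cball y (r/2) \<subseteq> cball a r"
        proof
          fix v assume "v \<in> cball y (r/2)"
          thus "v \<in> cball a r" using y dist_triangle[of a v y] by (simp add: dist_commute)
        qed
        have "y \<in> cball y (r/2)" using r(1) by simp
        hence yU: "y \<in> U" using sub r(2) by blast
        show "((\<lambda>z. f z x) has_field_derivative deriv (\<lambda>z. f z x) y) (at y within ball a (r/2))"
          by (rule has_field_derivative_at_within, rule holomorphic_derivI[OF hol[OF x] \<open>open U\<close> yU])
        have "norm ((deriv ^^ 1) (\<lambda>z. f z x) y) \<le> fact 1 * w x / (r/2)^1"
        proof (rule Cauchy_inequality)
          show "(\<lambda>z. f z x) holomorphic_on ball y (r/2)"
            using hol[OF x] by (rule holomorphic_on_subset) (use sub r(2) ball_subset_cball in blast)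
          show "continuous_on (cball y (r/2)) (\<lambda>z. f z x)"
            using holomorphic_on_subset[OF hol[OF x], of "cball y (r/2)"] sub r(2)
            by (auto intro: holomorphic_on_imp_continuous_on)
          show "norm (f v x) \<le> w x" if "norm (y - v) = r/2" for v
            by (rule bd[OF _ x]) (use sub that in \<open>auto simp: dist_norm\<close>)
        qed (use r in auto)
        thus "norm (deriv (\<lambda>z. f z x) y) \<le> w x / (r/2)" by simp
      qed (use r z in auto)
      thus ?thesis using z by (simp add: q_def norm_divide field_simps)
    qed
    have "((\<lambda>z. integral\<^sup>L M (q z)) \<longlongrightarrow> integral\<^sup>L M D) (at a)"
    proof (rule tendsto_integral_dominated_within[where w = "\<lambda>x. 2 / r * w x"])
      show "\<forall>\<^sub>F z in at a. q z \<in> borel_measurable M \<and> (AE x in M. norm (q z x) \<le> 2 / r * w x)"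
      proof -
        have "\<forall>\<^sub>F z in at a. z \<in> ball a (r/2) - {a}"
          using r(1) by (intro eventually_at_in_open) auto
        thus ?thesis
        proof eventually_elim
          case (elim z)
          thus ?case using q_meas[of z] q_bd[of z] r by (auto intro!: AE_I2)
        qed
      qed
    qed (use D_meas lim w in \<open>auto intro!: AE_I2\<close>)
    moreover have "\<forall>\<^sub>F z in at a. integral\<^sup>L M (q z) = (integral\<^sup>L M (f z) - integral\<^sup>L M (f a)) / (z - a)"
    proof -
      have "\<forall>\<^sub>F z in at a. z \<in> ball a r - {a}"
        using r(1) by (intro eventually_at_in_open) auto
      thus ?thesis
      proof eventually_elim
        case (elim z)
        thus ?case unfolding q_def using int[of z] int[of a] r by (simp add: Bochner_Integration.integral_diff)
      qed
    qed
    ultimately have "((\<lambda>z. (integral\<^sup>L M (f z) - integral\<^sup>L M (f a)) / (z - a)) \<longlongrightarrow> integral\<^sup>L M D) (at a)"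
      by (simp add: tendsto_cong)
    thus ?thesis unfolding has_field_derivative_iff by blast
  qed
  thus ?thesis using holomorphic_on_open[OF \<open>open U\<close>] by blast
qed

text \<open>Weierstrass M-test: the finite sums converge uniformly on the closed disc. The index set
  is arbitrary, so double series over pairs are covered without iterating sums.\<close>

lemma holomorphic_on_infsum:
  fixes f :: "'a \<Rightarrow> complex \<Rightarrow> complex"
  assumes "open U"
    and hol: "\<And>x. x \<in> A \<Longrightarrow> f x holomorphic_on U"
    and dom: "\<And>a. a \<in> U \<Longrightarrow> \<exists>r>0. \<exists>w. cball a r \<subseteq> U \<and> w summable_on A \<and>
                (\<forall>z\<in>cball a r. \<forall>x\<in>A. norm (f x z) \<le> w x)"
  shows "(\<lambda>z. \<Sum>\<^sub>\<infinity>x\<in>A. f x z) holomorphic_on U"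
proof -
  have "(\<lambda>z. \<Sum>\<^sub>\<infinity>x\<in>A. f x z) field_differentiable at a" if a: "a \<in> U" for a
  proof -
    obtain r w where r: "r > 0" "cball a r \<subseteq> U" and w: "w summable_on A"
      and bd: "\<And>z x. z \<in> cball a r \<Longrightarrow> x \<in> A \<Longrightarrow> norm (f x z) \<le> w x"
      using dom[OF a] by blast
    have "uniform_limit (cball a r) (\<lambda>X z. \<Sum>x\<in>X. f x z) (\<lambda>z. \<Sum>\<^sub>\<infinity>x\<in>A. f x z) (finite_subsets_at_top A)"
      by (rule Weierstrass_m_test_general[OF bd w])
    moreover have "\<forall>\<^sub>F X in finite_subsets_at_top A. continuous_on (cball a r) (\<lambda>z. \<Sum>x\<in>X. f x z) \<and>
        (\<lambda>z. \<Sum>x\<in>X. f x z) holomorphic_on ball a r"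
    proof (rule eventually_finite_subsets_at_top_weakI, intro conjI)
      fix X assume X: "finite X" "X \<subseteq> A"
      have *: "(\<lambda>z. \<Sum>x\<in>X. f x z) holomorphic_on cball a r"
        using X r(2) hol by (intro holomorphic_on_sum holomorphic_on_subset[OF hol]) auto
      show "continuous_on (cball a r) (\<lambda>z. \<Sum>x\<in>X. f x z)"
        using * by (rule holomorphic_on_imp_continuous_on)
      show "(\<lambda>z. \<Sum>x\<in>X. f x z) holomorphic_on ball a r"
        using * by (rule holomorphic_on_subset) auto
    qed
    ultimately have "(\<lambda>z. \<Sum>\<^sub>\<infinity>x\<in>A. f x z) holomorphic_on ball a r"
      by (elim holomorphic_uniform_limit) auto
    moreover have "a \<in> ball a r" using r(1) by simp
    ultimately show ?thesis using holomorphic_on_imp_differentiable_at open_ball by blast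
  qed
  thus ?thesis by (auto simp: holomorphic_on_def intro: field_differentiable_at_within)
qed

section \<open>Gamma integrals on a half-line\<close>

lemma of_real_powr_exp:
  assumes "x > 0"
  shows "complex_of_real x powr z = exp (z * of_real (ln x))"
  using assms by (simp add: powr_def Ln_of_real)

lemma norm_of_real_powr:
  assumes "x > 0"
  shows "norm (complex_of_real x powr z) = x powr Re z"
  using assms by (simp add: of_real_powr_exp norm_exp_eq_Re powr_def)

lemma continuous_on_of_real_powr [continuous_intros]:
  "continuous_on {0<..} (\<lambda>t. complex_of_real t powr z)"
proof -
  have "continuous_on {0<..} (\<lambda>t. exp (z * complex_of_real (ln t)))"
    by (intro continuous_intros) auto
  thus ?thesis by (rule continuous_on_eq) (simp add: of_real_powr_exp)
qed

lemma of_real_powr_mult_left: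
  assumes "c > 0" "x > 0"
  shows "complex_of_real (c * x) powr z = of_real c powr z * of_real x powr z"
  using assms by (simp add: of_real_powr_exp ln_mult exp_add [symmetric] ring_distribs del: of_real_mult)

lemma of_real_powr_power2:
  assumes "x > 0"
  shows "complex_of_real (x\<^sup>2) powr z = of_real x powr (2 * z)"
  using assms by (simp add: of_real_powr_exp ln_realpow algebra_simps del: of_real_power)

text \<open>The identity theorem, with the limit point 1 of the positive half-line. It carries
  integral formulas that real calculus proves for positive parameters over to complex ones.\<close>

lemma holomorphic_eq_of_eq_on_pos_reals:
  assumes "f holomorphic_on S" "g holomorphic_on S" "open S" "connected S"
    and sub: "\<And>x. x > 0 \<Longrightarrow> complex_of_real x \<in> S"
    and eq: "\<And>x. x > 0 \<Longrightarrow> f (of_real x) = g (of_real x)"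
    and "z \<in> S"
  shows "f z = g z"
proof -
  have "f z - g z = 0"
  proof (rule analytic_continuation[where f = "\<lambda>z. f z - g z" and S = S and U = "of_real ` {0<..}" and \<xi> = 1])
    show "1 islimpt complex_of_real ` {0<..}"
      unfolding islimpt_approachable
    proof (intro allI impI)
      fix e :: real assume e: "e > 0"
      show "\<exists>x'\<in>complex_of_real ` {0<..}. x' \<noteq> 1 \<and> dist x' 1 < e"
      proof (rule bexI)
        have "1 + e / 2 \<in> {0<..}" using e by simp
        thus "complex_of_real (1 + e / 2) \<in> complex_of_real ` {0<..}" by (rule imageI)
      qed (use e in \<open>auto simp: dist_norm\<close>)
    qed
  qed (use assms sub[of 1] in \<open>auto intro!: holomorphic_intros\<close>)
  thus ?thesis by simp
qed

lemma set_integrable_pos_bound: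
  fixes f :: "real \<Rightarrow> 'a::euclidean_space"
  assumes "continuous_on {0<..} f" "set_integrable lborel {0<..} g" "\<And>x. x > 0 \<Longrightarrow> norm (f x) \<le> g x"
  shows "set_integrable lborel {0<..} f"
proof (rule set_integrable_bound[OF assms(2)])
  show "set_borel_measurable lborel {0<..} f"
    using set_measurable_continuous_on[OF _ assms(1)] by (simp add: set_borel_measurable_def)
qed (use assms(3) in \<open>force intro!: AE_I2\<close>)

lemma pos_scale_indicator:
  assumes "c > (0::real)"
  shows "indicator {0<..} (c * x) = (indicator {0<..} x :: real)"
  using assms by (auto simp: indicator_def zero_less_mult_iff)

lemma set_integral_pos_scale:
  fixes f :: "real \<Rightarrow> 'a::euclidean_space"
  assumes "c > 0"
  shows "(LBINT x:{0<..}. f x) = c *\<^sub>R (LBINT x:{0<..}. f (c * x))"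
  using lborel_integral_real_affine[of c "\<lambda>x. indicator {0<..} x *\<^sub>R f x" 0] assms
  by (simp add: set_lebesgue_integral_def pos_scale_indicator)

lemma set_integrable_powr_exp:
  assumes "a > 0" "b > 0"
  shows "set_integrable lborel {0<..} (\<lambda>t::real. t powr (a - 1) * exp (- b * t))"
proof -
  have "(\<lambda>t. complex_of_real t powr (of_real a - 1) / of_real (exp (b * t))) absolutely_integrable_on {0<..}"
    using assms by (intro absolutely_integrable_Gamma_integral) auto
  hence "set_integrable lebesgue {0<..} (\<lambda>t. complex_of_real t powr (of_real a - 1) / of_real (exp (b * t)))" .
  hence "set_integrable lebesgue {0<..} (\<lambda>t. norm (complex_of_real t powr (of_real a - 1) / of_real (exp (b * t))))"
    by (rule set_integrable_norm)
  moreover have "set_integrable lebesgue {0<..} (\<lambda>t. norm (complex_of_real t powr (of_real a - 1) / of_real (exp (b * t))))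
      = set_integrable lebesgue {0<..} (\<lambda>t::real. t powr (a - 1) * exp (- b * t))"
    by (rule set_integrable_cong) (auto simp: norm_divide norm_of_real_powr exp_minus field_simps)
  ultimately have *: "integrable lebesgue (\<lambda>t::real. indicator {0<..} t *\<^sub>R (t powr (a - 1) * exp (- b * t)))"
    unfolding set_integrable_def by simp
  show ?thesis unfolding set_integrable_def
    using * by (subst (asm) integrable_completion) auto
qed

lemma set_integrable_cpowr_exp:
  assumes "Re z > 0" "Re \<rho> > 0"
  shows "set_integrable lborel {0<..} (\<lambda>t. of_real t powr (z - 1) * exp (- \<rho> * of_real t))"
  using set_integrable_powr_exp[OF assms]
  by (rule set_integrable_pos_bound[rotated]) (auto intro!: continuous_intros simp: norm_mult norm_of_real_powr norm_exp_eq_Re)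

lemma Gamma_set_integral:
  assumes "Re z > 0"
  shows "(LBINT t:{0<..}. of_real t powr (z - 1) * exp (- of_real t)) = Gamma z"
proof -
  have "set_integrable lborel {0<..} (\<lambda>t. of_real t powr (z - 1) * exp (- 1 * of_real t))"
    using assms by (intro set_integrable_cpowr_exp) auto
  hence "(LBINT t:{0<..}. of_real t powr (z - 1) * exp (- of_real t)) = integral {0<..} (\<lambda>t. of_real t powr (z - 1) * exp (- of_real t))"
    using set_borel_integral_eq_integral(2) by fastforce
  also have "\<dots> = integral {0<..} (\<lambda>t. of_real t powr (z - 1) / of_real (exp t))"
    by (rule integral_cong) (simp add: exp_minus divide_inverse exp_of_real)
  also have "\<dots> = Gamma z" using Gamma_integral_complex'[OF assms] by (rule integral_unique)
  finally show ?thesis .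
qed

text \<open>For positive \<open>\<rho>\<close> this is a rescaling of Euler's integral; both sides
  are holomorphic in the right half-plane, which gives complex \<open>\<rho>\<close> with the
  principal power.\<close>

lemma Gamma_set_integral_scaled:
  assumes z: "Re z > 0" and \<rho>: "Re \<rho> > 0"
  shows "(LBINT t:{0<..}. of_real t powr (z - 1) * exp (- \<rho> * of_real t)) = Gamma z * \<rho> powr (- z)"
proof (rule holomorphic_eq_of_eq_on_pos_reals[where S = "{x. Re x > 0}" and z = \<rho>
      and f = "\<lambda>\<rho>. LBINT t:{0<..}. of_real t powr (z - 1) * exp (- \<rho> * of_real t)"
      and g = "\<lambda>\<rho>. Gamma z * \<rho> powr (- z)"])
  show "(\<lambda>\<rho>. LBINT t:{0<..}. of_real t powr (z - 1) * exp (- \<rho> * of_real t)) holomorphic_on {x. Re x > 0}"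
    unfolding set_lebesgue_integral_def
  proof (rule holomorphic_on_integral)
    fix a :: complex assume a: "a \<in> {x. Re x > 0}"
    show "\<exists>r>0. \<exists>w. cball a r \<subseteq> {x. Re x > 0} \<and> integrable lborel w \<and>
        (\<forall>\<rho>\<in>cball a r. \<forall>x\<in>space lborel. norm (indicat_real {0<..} x *\<^sub>R (of_real x powr (z - 1) * exp (- \<rho> * of_real x))) \<le> w x)"
    proof (intro exI[of _ "Re a / 2"] exI[of _ "\<lambda>x. indicator {0<..} x *\<^sub>R (x powr (Re z - 1) * exp (- (Re a / 2) * x))"] conjI ballI)
      have *: "Re y \<ge> Re a / 2" if "y \<in> cball a (Re a / 2)" for y
        using that abs_Re_le_cmod[of "a - y"] by (simp add: dist_norm)
      show "cball a (Re a / 2) \<subseteq> {x. Re x > 0}" using * a by force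
      show "integrable lborel (\<lambda>x. indicat_real {0<..} x *\<^sub>R (x powr (Re z - 1) * exp (- (Re a / 2) * x)))"
        using set_integrable_powr_exp[of "Re z" "Re a / 2"] z a by (simp add: set_integrable_def)
      fix y x assume y: "y \<in> cball a (Re a / 2)"
      show "norm (indicat_real {0<..} x *\<^sub>R (of_real x powr (z - 1) * exp (- y * of_real x)))
          \<le> indicator {0<..} x *\<^sub>R (x powr (Re z - 1) * exp (- (Re a / 2) * x))"
        using *[OF y] by (auto simp: indicator_def norm_mult norm_of_real_powr norm_exp_eq_Re intro!: mult_left_mono mult_right_mono)
    qed (use a in auto)
  qed (auto intro!: holomorphic_intros borel_measurable_continuous_on_indicator continuous_intros open_halfspace_Re_gt)
  show "(\<lambda>\<rho>. Gamma z * \<rho> powr (- z)) holomorphic_on {x. Re x > 0}"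
    by (intro holomorphic_intros) (auto simp: complex_nonpos_Reals_iff)
next
  fix x :: real assume x: "x > 0"
  have "Gamma z = (LBINT t:{0<..}. of_real t powr (z - 1) * exp (- of_real t))"
    using Gamma_set_integral[OF z] by simp
  also have "\<dots> = x *\<^sub>R (LBINT t:{0<..}. of_real (x * t) powr (z - 1) * exp (- of_real (x * t)))"
    by (rule set_integral_pos_scale[OF x])
  also have "(LBINT t:{0<..}. of_real (x * t) powr (z - 1) * exp (- of_real (x * t))) =
      (LBINT t:{0<..}. of_real x powr (z - 1) * (of_real t powr (z - 1) * exp (- of_real x * of_real t)))"
    by (rule set_lebesgue_integral_cong) (use x in \<open>auto simp: of_real_powr_mult_left simp del: of_real_mult\<close>, simp)
  also have "x *\<^sub>R \<dots> = of_real x powr z * (LBINT t:{0<..}. of_real t powr (z - 1) * exp (- of_real x * of_real t))"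
  proof -
    have "of_real x * of_real x powr (z - 1) = of_real x powr z" using x by (simp add: powr_diff)
    thus ?thesis unfolding set_integral_mult_right scaleR_conv_of_real by (simp only: mult.assoc [symmetric])
  qed
  finally show "(LBINT t:{0<..}. of_real t powr (z - 1) * exp (- of_real x * of_real t)) = Gamma z * of_real x powr (- z)"
    using x by (simp add: powr_minus field_simps)
qed (use \<rho> in \<open>auto simp: open_halfspace_Re_gt convex_connected convex_halfspace_Re_gt\<close>)

lemma set_integrable_powr_exp_quadratic:
  fixes b m :: real
  assumes "a > 0" "b > 0"
  shows "set_integrable lborel {0<..} (\<lambda>t::real. t powr (a - 1) * exp (m * t - b * t\<^sup>2))"
proof (rule set_integrable_pos_bound[where g = "\<lambda>t. exp ((m + 1)\<^sup>2 / (4 * b)) * (t powr (a - 1) * exp (- 1 * t))"])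
  fix t :: real assume t: "t > 0"
  \<comment> \<open>Completing the square for \<open>(m + 1) * t\<close> instead of
    \<open>m * t\<close> leaves a spare factor \<open>exp (- t)\<close>, so that a Gamma integrand
    is the majorant for either sign of \<open>m\<close>.\<close>
  have "0 \<le> b * (t - (m + 1) / (2 * b))\<^sup>2" using assms by simp
  also have "\<dots> = b * t\<^sup>2 - (m + 1) * t + (m + 1)\<^sup>2 / (4 * b)"
    using assms by (simp add: field_simps power2_eq_square)
  finally have "exp (m * t - b * t\<^sup>2) \<le> exp ((m + 1)\<^sup>2 / (4 * b) - t)" by (simp add: algebra_simps)
  thus "norm (t powr (a - 1) * exp (m * t - b * t\<^sup>2)) \<le> exp ((m + 1)\<^sup>2 / (4 * b)) * (t powr (a - 1) * exp (- 1 * t))"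
    using mult_left_mono[of "exp (m * t - b * t\<^sup>2)" "exp ((m + 1)\<^sup>2 / (4 * b) - t)" "t powr (a - 1)"]
    by (simp add: exp_diff exp_minus field_simps)
next
  show "continuous_on {0<..} (\<lambda>t. t powr (a - 1) * exp (m * t - b * t\<^sup>2))"
    by (intro continuous_intros) auto
  show "set_integrable lborel {0<..} (\<lambda>t. exp ((m + 1)\<^sup>2 / (4 * b)) * (t powr (a - 1) * exp (- 1 * t)))"
    by (intro set_integrable_mult_right impI set_integrable_powr_exp assms) auto
qed

lemma set_integrable_cpowr_gauss:
  assumes "Re s > 0" "Re \<rho> > 0"
  shows "set_integrable lborel {0<..} (\<lambda>t. of_real t powr (s - 1) * exp (\<mu> * of_real t - \<rho> * of_real t ^ 2))"
  using set_integrable_powr_exp_quadratic[OF assms, of "Re \<mu>"]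
  by (rule set_integrable_pos_bound[rotated])
     (auto intro!: continuous_intros simp: norm_mult norm_of_real_powr norm_exp_eq_Re simp flip: of_real_power)

lemma Gamma_set_integral_gauss:
  assumes z: "Re z > 0" and \<rho>: "Re \<rho> > 0"
  shows "(LBINT t:{0<..}. of_real t powr (z - 1) * exp (- \<rho> * of_real t ^ 2)) = 1 / 2 * Gamma (z / 2) * \<rho> powr (- z / 2)"
proof -
  define f where "f = (\<lambda>u::real. 1 / 2 * (of_real u powr (z / 2 - 1) * exp (- \<rho> * of_real u)))"
  have eq: "(2 * x) *\<^sub>R f (x\<^sup>2) = of_real x powr (z - 1) * exp (- \<rho> * of_real x ^ 2)" if "x > 0" for x :: real
  proof -
    have "of_real x powr (z - 1) = of_real x * of_real x powr (z - 2)"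
      using that by (simp add: powr_diff power2_eq_square)
    moreover have "of_real (x\<^sup>2) powr (z / 2 - 1) = of_real x powr (z - 2)"
      using that by (subst of_real_powr_power2) (auto simp: algebra_simps)
    ultimately show ?thesis by (simp add: f_def scaleR_conv_of_real)
  qed
  have "(LBINT x=0..\<infinity>. f x) = (LBINT x=0..\<infinity>. (2 * x) *\<^sub>R f (x\<^sup>2))"
  proof (rule interval_integral_substitution_integrable)
    show "DERIV (\<lambda>x. x\<^sup>2) x :> 2 * x" for x :: real
      by (auto intro!: derivative_eq_intros)
    fix x :: real assume "0 < ereal x"
    hence x: "x > 0" by simp
    have "continuous_on {0<..} f" unfolding f_def by (intro continuous_intros)
    thus "isCont f (x\<^sup>2)" using x by (simp add: continuous_on_eq_continuous_at)
  next
    show "set_integrable lborel (einterval 0 \<infinity>) (\<lambda>x. (2 * x) *\<^sub>R f (x\<^sup>2))"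
    proof -
      have "set_integrable lborel {0<..} (\<lambda>x. of_real x powr (z - 1) * exp (- \<rho> * of_real x ^ 2))"
        using set_integrable_cpowr_gauss[OF z \<rho>, of 0] by simp
      also have "?this = set_integrable lborel {0<..} (\<lambda>x. (2 * x) *\<^sub>R f (x\<^sup>2))"
        by (rule set_integrable_cong) (simp_all add: eq)
      finally show ?thesis by (simp add: zero_ereal_def)
    qed
    show "set_integrable lborel (einterval 0 \<infinity>) f"
      using set_integrable_cpowr_exp[of "z / 2" \<rho>] z \<rho> unfolding f_def
      by (simp add: zero_ereal_def)
    have "((\<lambda>x::real. x\<^sup>2) \<longlongrightarrow> 0\<^sup>2) (at_right 0)" by (intro tendsto_intros)
    thus "((ereal \<circ> (\<lambda>x::real. x\<^sup>2) \<circ> real_of_ereal) \<longlongrightarrow> 0) (at_right 0)"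
      unfolding zero_ereal_def by (simp add: ereal_tendsto_simps)
    have "filterlim (\<lambda>x::real. x\<^sup>2) at_top at_top" by real_asymp
    thus "((ereal \<circ> (\<lambda>x::real. x\<^sup>2) \<circ> real_of_ereal) \<longlongrightarrow> \<infinity>) (at_left \<infinity>)"
      by (simp add: ereal_tendsto_simps)
  qed (auto simp: zero_ereal_def)
  also have "\<dots> = (LBINT x:{0<..}. of_real x powr (z - 1) * exp (- \<rho> * of_real x ^ 2))"
    unfolding interval_lebesgue_integral_0_infty by (rule set_lebesgue_integral_cong) (simp_all add: eq)
  also have "(LBINT x=0..\<infinity>. f x) = 1 / 2 * (LBINT u:{0<..}. of_real u powr (z / 2 - 1) * exp (- \<rho> * of_real u))"
    unfolding interval_lebesgue_integral_0_infty f_def by simp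
  also have "\<dots> = 1 / 2 * Gamma (z / 2) * \<rho> powr (- z / 2)"
    using Gamma_set_integral_scaled[of "z / 2" \<rho>] z \<rho> by simp
  finally show ?thesis by simp
qed

section \<open>Termwise integration and Taylor bounds for the exponential\<close>

lemma sums_integral_dominated:
  fixes f :: "nat \<Rightarrow> 'a \<Rightarrow> 'b::{banach, second_countable_topology}"
  assumes meas: "\<And>i. f i \<in> borel_measurable M" and w: "integrable M w"
    and sums: "\<And>x. x \<in> space M \<Longrightarrow> (\<lambda>i. f i x) sums F x"
    and bd: "\<And>x n. x \<in> space M \<Longrightarrow> norm (\<Sum>i<n. f i x) \<le> w x"
  shows "(\<lambda>i. integral\<^sup>L M (f i)) sums integral\<^sup>L M F"
proof -
  have F: "F \<in> borel_measurable M"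
    by (rule borel_measurable_LIMSEQ_metric[where f = "\<lambda>n x. \<Sum>i<n. f i x"])
       (use meas sums in \<open>auto simp: sums_def\<close>)
  have int: "integrable M (f i)" for i
  proof (rule Bochner_Integration.integrable_bound[OF Bochner_Integration.integrable_mult_right[OF w, of 2] meas])
    show "AE x in M. norm (f i x) \<le> norm (2 * w x)"
    proof (rule AE_I2)
      fix x assume x: "x \<in> space M"
      \<comment> \<open>A term is the difference of two consecutive partial sums, each bounded by
        \<open>w x\<close>; hence the factor 2.\<close>
      have "f i x = (\<Sum>i<Suc i. f i x) - (\<Sum>i<i. f i x)" by simp
      also have "norm \<dots> \<le> w x + w x" using norm_triangle_ineq4 bd[OF x] by (meson add_mono order.trans)
      finally show "norm (f i x) \<le> norm (2 * w x)" by simp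
    qed
  qed
  have "(\<lambda>n. \<integral>x. (\<Sum>i<n. f i x) \<partial>M) \<longlonglongrightarrow> integral\<^sup>L M F"
    by (rule integral_dominated_convergence[where w = w])
       (use meas sums w bd F in \<open>auto simp: sums_def intro!: AE_I2\<close>)
  thus ?thesis using int by (simp add: sums_def)
qed

text \<open>Expanding \<open>exp (\<mu> * t)\<close> is legitimate because the series of absolute
  values, \<open>exp (norm \<mu> * t)\<close>, is still beaten by the Gaussian. Comparing
  coefficients of this series rotates the ray in \<open>gauss_fourier_eq_ray\<close>, and the same
  series is recognized as Kummer's in \<open>cos_transform_kummer\<close>.\<close>

lemma gauss_integral_sums:
  assumes s: "Re s > 0" and \<rho>: "Re \<rho> > 0"
  shows "(\<lambda>k. \<mu> ^ k / fact k * (1 / 2 * Gamma ((s + of_nat k) / 2) * \<rho> powr (- (s + of_nat k) / 2))) sums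
           (LBINT t:{0<..}. of_real t powr (s - 1) * exp (\<mu> * of_real t - \<rho> * of_real t ^ 2))"
proof -
  let ?g = "\<lambda>t. of_real t powr (s - 1) * exp (- \<rho> * of_real t ^ 2)"
  have *: "(\<lambda>k. LBINT t:{0<..}. ?g t * ((\<mu> * of_real t) ^ k / fact k)) sums
           (LBINT t:{0<..}. ?g t * exp (\<mu> * of_real t))"
    unfolding set_lebesgue_integral_def
  proof (rule sums_integral_dominated[where w = "\<lambda>t. indicator {0<..} t *\<^sub>R (t powr (Re s - 1) * exp (norm \<mu> * t - Re \<rho> * t\<^sup>2))"])
    show "(\<lambda>t. indicat_real {0<..} t *\<^sub>R (?g t * ((\<mu> * complex_of_real t) ^ i / fact i))) \<in> borel_measurable lborel" for i
    proof -
      have "(\<lambda>t. indicat_real {0<..} t *\<^sub>R (?g t * ((\<mu> * complex_of_real t) ^ i / fact i))) \<in> borel_measurable borel"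
        by (intro borel_measurable_continuous_on_indicator continuous_intros) auto
      thus ?thesis by simp
    qed
    show "integrable lborel (\<lambda>t. indicat_real {0<..} t *\<^sub>R (t powr (Re s - 1) * exp (norm \<mu> * t - Re \<rho> * t\<^sup>2)))"
      using set_integrable_powr_exp_quadratic[OF s \<rho>] by (simp add: set_integrable_def)
    fix t :: real
    have "(\<lambda>k. (\<mu> * of_real t) ^ k / fact k) sums exp (\<mu> * of_real t)"
      using exp_converges[of "\<mu> * of_real t"] by (simp add: scaleR_conv_of_real divide_inverse mult.commute)
    thus "(\<lambda>k. indicat_real {0<..} t *\<^sub>R (?g t * ((\<mu> * of_real t) ^ k / fact k))) sums
          (indicat_real {0<..} t *\<^sub>R (?g t * exp (\<mu> * of_real t)))"
      by (intro sums_scaleR_right sums_mult)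
    fix n
    show "norm (\<Sum>k<n. indicat_real {0<..} t *\<^sub>R (?g t * ((\<mu> * of_real t) ^ k / fact k)))
        \<le> indicator {0<..} t *\<^sub>R (t powr (Re s - 1) * exp (norm \<mu> * t - Re \<rho> * t\<^sup>2))"
    proof (cases "t > 0")
      case True
      have "norm (\<Sum>k<n. ?g t * ((\<mu> * of_real t) ^ k / fact k)) = norm (?g t) * norm (\<Sum>k<n. (\<mu> * of_real t) ^ k / fact k)"
        by (simp only: norm_mult sum_distrib_left [symmetric])
      also have "norm (\<Sum>k<n. (\<mu> * of_real t) ^ k / fact k) \<le> (\<Sum>k<n. (norm \<mu> * t) ^ k / fact k)"
        using True by (intro order.trans[OF norm_sum] sum_mono) (simp add: norm_divide norm_power norm_mult power_mult_distrib)
      also have "\<dots> \<le> exp (norm \<mu> * t)"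
      proof -
        have "(\<lambda>k. (norm \<mu> * t) ^ k / fact k) sums exp (norm \<mu> * t)"
          using exp_converges[of "norm \<mu> * t"] by (simp add: divide_inverse mult.commute)
        thus ?thesis using True by (subst sums_unique) (auto intro!: sum_le_suminf simp: sums_iff)
      qed
      also have "norm (?g t) = t powr (Re s - 1) * exp (- Re \<rho> * t\<^sup>2)"
        using True by (simp add: norm_mult norm_of_real_powr norm_exp_eq_Re flip: of_real_power)
      finally show ?thesis using True by (simp add: exp_diff exp_minus field_simps)
    qed auto
  qed
  have 1: "(LBINT t:{0<..}. ?g t * ((\<mu> * of_real t) ^ k / fact k)) =
      \<mu> ^ k / fact k * (1 / 2 * Gamma ((s + of_nat k) / 2) * \<rho> powr (- (s + of_nat k) / 2))" for k
  proof -
    have "(LBINT t:{0<..}. ?g t * ((\<mu> * of_real t) ^ k / fact k)) =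
        (LBINT t:{0<..}. \<mu> ^ k / fact k * (of_real t powr (s + of_nat k - 1) * exp (- \<rho> * of_real t ^ 2)))"
    proof (rule set_lebesgue_integral_cong, simp, intro allI impI)
      fix t :: real assume "t \<in> {0<..}"
      hence t: "t > 0" by simp
      have "of_real t powr (s + of_nat k - 1) = of_real t powr (s - 1) * of_real t ^ k"
        using t powr_add[of "of_real t :: complex" "s - 1" "of_nat k"] by (simp add: powr_nat' algebra_simps)
      thus "?g t * ((\<mu> * of_real t) ^ k / fact k) = \<mu> ^ k / fact k * (of_real t powr (s + of_nat k - 1) * exp (- \<rho> * of_real t ^ 2))"
        by (simp add: power_mult_distrib)
    qed
    also have "\<dots> = \<mu> ^ k / fact k * (LBINT t:{0<..}. of_real t powr (s + of_nat k - 1) * exp (- \<rho> * of_real t ^ 2))"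
      by (rule set_integral_mult_right)
    also have "(LBINT t:{0<..}. of_real t powr (s + of_nat k - 1) * exp (- \<rho> * of_real t ^ 2)) =
        1 / 2 * Gamma ((s + of_nat k) / 2) * \<rho> powr (- (s + of_nat k) / 2)"
      using s \<rho> by (intro Gamma_set_integral_gauss) auto
    finally show ?thesis .
  qed
  have 2: "(LBINT t:{0<..}. ?g t * exp (\<mu> * of_real t)) =
     (LBINT t:{0<..}. of_real t powr (s - 1) * exp (\<mu> * of_real t - \<rho> * of_real t ^ 2))"
    by (rule set_lebesgue_integral_cong) (auto simp: exp_diff exp_minus field_simps)
  show ?thesis using * unfolding 1 2 .
qed

lemma norm_exp_minus_1_le:
  assumes "Re z \<ge> 0"
  shows "norm (exp (- z) - 1) \<le> norm z"
proof -
  have "norm (exp (- z) - exp (- 0)) \<le> 1 * norm (z - 0)"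
  proof (rule field_differentiable_bound[where S = "{z. Re z \<ge> 0}" and f' = "\<lambda>z. - exp (- z)"])
    show "((\<lambda>z. exp (- z)) has_field_derivative - exp (- w)) (at w within {z. 0 \<le> Re z})" for w
      by (auto intro!: derivative_eq_intros)
  qed (use assms in \<open>auto simp: norm_exp_eq_Re convex_halfspace_Re_ge\<close>)
  thus ?thesis by simp
qed

text \<open>Mean value estimate: the derivative \<open>1 - exp (- w)\<close> is controlled by
  \<open>norm_exp_minus_1_le\<close>, and cutting the half-plane by the disc of radius
  \<open>norm z\<close> makes that control uniform.\<close>

lemma norm_exp_minus_2_le:
  assumes "Re z \<ge> 0"
  shows "norm (exp (- z) - 1 + z) \<le> norm z ^ 2"
proof -
  let ?S = "{w. Re w \<ge> 0} \<inter> cball 0 (norm z)"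
  have "norm ((exp (- z) - 1 + z) - (exp (- 0) - 1 + 0)) \<le> norm z * norm (z - 0)"
  proof (rule field_differentiable_bound[where S = ?S and f' = "\<lambda>z. 1 - exp (- z)"])
    show "((\<lambda>z. exp (- z) - 1 + z) has_field_derivative 1 - exp (- w)) (at w within ?S)" for w
      by (auto intro!: derivative_eq_intros)
    show "norm (1 - exp (- w)) \<le> norm z" if "w \<in> ?S" for w
      using norm_exp_minus_1_le[of w] that by (simp add: norm_minus_commute)
    show "convex ?S" by (intro convex_Int convex_halfspace_Re_ge convex_cball)
  qed (use assms in auto)
  thus ?thesis by (simp add: power2_eq_square)
qed

section \<open>The cosine transform of a power times a Gaussian\<close>

text \<open>
  On the ray \<open>w * t\<close> with \<open>w = exp (\<eta> * pi / 8)\<close> and \<open>\<eta> = \<plusminus>\<i>\<close> the factor \<open>exp (\<eta> * y * u)\<close> decays, while \<open>w\<^sup>2\<close>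
  still has positive real part. The first two Taylor terms of the Gaussian are subtracted;
  what is left is of order \<open>t ^ 4\<close> at \<open>0\<close>, which permits \<open>Re s > -4\<close>.
\<close>

definition ray_integrand :: "complex \<Rightarrow> complex \<Rightarrow> real \<Rightarrow> real \<Rightarrow> complex" where
  "ray_integrand \<eta> s y t = of_real t powr (s - 1) *
     (exp (- exp (\<eta> * pi / 4) * of_real t ^ 2) - 1 + exp (\<eta> * pi / 4) * of_real t ^ 2) *
     exp (\<eta> * exp (\<eta> * pi / 8) * of_real (y * t))"

text \<open>The prefactor is \<open>w powr s\<close> for \<open>w = exp (\<eta> * pi / 8)\<close>:
  the substitution \<open>u = w * t\<close> collects it from \<open>u powr (s - 1)\<close> and the
  differential.\<close>

definition ray_rem :: "complex \<Rightarrow> complex \<Rightarrow> real \<Rightarrow> complex" where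
  "ray_rem \<eta> s y = exp (\<eta> * pi * s / 8) * (LBINT t:{0<..}. ray_integrand \<eta> s y t)"

lemma exp_quarter_props:
  assumes "\<eta> = \<i> \<or> \<eta> = -\<i>"
  shows "Re (exp (\<eta> * pi / 4)) > 0" "norm (exp (\<eta> * pi / 4)) = 1"
    "Re (\<eta> * exp (\<eta> * pi / 8)) = - sin (pi / 8)"
proof -
  have "cos (pi / 4) > 0" by (intro cos_gt_zero) auto
  thus "Re (exp (\<eta> * pi / 4)) > 0" "norm (exp (\<eta> * pi / 4)) = 1" "Re (\<eta> * exp (\<eta> * pi / 8)) = - sin (pi / 8)"
    using assms by (auto simp: Re_exp Im_exp norm_exp_eq_Re)
qed

lemma sin_pi_8_pos: "sin (pi / 8) > 0"
  by (intro sin_gt_zero) auto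

text \<open>The Taylor remainder of the Gaussian contributes \<open>t ^ 4\<close>, and turning the
  ray by \<open>pi / 8\<close> makes the oscillating factor decay at rate
  \<open>y * sin (pi / 8)\<close>. The exponent is left as \<open>Re s + 4 - 1\<close> to display a
  Gamma integrand of parameter \<open>Re s + 4\<close>.\<close>

lemma norm_ray_integrand_le:
  assumes \<eta>: "\<eta> = \<i> \<or> \<eta> = -\<i>" and t: "t > 0"
  shows "norm (ray_integrand \<eta> s y t) \<le> t powr (Re s + 4 - 1) * exp (- (y * sin (pi / 8)) * t)"
proof -
  let ?w = "exp (\<eta> * pi / 4) * of_real t ^ 2"
  have "Re ?w = Re (exp (\<eta> * pi / 4)) * t ^ 2"
    by (simp flip: of_real_power)
  hence "norm (exp (- ?w) - 1 + ?w) \<le> norm ?w ^ 2"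
    using exp_quarter_props(1)[OF \<eta>] by (intro norm_exp_minus_2_le) simp
  also have "norm ?w = t ^ 2" using exp_quarter_props(2)[OF \<eta>] by (simp add: norm_mult norm_power)
  finally have 1: "norm (exp (- ?w) - 1 + ?w) \<le> t ^ 4" by simp
  have 2: "norm (exp (\<eta> * exp (\<eta> * pi / 8) * of_real (y * t))) = exp (- (y * sin (pi / 8)) * t)"
  proof -
    have "Re (\<eta> * exp (\<eta> * pi / 8) * of_real (y * t)) = Re (\<eta> * exp (\<eta> * pi / 8)) * (y * t)"
      by (simp only: Re_complex_of_real Im_complex_of_real times_complex.sel)
    thus ?thesis unfolding norm_exp_eq_Re exp_quarter_props(3)[OF \<eta>] by (simp add: mult_ac)
  qed
  have 3: "norm (of_real t powr (s - 1)) * t ^ 4 = t powr (Re s + 4 - 1)"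
    using t powr_add[of t "Re s - 1" 4] by (simp add: norm_of_real_powr algebra_simps flip: powr_numeral)
  have "norm (ray_integrand \<eta> s y t) = norm (of_real t powr (s - 1)) * norm (exp (- ?w) - 1 + ?w) * exp (- (y * sin (pi / 8)) * t)"
    unfolding ray_integrand_def norm_mult 2 by simp
  also have "\<dots> \<le> norm (of_real t powr (s - 1)) * t ^ 4 * exp (- (y * sin (pi / 8)) * t)"
    by (intro mult_right_mono mult_left_mono 1) auto
  finally show ?thesis by (simp only: 3)
qed

lemma continuous_on_ray_integrand: "continuous_on {0<..} (ray_integrand \<eta> s y)"
  unfolding ray_integrand_def by (intro continuous_intros)

lemma set_integrable_ray:
  assumes "\<eta> = \<i> \<or> \<eta> = -\<i>" "y > 0" "Re s > -4"
  shows "set_integrable lborel {0<..} (ray_integrand \<eta> s y)"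
proof (rule set_integrable_pos_bound[OF continuous_on_ray_integrand _ norm_ray_integrand_le[OF assms(1)]])
  show "set_integrable lborel {0<..} (\<lambda>t::real. t powr (Re s + 4 - 1) * exp (- (y * sin (pi / 8)) * t))"
    using assms sin_pi_8_pos by (intro set_integrable_powr_exp) auto
qed

lemma holomorphic_ray_rem:
  assumes \<eta>: "\<eta> = \<i> \<or> \<eta> = -\<i>" and y: "y > 0"
  shows "(\<lambda>s. ray_rem \<eta> s y) holomorphic_on {s. Re s > -4}"
proof -
  have "(\<lambda>s. LBINT t:{0<..}. ray_integrand \<eta> s y t) holomorphic_on {s. Re s > -4}"
    unfolding set_lebesgue_integral_def
  proof (rule holomorphic_on_integral)
    show "(\<lambda>t. indicat_real {0<..} t *\<^sub>R ray_integrand \<eta> s y t) \<in> borel_measurable lborel" for s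
      using borel_measurable_continuous_on_indicator[OF _ continuous_on_ray_integrand, of \<eta> s y] by simp
    show "(\<lambda>s. indicat_real {0<..} t *\<^sub>R ray_integrand \<eta> s y t) holomorphic_on {s. Re s > -4}" for t
      by (cases "t > 0") (auto simp: ray_integrand_def intro!: holomorphic_intros)
    fix a :: complex assume a: "a \<in> {s. Re s > -4}"
    define r where "r = (Re a + 4) / 2"
    have r: "r > 0" using a by (simp add: r_def)
    have ineq: "Re a - r \<le> Re z \<and> Re z \<le> Re a + r" if "z \<in> cball a r" for z
    proof -
      have "\<bar>Re a - Re z\<bar> \<le> r" using that abs_Re_le_cmod[of "a - z"] by (simp add: dist_norm)
      thus ?thesis by (simp add: abs_le_iff)
    qed
    let ?f = "\<lambda>c t::real. t powr (c + 4 - 1) * exp (- (y * sin (pi / 8)) * t)"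
    show "\<exists>r>0. \<exists>w. cball a r \<subseteq> {s. Re s > -4} \<and> integrable lborel w \<and>
        (\<forall>z\<in>cball a r. \<forall>t\<in>space lborel. norm (indicat_real {0<..} t *\<^sub>R ray_integrand \<eta> z y t) \<le> w t)"
    proof (intro exI[of _ r] exI[of _ "\<lambda>t. indicator {0<..} t *\<^sub>R (?f (Re a - r) t + ?f (Re a + r) t)"] conjI ballI r)
      show "cball a r \<subseteq> {s. Re s > -4}" using ineq r by (force simp: r_def field_simps)
      have "set_integrable lborel {0<..} (\<lambda>t. ?f (Re a - r) t + ?f (Re a + r) t)"
        by (intro set_integral_add set_integrable_powr_exp) (use r y sin_pi_8_pos in \<open>auto simp: r_def field_simps\<close>)
      thus "integrable lborel (\<lambda>t. indicat_real {0<..} t *\<^sub>R (?f (Re a - r) t + ?f (Re a + r) t))"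
        by (simp add: set_integrable_def)
      fix z t assume z: "z \<in> cball a r"
      have *: "norm (ray_integrand \<eta> z y t) \<le> ?f (Re a - r) t + ?f (Re a + r) t" if t: "t > 0"
      proof -
        \<comment> \<open>A power of \<open>t\<close> increases with the exponent for
          \<open>t \<ge> 1\<close> and decreases otherwise, so the sum of the two endpoint powers
          bounds it on the whole disc.\<close>
        have "t powr (Re z + 4 - 1) \<le> t powr (Re a - r + 4 - 1) + t powr (Re a + r + 4 - 1)"
        proof (cases "t \<ge> 1")
          case True
          thus ?thesis using ineq[OF z] by (intro order.trans[OF powr_mono add_increasing[OF _ order_refl]]) auto
        next
          case False
          thus ?thesis using ineq[OF z] t by (intro order.trans[OF powr_mono' add_increasing2[OF _ order_refl]]) auto
        qed
        hence "?f (Re z) t \<le> ?f (Re a - r) t + ?f (Re a + r) t"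
          unfolding distrib_right [symmetric] by (rule mult_right_mono) simp
        thus ?thesis using norm_ray_integrand_le[OF \<eta> t, of z y] by linarith
      qed
      show "norm (indicat_real {0<..} t *\<^sub>R ray_integrand \<eta> z y t) \<le> indicator {0<..} t *\<^sub>R (?f (Re a - r) t + ?f (Re a + r) t)"
        using * by (auto simp: indicator_def)
    qed
  qed (auto simp: open_halfspace_Re_gt)
  thus ?thesis unfolding ray_rem_def by (intro holomorphic_intros) auto
qed

text \<open>Scaling \<open>t\<close> by \<open>y\<close> pulls out
  \<open>y powr (- Re s - 4)\<close> and leaves an integral free of \<open>y\<close>. This exponent
  decides where the later remainder series converge; \<open>exp (pi * \<bar>Im s\<bar> / 8)\<close>
  bounds the rotation prefactor.\<close>

lemma norm_ray_rem_le:
  assumes \<eta>: "\<eta> = \<i> \<or> \<eta> = -\<i>" and y: "y > 0" and s: "Re s > -4"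
  shows "norm (ray_rem \<eta> s y) \<le> exp (pi * \<bar>Im s\<bar> / 8) * (LBINT t:{0<..}. t powr (Re s + 4 - 1) * exp (- sin (pi / 8) * t)) * y powr (- Re s - 4)"
proof -
  let ?b = "sin (pi / 8)"
  have b: "?b > 0" by (rule sin_pi_8_pos)
  let ?f = "\<lambda>t::real. t powr (Re s + 4 - 1) * exp (- ?b * t)"
  have int: "set_integrable lborel {0<..} (\<lambda>t::real. t powr (Re s + 4 - 1) * exp (- (y * ?b) * t))"
    using s y b by (intro set_integrable_powr_exp) auto
  have "norm (LBINT t:{0<..}. ray_integrand \<eta> s y t) \<le> (LBINT t:{0<..}. norm (ray_integrand \<eta> s y t))"
    using set_integral_norm_bound[OF set_integrable_ray[OF \<eta> y s]] .
  also have "\<dots> \<le> (LBINT t:{0<..}. t powr (Re s + 4 - 1) * exp (- (y * ?b) * t))"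
    by (intro set_integral_mono set_integrable_norm set_integrable_ray assms int norm_ray_integrand_le) auto
  also have "\<dots> = (LBINT t:{0<..}. y powr (- Re s - 3) * ?f (y * t))"
  proof (rule set_lebesgue_integral_cong, simp, intro allI impI)
    fix t :: real assume "t \<in> {0<..}"
    thus "t powr (Re s + 4 - 1) * exp (- (y * ?b) * t) = y powr (- Re s - 3) * ?f (y * t)"
      using y by (simp add: powr_mult powr_minus powr_diff powr_add field_simps)
  qed
  also have "\<dots> = y powr (- Re s - 3) * ((LBINT t:{0<..}. ?f t) / y)"
    using set_integral_pos_scale[OF y, of ?f] y by simp
  also have "\<dots> = (LBINT t:{0<..}. ?f t) * y powr (- Re s - 4)"
    using y powr_diff[of y "- Re s - 3" 1] by (simp add: field_simps)
  finally have *: "norm (LBINT t:{0<..}. ray_integrand \<eta> s y t) \<le> (LBINT t:{0<..}. ?f t) * y powr (- Re s - 4)" .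
  have "norm (exp (\<eta> * pi * s / 8)) \<le> exp (pi * \<bar>Im s\<bar> / 8)"
    using \<eta> mult_left_mono[OF abs_ge_minus_self[of "Im s"], of pi] by (auto simp: norm_exp_eq_Re)
  from mult_mono[OF this *] show ?thesis
    by (simp add: ray_rem_def norm_mult mult.assoc)
qed

text \<open>The rotation of the ray is a comparison of power series in \<open>y\<close>: in the k-th
  coefficient the factors \<open>exp (\<eta> * pi * s / 8)\<close>, \<open>?w ^ k\<close> and the
  power of \<open>exp (\<eta> * pi / 4)\<close> coming from the rotated Gaussian multiply to
  1.\<close>

lemma gauss_fourier_eq_ray:
  assumes \<eta>: "\<eta> = \<i> \<or> \<eta> = -\<i>" and s: "Re s > 0"
  shows "(LBINT t:{0<..}. of_real t powr (s - 1) * exp (\<eta> * of_real y * of_real t - of_real t ^ 2)) =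
     exp (\<eta> * pi * s / 8) * (LBINT t:{0<..}. of_real t powr (s - 1) *
        exp (\<eta> * of_real y * exp (\<eta> * pi / 8) * of_real t - exp (\<eta> * pi / 4) * of_real t ^ 2))"
proof -
  let ?w = "exp (\<eta> * pi / 8)"
  have powr: "exp (\<eta> * pi / 4) powr z = exp (z * (\<eta> * pi / 4))" for z
  proof -
    have "Ln (exp (\<eta> * pi / 4)) = \<eta> * pi / 4" using \<eta> by (intro Ln_exp) auto
    thus ?thesis by (simp only: powr_def exp_not_eq_zero if_False)
  qed
  have A: "(\<lambda>k. exp (\<eta> * pi * s / 8) * ((\<eta> * of_real y * ?w) ^ k / fact k * (1 / 2 * Gamma ((s + of_nat k) / 2) * exp (\<eta> * pi / 4) powr (- (s + of_nat k) / 2))))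
     sums (exp (\<eta> * pi * s / 8) * (LBINT t:{0<..}. of_real t powr (s - 1) *
        exp (\<eta> * of_real y * ?w * of_real t - exp (\<eta> * pi / 4) * of_real t ^ 2)))"
    by (intro sums_mult gauss_integral_sums s exp_quarter_props(1)[OF \<eta>])
  have B: "exp (\<eta> * pi * s / 8) * ((\<eta> * of_real y * ?w) ^ k / fact k * (1 / 2 * Gamma ((s + of_nat k) / 2) * exp (\<eta> * pi / 4) powr (- (s + of_nat k) / 2)))
      = (\<eta> * of_real y) ^ k / fact k * (1 / 2 * Gamma ((s + of_nat k) / 2) * 1 powr (- (s + of_nat k) / 2))" for k
  proof -
    have "exp (\<eta> * pi * s / 8) * (?w ^ k * exp (\<eta> * pi / 4) powr (- (s + of_nat k) / 2)) = 1"
      unfolding powr exp_of_nat_mult [symmetric] exp_add [symmetric] by (simp add: field_simps)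
    hence "(\<eta> * of_real y) ^ k / fact k * (1 / 2 * Gamma ((s + of_nat k) / 2)) * (exp (\<eta> * pi * s / 8) * (?w ^ k * exp (\<eta> * pi / 4) powr (- (s + of_nat k) / 2)))
       = (\<eta> * of_real y) ^ k / fact k * (1 / 2 * Gamma ((s + of_nat k) / 2))" by (simp only: mult_1_right)
    thus ?thesis by (simp only: power_mult_distrib powr_one_eq_one times_divide_eq_left times_divide_eq_right mult_ac mult_1_left)
  qed
  have C: "(\<lambda>k. (\<eta> * of_real y) ^ k / fact k * (1 / 2 * Gamma ((s + of_nat k) / 2) * 1 powr (- (s + of_nat k) / 2))) sums
      (LBINT t:{0<..}. of_real t powr (s - 1) * exp (\<eta> * of_real y * of_real t - 1 * of_real t ^ 2))"
    by (intro gauss_integral_sums s) auto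
  show ?thesis using sums_unique2[OF C A[unfolded B]] by simp
qed

text \<open>On the rotated ray the first two Taylor terms of the Gaussian split off as Gamma
  integrals. Their phase \<open>exp (\<eta> * pi * s / 2)\<close> is made of one eighth of
  \<open>pi\<close> from the ray and three eighths from \<open>\<rho> powr (- s)\<close>.\<close>

lemma gauss_fourier_expansion:
  assumes \<eta>: "\<eta> = \<i> \<or> \<eta> = -\<i>" and y: "y > 0" and s: "Re s > 0"
  shows "(LBINT t:{0<..}. of_real t powr (s - 1) * exp (\<eta> * of_real y * of_real t - of_real t ^ 2)) =
     Gamma s * exp (\<eta> * pi * s / 2) * of_real y powr (- s)
     - Gamma (s + 2) * exp (\<eta> * pi * (s + 2) / 2) * of_real y powr (- s - 2) + ray_rem \<eta> s y"
proof -
  let ?w = "exp (\<eta> * pi / 8)" and ?v = "exp (\<eta> * pi / 4)"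
  define \<rho> where "\<rho> = - (\<eta> * of_real y * ?w)"
  \<comment> \<open>Since \<open>- \<eta> = exp (- \<eta> * pi / 2)\<close>, the decay rate
    \<open>\<rho>\<close> has an argument of modulus \<open>3 * pi / 8\<close>. This is below
    \<open>pi / 2\<close>, so \<open>Re \<rho> > 0\<close>, and it lies in the principal strip, so
    powers of \<open>\<rho>\<close> can be read off.\<close>
  have \<rho>_eq: "\<rho> = exp (of_real (ln y) - 3 * \<eta> * pi / 8)"
  proof -
    have "- \<eta> = exp (- \<eta> * pi / 2)" using \<eta> exp_minus[of "\<i> * pi / 2"] exp_pi_i' by (auto simp: exp_eq_polar cis_conv_exp[symmetric])
    moreover have "\<rho> = of_real y * (- \<eta> * ?w)" by (simp add: \<rho>_def)
    ultimately have "\<rho> = of_real y * (exp (- \<eta> * pi / 2) * ?w)" by (simp only:)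
    also have "\<dots> = exp (of_real (ln y)) * exp (- \<eta> * pi / 2 + \<eta> * pi / 8)"
      using y by (simp only: exp_add exp_of_real exp_ln)
    also have "\<dots> = exp (of_real (ln y) + (- \<eta> * pi / 2 + \<eta> * pi / 8))" by (simp only: exp_add)
    finally show ?thesis by (simp add: algebra_simps)
  qed
  have Re\<rho>: "Re \<rho> > 0"
  proof -
    have "Re \<rho> = y * (- Re (\<eta> * ?w))" by (simp add: \<rho>_def algebra_simps)
    thus ?thesis using y sin_pi_8_pos by (simp only: exp_quarter_props(3)[OF \<eta>] minus_minus mult_pos_pos)
  qed
  have \<rho>_powr: "\<rho> powr z = exp (z * (of_real (ln y) - 3 * \<eta> * pi / 8))" for z
  proof -
    have "Ln \<rho> = of_real (ln y) - 3 * \<eta> * pi / 8" unfolding \<rho>_eq using \<eta> pi_gt_zero by (intro Ln_exp) (auto simp: field_simps)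
    thus ?thesis by (simp add: powr_def \<rho>_eq)
  qed
  have v2: "?v = exp (\<eta> * pi * 2 / 8)" by (simp add: field_simps)
  have moment: "exp (\<eta> * pi * z / 8) * (LBINT t:{0<..}. of_real t powr (z - 1) * exp (- \<rho> * of_real t)) =
      Gamma z * exp (\<eta> * pi * z / 2) * of_real y powr (- z)" if "Re z > 0" for z
  proof -
    have "exp (\<eta> * pi * z / 8) * \<rho> powr (- z) = exp (\<eta> * pi * z / 2) * of_real y powr (- z)"
      unfolding \<rho>_powr of_real_powr_exp[OF y] exp_add [symmetric] by (rule arg_cong[where f = exp]) (simp add: field_simps)
    thus ?thesis using Gamma_set_integral_scaled[OF that Re\<rho>] by simp
  qed
  have int: "set_integrable lborel {0<..} (\<lambda>t. of_real t powr (z - 1) * exp (- \<rho> * of_real t))" if "Re z > 0" for z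
    by (rule set_integrable_cpowr_exp[OF that Re\<rho>])
  have int3: "set_integrable lborel {0<..} (ray_integrand \<eta> s y)"
    using s by (intro set_integrable_ray \<eta> y) auto
  have "(LBINT t:{0<..}. of_real t powr (s - 1) * exp (\<eta> * of_real y * ?w * of_real t - ?v * of_real t ^ 2))
     = (LBINT t:{0<..}. (of_real t powr (s - 1) * exp (- \<rho> * of_real t)
          - ?v * (of_real t powr (s + 2 - 1) * exp (- \<rho> * of_real t))) + ray_integrand \<eta> s y t)"
  proof (rule set_lebesgue_integral_cong, simp, intro allI impI)
    fix t :: real assume "t \<in> {0<..}"
    hence t: "t > 0" by simp
    have 1: "of_real t powr (s + 2 - 1) = of_real t powr (s - 1) * of_real t ^ 2"
      using t powr_add[of "of_real t :: complex" "s - 1" 2] by (simp add: algebra_simps)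
    have 2: "exp (\<eta> * of_real y * ?w * of_real t - ?v * of_real t ^ 2) = exp (- \<rho> * of_real t) * exp (- ?v * of_real t ^ 2)"
      by (simp add: \<rho>_def exp_add [symmetric])
    have 3: "ray_integrand \<eta> s y t = of_real t powr (s - 1) * (exp (- ?v * of_real t ^ 2) - 1 + ?v * of_real t ^ 2) * exp (- \<rho> * of_real t)"
      by (simp add: ray_integrand_def \<rho>_def mult_ac)
    show "of_real t powr (s - 1) * exp (\<eta> * of_real y * ?w * of_real t - ?v * of_real t ^ 2) =
      (of_real t powr (s - 1) * exp (- \<rho> * of_real t)
          - ?v * (of_real t powr (s + 2 - 1) * exp (- \<rho> * of_real t))) + ray_integrand \<eta> s y t"
      unfolding 1 2 3 by (simp add: algebra_simps)
  qed
  also have "\<dots> = (LBINT t:{0<..}. of_real t powr (s - 1) * exp (- \<rho> * of_real t))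
       - ?v * (LBINT t:{0<..}. of_real t powr (s + 2 - 1) * exp (- \<rho> * of_real t)) + (LBINT t:{0<..}. ray_integrand \<eta> s y t)"
    using int[of s] int[of "s + 2"] int3 s by (simp add: set_integral_add set_integral_diff del: add_2_eq_Suc')
  finally have I: "(LBINT t:{0<..}. of_real t powr (s - 1) * exp (\<eta> * of_real y * ?w * of_real t - ?v * of_real t ^ 2)) =
      (LBINT t:{0<..}. of_real t powr (s - 1) * exp (- \<rho> * of_real t))
       - ?v * (LBINT t:{0<..}. of_real t powr (s + 2 - 1) * exp (- \<rho> * of_real t)) + (LBINT t:{0<..}. ray_integrand \<eta> s y t)" .
  have v: "exp (\<eta> * pi * s / 8) * ?v = exp (\<eta> * pi * (s + 2) / 8)"
    unfolding v2 exp_add [symmetric] by (simp add: field_simps)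
  have s2: "Re (s + 2) > 0" "- (s + 2) = - s - 2" using s by auto
  have "exp (\<eta> * pi * s / 8) * (A - ?v * B + C) = exp (\<eta> * pi * s / 8) * A - exp (\<eta> * pi * (s + 2) / 8) * B + exp (\<eta> * pi * s / 8) * C" for A B C
    unfolding v [symmetric] by (simp only: ring_distribs mult.assoc)
  thus ?thesis
    unfolding gauss_fourier_eq_ray[OF \<eta> s] I ray_rem_def by (simp only: moment[OF s] moment[OF s2(1)] s2(2))
qed

section \<open>The cosine transform: asymptotics and Kummer form\<close>

definition cos_transform :: "complex \<Rightarrow> real \<Rightarrow> complex" where
  "cos_transform s y = 2 * (LBINT t:{0<..}. of_real t powr (s - 1) * exp (- (of_real t ^ 2)) * cos (of_real (y * t)))"

definition cos_transform_rem :: "complex \<Rightarrow> real \<Rightarrow> complex" where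
  "cos_transform_rem s y = ray_rem \<i> s y + ray_rem (-\<i>) s y"

lemma cos_transform_conv_exp:
  assumes s: "Re s > 0"
  shows "cos_transform s y = (LBINT t:{0<..}. of_real t powr (s - 1) * exp (\<i> * of_real y * of_real t - of_real t ^ 2))
     + (LBINT t:{0<..}. of_real t powr (s - 1) * exp (-\<i> * of_real y * of_real t - of_real t ^ 2))"
proof -
  have int: "set_integrable lborel {0<..} (\<lambda>t. of_real t powr (s - 1) * exp (\<mu> * of_real t - 1 * of_real t ^ 2))" for \<mu>
    by (rule set_integrable_cpowr_gauss) (use s in auto)
  have "cos_transform s y = (LBINT t:{0<..}. 2 * (of_real t powr (s - 1) * exp (- (of_real t ^ 2)) * cos (of_real (y * t))))"
    unfolding cos_transform_def by (rule set_integral_mult_right [symmetric])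
  also have "\<dots> = (LBINT t:{0<..}. of_real t powr (s - 1) * exp (\<i> * of_real y * of_real t - of_real t ^ 2)
       + of_real t powr (s - 1) * exp (-\<i> * of_real y * of_real t - of_real t ^ 2))"
    by (rule set_lebesgue_integral_cong) (auto simp: cos_exp_eq exp_diff exp_minus field_simps)
  finally show ?thesis using int[of "\<i> * of_real y"] int[of "-\<i> * of_real y"] by (simp add: set_integral_add)
qed

text \<open>Adding the expansions for \<open>\<i>\<close> and \<open>-\<i>\<close> turns the phases
  into cosines. Passing from \<open>s\<close> to \<open>s + 2\<close> changes each phase by a sign,
  which is why the second term enters with a plus.\<close>

lemma cos_transform_expansion:
  assumes y: "y > 0" and s: "Re s > 0"
  shows "cos_transform s y = 2 * Gamma s * cos (of_real pi * s / 2) * of_real y powr (- s)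
      + 2 * Gamma (s + 2) * cos (of_real pi * s / 2) * of_real y powr (- s - 2) + cos_transform_rem s y"
proof -
  have 1: "exp (\<i> * pi * s / 2) + exp (- \<i> * pi * s / 2) = 2 * cos (of_real pi * s / 2)"
    by (simp add: cos_exp_eq field_simps)
  have 2: "exp (\<i> * pi * (s + 2) / 2) = - exp (\<i> * pi * s / 2)"
  proof -
    have "\<i> * pi * (s + 2) / 2 = \<i> * pi * s / 2 + \<i> * pi" by (simp add: field_simps)
    thus ?thesis by (simp only: exp_add exp_pi_i' mult_minus1_right)
  qed
  have 3: "exp (- \<i> * pi * (s + 2) / 2) = - exp (- \<i> * pi * s / 2)"
  proof -
    have "- \<i> * pi * (s + 2) / 2 = - \<i> * pi * s / 2 + - (\<i> * pi)" by (simp add: field_simps)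
    thus ?thesis by (simp only: exp_add exp_minus exp_pi_i' inverse_minus_eq inverse_1 mult_minus1_right)
  qed
  have "cos_transform s y = (Gamma s * of_real y powr (- s) + Gamma (s + 2) * of_real y powr (- s - 2)) * (exp (\<i> * pi * s / 2) + exp (- \<i> * pi * s / 2)) + cos_transform_rem s y"
    unfolding cos_transform_conv_exp[OF s] cos_transform_rem_def
    using gauss_fourier_expansion[of "\<i>" y s] gauss_fourier_expansion[of "-\<i>" y s] y s
    unfolding 2 3 by (simp add: algebra_simps)
  thus ?thesis unfolding 1 by (simp add: algebra_simps)
qed

lemma fact_double_pochhammer: "fact (2 * n) = (4 ^ n * fact n * pochhammer (1 / 2) n :: 'a::field_char_0)"
  by (induction n) (simp_all add: pochhammer_Suc algebra_simps)

text \<open>Odd powers cancel between \<open>\<i> * y\<close> and \<open>- \<i> * y\<close>. In the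
  even ones \<open>fact (2 * k)\<close> supplies the lower parameter \<open>1 / 2\<close> and
  \<open>Gamma (s / 2 + k)\<close> the upper one. The factor 2 in \<open>cos_transform\<close>
  normalizes the value at \<open>y = 0\<close> to \<open>Gamma (s / 2)\<close>.\<close>

lemma cos_transform_kummer:
  assumes s: "Re s > 0"
  shows "cos_transform s y = Gamma (s / 2) * kummer_1F1 (s / 2) (1 / 2) (- of_real (y\<^sup>2 / 4))"
proof -
  define T where "T = (\<lambda>\<mu> k. \<mu> ^ k / fact k * (1 / 2 * Gamma ((s + of_nat k) / 2)))"
  have T: "T \<mu> sums (LBINT t:{0<..}. of_real t powr (s - 1) * exp (\<mu> * of_real t - of_real t ^ 2))" for \<mu> :: complex
    using gauss_integral_sums[of s 1 \<mu>] s by (simp add: T_def)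
  have "(\<lambda>k. T (\<i> * of_real y) k + T (- \<i> * of_real y) k) sums cos_transform s y"
    unfolding cos_transform_conv_exp[OF s] by (intro sums_add T)
  hence "(\<lambda>k. T (\<i> * of_real y) (2 * k) + T (- \<i> * of_real y) (2 * k)) sums cos_transform s y"
  proof (subst sums_mono_reindex[of "\<lambda>k. 2 * k"])
    fix n assume "n \<notin> range (\<lambda>k::nat. 2 * k)"
    hence "odd n" by (auto elim!: evenE)
    thus "T (\<i> * of_real y) n + T (- \<i> * of_real y) n = 0" by (simp add: T_def power_minus_odd)
  qed (auto simp: strict_mono_def)
  moreover have "T (\<i> * of_real y) (2 * k) + T (- \<i> * of_real y) (2 * k) =
      Gamma (s / 2) * (pochhammer (s / 2) k / pochhammer (1 / 2) k * ((- of_real (y\<^sup>2 / 4)) ^ k / fact k))" for k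
  proof -
    have "Gamma ((s + of_nat (2 * k)) / 2) = pochhammer (s / 2) k * Gamma (s / 2)"
    proof -
      have "s / 2 \<notin> \<int>\<^sub>\<le>\<^sub>0" using s by (auto elim!: nonpos_Ints_cases)
      hence "pochhammer (s / 2) k = Gamma (s / 2 + of_nat k) / Gamma (s / 2)" by (rule pochhammer_Gamma)
      moreover have "Gamma (s / 2) \<noteq> 0" using \<open>s / 2 \<notin> \<int>\<^sub>\<le>\<^sub>0\<close> by (simp add: Gamma_eq_zero_iff)
      ultimately show ?thesis by (simp add: add_divide_distrib)
    qed
    moreover have "(\<i> * of_real y) ^ (2 * k) = (4 * - of_real (y\<^sup>2 / 4)) ^ k" "(- \<i> * of_real y) ^ (2 * k) = (4 * - of_real (y\<^sup>2 / 4)) ^ k"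
      by (simp_all add: power_mult power_mult_distrib)
    moreover have "pochhammer (1 / 2 :: complex) k \<noteq> 0"
      using fact_double_pochhammer[of k, where 'a = complex] fact_nonzero[of "2 * k", where 'a = complex] by auto
    ultimately show ?thesis
      by (simp only: T_def fact_double_pochhammer power_mult_distrib) (simp add: field_simps)
  qed
  ultimately have *: "(\<lambda>k. Gamma (s / 2) * (pochhammer (s / 2) k / pochhammer (1 / 2) k * ((- of_real (y\<^sup>2 / 4)) ^ k / fact k))) sums cos_transform s y"
    by simp
  have "Gamma (s / 2) \<noteq> 0" using s by (auto simp: Gamma_eq_zero_iff elim!: nonpos_Ints_cases)
  moreover have "kummer_1F1 (s / 2) (1 / 2) (- of_real (y\<^sup>2 / 4)) = cos_transform s y / Gamma (s / 2)"
    unfolding kummer_1F1_def by (rule sums_unique [symmetric], rule sums_mult_D[OF * calculation])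
  ultimately show ?thesis by simp
qed

section \<open>A Poisson summation formula on the half-line\<close>

lemma set_integrable_mult_bounded:
  fixes f g :: "real \<Rightarrow> complex"
  assumes "set_integrable lborel A f" "g \<in> borel_measurable borel" "\<And>x. norm (g x) \<le> C"
  shows "set_integrable lborel A (\<lambda>x. f x * g x)"
proof -
  have "integrable lborel (\<lambda>x. indicator A x *\<^sub>R f x)" using assms(1) by (simp add: set_integrable_def)
  hence f: "(\<lambda>x. indicator A x *\<^sub>R f x) \<in> borel_measurable lborel" by simp
  have "integrable lborel (\<lambda>x. (indicator A x *\<^sub>R f x) * g x)"
  proof (rule Bochner_Integration.integrable_bound)
    show "integrable lborel (\<lambda>x. C * norm (indicator A x *\<^sub>R f x))"
      using assms(1) by (simp add: set_integrable_def del: norm_scaleR)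
    show "(\<lambda>x. (indicator A x *\<^sub>R f x) * g x) \<in> borel_measurable lborel"
      using f assms(2) by (intro borel_measurable_times) auto
    show "AE x in lborel. norm ((indicator A x *\<^sub>R f x) * g x) \<le> norm (C * norm (indicator A x *\<^sub>R f x))"
    proof (rule AE_I2)
      fix x
      have "norm ((indicator A x *\<^sub>R f x) * g x) \<le> norm (indicator A x *\<^sub>R f x) * C"
        unfolding norm_mult by (intro mult_left_mono assms) auto
      thus "norm ((indicator A x *\<^sub>R f x) * g x) \<le> norm (C * norm (indicator A x *\<^sub>R f x))"
        by (simp add: mult.commute del: norm_scaleR)
    qed
  qed
  thus ?thesis by (simp add: set_integrable_def)
qed

lemma tendsto_mult_zero_bounded:
  fixes f g :: "'a \<Rightarrow> complex"
  assumes "(f \<longlongrightarrow> 0) F" "\<And>x. norm (g x) \<le> C"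
  shows "((\<lambda>x. f x * g x) \<longlongrightarrow> 0) F"
proof (rule Lim_null_comparison)
  show "\<forall>\<^sub>F x in F. norm (f x * g x) \<le> norm (f x) * C"
    unfolding norm_mult by (intro always_eventually allI mult_left_mono assms) auto
  have "((\<lambda>x. norm (f x) * C) \<longlongrightarrow> norm (0 :: complex) * C) F" by (intro tendsto_intros assms(1))
  thus "((\<lambda>x. norm (f x) * C) \<longlongrightarrow> 0) F" by simp
qed

text \<open>Imaginary part of the logarithm series: the Abel means of the Fourier series of the
  sawtooth. The term \<open>n = 0\<close> has the value 0.\<close>

lemma sin_series_Ln:
  fixes r \<theta> :: real
  assumes "0 < r" "r < 1"
  shows "(\<lambda>n. r ^ n * sin (of_nat n * \<theta>) / of_nat n) sums (- Im (Ln (1 - of_real r * cis \<theta>)))"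
proof -
  have "(\<lambda>n. - (((of_real r * cis \<theta>) ^ n)) / of_nat n) sums Ln (1 + (- (of_real r * cis \<theta>)))"
    using Ln_series'[of "- (of_real r * cis \<theta>)"] assms by (simp add: norm_mult)
  from sums_Im[OF this] have "(\<lambda>n. Im (- (((of_real r * cis \<theta>) ^ n)) / of_nat n)) sums Im (Ln (1 - of_real r * cis \<theta>))"
    by simp
  moreover have "Im (- (((of_real r * cis \<theta>) ^ n)) / of_nat n) = - (r ^ n * sin (of_nat n * \<theta>) / of_nat n)" for n
  proof -
    have "- (((of_real r * cis \<theta>) ^ n)) / of_nat n = of_real (- (r ^ n / real n)) * cis (of_nat n * \<theta>)"
      by (simp add: power_mult_distrib Complex.DeMoivre)
    thus ?thesis by (simp only: Im_complex_of_real Re_complex_of_real times_complex.sel cis.sel) simp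
  qed
  ultimately have "(\<lambda>n. - (r ^ n * sin (of_nat n * \<theta>) / of_nat n)) sums Im (Ln (1 - of_real r * cis \<theta>))"
    by (simp only:)
  from sums_minus[OF this] show ?thesis by simp
qed

text \<open>With \<open>f = frac x\<close> the number factors as \<open>2 * sin (pi * f)\<close>
  times the unit vector at angle \<open>pi * (f - 1 / 2)\<close>, so the principal logarithm reads
  off the sawtooth. Avoiding the branch cut gives the continuity needed for \<open>r\<close> tending
  to 1.\<close>

lemma Im_Ln_1_minus_cis:
  assumes "x \<notin> \<int>"
  shows "Im (Ln (1 - cis (2 * pi * x))) = pi * (frac x - 1 / 2)" "1 - cis (2 * pi * x) \<notin> \<real>\<^sub>\<le>\<^sub>0"
proof -
  define f where "f = frac x"
  have f: "0 < f" "f < 1" using assms by (auto simp: f_def frac_gt_0_iff frac_lt_1)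
  have "cis (2 * pi * x) = cis (2 * pi * f)"
  proof -
    have "2 * pi * x = 2 * pi * f + 2 * pi * of_int \<lfloor>x\<rfloor>" by (simp add: f_def frac_def algebra_simps)
    hence "cis (2 * pi * x) = cis (2 * pi * f) * cis (2 * pi * of_int \<lfloor>x\<rfloor>)" by (simp only: cis_mult)
    thus ?thesis by (simp add: cis_multiple_2pi)
  qed
  moreover have "1 - cis (2 * pi * f) = of_real (2 * sin (pi * f)) * cis (pi * (f - 1 / 2))"
  proof -
    have 1: "cos (pi * (f - 1 / 2)) = sin (pi * f)" "sin (pi * (f - 1 / 2)) = - cos (pi * f)"
      by (simp_all add: right_diff_distrib cos_diff sin_diff)
    have 2: "cos (2 * pi * f) = 1 - 2 * sin (pi * f) ^ 2" "sin (2 * pi * f) = 2 * sin (pi * f) * cos (pi * f)"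
      using cos_double_sin[of "pi * f"] sin_double[of "pi * f"] by (simp_all add: mult_ac)
    show ?thesis by (rule complex_eqI) (simp_all add: 1 2 power2_eq_square)
  qed
  ultimately have eq: "1 - cis (2 * pi * x) = of_real (2 * sin (pi * f)) * cis (pi * (f - 1 / 2))" by simp
  have s: "sin (pi * f) > 0" using f by (intro sin_gt_zero) auto
  have "Ln (1 - cis (2 * pi * x)) = of_real (ln (2 * sin (pi * f))) + \<i> * of_real (pi * (f - 1 / 2))"
  proof (rule Ln_unique)
    show "exp (of_real (ln (2 * sin (pi * f))) + \<i> * of_real (pi * (f - 1 / 2))) = 1 - cis (2 * pi * x)"
      using s unfolding eq by (simp only: exp_add exp_of_real cis_conv_exp exp_ln mult_pos_pos zero_less_numeral)
    have "pi * (- 1) < pi * (f - 1 / 2)" "pi * (f - 1 / 2) \<le> pi * 1" using f by (intro mult_strict_left_mono mult_left_mono; simp)+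
    thus "- pi < Im (of_real (ln (2 * sin (pi * f))) + \<i> * of_real (pi * (f - 1 / 2)))"
      "Im (of_real (ln (2 * sin (pi * f))) + \<i> * of_real (pi * (f - 1 / 2))) \<le> pi"
      by simp_all
  qed
  thus "Im (Ln (1 - cis (2 * pi * x))) = pi * (frac x - 1 / 2)" by (simp add: f_def)
  have "Re (1 - cis (2 * pi * x)) = 2 * sin (pi * f) * sin (pi * f)"
    unfolding eq by (simp add: right_diff_distrib cos_diff)
  hence "Re (1 - cis (2 * pi * x)) > 0" using s by (simp only: mult_pos_pos zero_less_numeral)
  thus "1 - cis (2 * pi * x) \<notin> \<real>\<^sub>\<le>\<^sub>0" by (auto simp: complex_nonpos_Reals_iff)
qed

context
  fixes h h' :: "real \<Rightarrow> complex"
  assumes deriv: "\<And>x. x > 0 \<Longrightarrow> (h has_vector_derivative h' x) (at x)"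
    and cont': "continuous_on {0<..} h'"
    and int_h: "set_integrable lborel {0<..} h" and int_h': "set_integrable lborel {0<..} h'"
    and lim_0: "(h \<longlongrightarrow> 0) (at_right 0)" and lim_top: "(h \<longlongrightarrow> 0) at_top"
begin

lemma isCont_h: "x > 0 \<Longrightarrow> isCont h x"
  using deriv has_vector_derivative_continuous by blast

lemma isCont_h': "x > 0 \<Longrightarrow> isCont h' x"
  using cont' by (simp add: continuous_on_eq_continuous_at)

text \<open>Integration by parts; the boundary terms vanish because \<open>h\<close> tends to 0 at
  both ends while the sine is bounded. The factor gained, \<open>1 / m\<close>, is the Fourier
  coefficient of the sawtooth.\<close>

lemma cos_coeff_eq_sin_coeff:
  assumes m: "m > 0"
  shows "(LBINT x:{0<..}. h x * of_real (cos (2 * pi * real m * x))) =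
    - 1 / (2 * pi * real m) * (LBINT x:{0<..}. h' x * of_real (sin (2 * pi * real m * x)))"
proof -
  let ?c = "2 * pi * real m"
  have c: "?c > 0" using m by simp
  let ?s = "\<lambda>x. complex_of_real (sin (?c * x))" and ?k = "\<lambda>x. complex_of_real (cos (?c * x))"
  have int1: "set_integrable lborel {0<..} (\<lambda>x. h' x * ?s x)"
    by (rule set_integrable_mult_bounded[OF int_h', where C = 1]) auto
  have int2: "set_integrable lborel {0<..} (\<lambda>x. h x * ?k x)"
    by (rule set_integrable_mult_bounded[OF int_h, where C = 1]) auto
  have "(LBINT x=0..\<infinity>. h' x * ?s x + of_real ?c * (h x * ?k x)) = 0 - 0"
  proof (rule interval_integral_FTC_integrable[where F = "\<lambda>x. h x * ?s x"])
    fix x :: real assume "0 < ereal x"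
    hence x: "x > 0" by simp
    have "(?s has_vector_derivative of_real (cos (?c * x) * ?c)) (at x)"
      by (intro has_vector_derivative_of_real) (auto intro!: derivative_eq_intros simp: has_real_derivative_iff_has_vector_derivative [symmetric])
    from has_vector_derivative_mult[OF deriv[OF x] this]
    show "((\<lambda>x. h x * ?s x) has_vector_derivative h' x * ?s x + of_real ?c * (h x * ?k x)) (at x)"
      by (simp add: mult_ac add.commute)
    show "isCont (\<lambda>x. h' x * ?s x + of_real ?c * (h x * ?k x)) x"
      by (intro continuous_intros isCont_h isCont_h' x)
  next
    show "set_integrable lborel (einterval 0 \<infinity>) (\<lambda>x. h' x * ?s x + of_real ?c * (h x * ?k x))"
      using int1 int2 unfolding zero_ereal_def by (simp add: set_integral_add)
    show "(((\<lambda>x. h x * ?s x) \<circ> real_of_ereal) \<longlongrightarrow> 0) (at_right 0)"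
      unfolding zero_ereal_def ereal_tendsto_simps by (rule tendsto_mult_zero_bounded[OF lim_0, where C = 1]) auto
    show "(((\<lambda>x. h x * ?s x) \<circ> real_of_ereal) \<longlongrightarrow> 0) (at_left \<infinity>)"
      unfolding ereal_tendsto_simps by (rule tendsto_mult_zero_bounded[OF lim_top, where C = 1]) auto
  qed auto
  hence "(LBINT x:{0<..}. h' x * ?s x) + of_real ?c * (LBINT x:{0<..}. h x * ?k x) = 0"
    unfolding interval_lebesgue_integral_0_infty using int1 int2 by (simp add: set_integral_add)
  hence "of_real ?c * (LBINT x:{0<..}. h x * ?k x) = - (LBINT x:{0<..}. h' x * ?s x)"
    by (simp only: add_eq_0_iff)
  moreover have "I = of_real (- 1 / C) * J" if "of_real C * I = - J" "C > 0" for I J :: complex and C :: real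
  proof -
    have "J = - (of_real C * I)" using that(1) by simp
    thus ?thesis using that(2) by simp
  qed
  ultimately show ?thesis using c by blast
qed

text \<open>The weights \<open>r ^ m\<close> bound the partial sums of the sine series by a
  geometric series, so that sum and integral commute. The coefficient at \<open>m = 0\<close> is set
  to 0 to match \<open>sin_series_Ln\<close>, whose index also starts at 0.\<close>

lemma abel_cos_coeffs:
  assumes r: "0 < r" "r < 1"
  shows "(\<lambda>m. of_real (r ^ m) * (if m = 0 then 0 else 2 * (LBINT x:{0<..}. h x * of_real (cos (2 * pi * real m * x))))) sums
     (1 / pi * (LBINT x:{0<..}. h' x * of_real (Im (Ln (1 - of_real r * cis (2 * pi * x))))))"
proof -
  let ?t = "\<lambda>m x. r ^ m * sin (of_nat m * (2 * pi * x)) / of_nat m"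
  let ?L = "\<lambda>x. Im (Ln (1 - of_real r * cis (2 * pi * x)))"
  have meas_h': "(\<lambda>x. indicat_real {0<..} x *\<^sub>R h' x) \<in> borel_measurable borel"
    by (rule borel_measurable_continuous_on_indicator[OF _ cont']) simp
  have "(\<lambda>m. LBINT x:{0<..}. h' x * of_real (?t m x)) sums (LBINT x:{0<..}. h' x * of_real (- ?L x))"
    unfolding set_lebesgue_integral_def
  proof (rule sums_integral_dominated[where w = "\<lambda>x. norm (indicator {0<..} x *\<^sub>R h' x) * (1 / (1 - r))"])
    show "(\<lambda>x. indicat_real {0<..} x *\<^sub>R (h' x * of_real (?t m x))) \<in> borel_measurable lborel" for m
    proof -
      have "(\<lambda>x. (indicat_real {0<..} x *\<^sub>R h' x) * of_real (?t m x)) \<in> borel_measurable borel"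
        by (rule borel_measurable_times[OF meas_h']) (auto intro!: borel_measurable_continuous_onI continuous_intros simp: divide_inverse)
      thus ?thesis by (simp only: measurable_lborel2 mult_scaleR_left)
    qed
    show "integrable lborel (\<lambda>x. norm (indicat_real {0<..} x *\<^sub>R h' x) * (1 / (1 - r)))"
      using int_h' by (simp add: set_integrable_def del: norm_scaleR)
    fix x :: real
    show "(\<lambda>m. indicat_real {0<..} x *\<^sub>R (h' x * of_real (?t m x))) sums (indicat_real {0<..} x *\<^sub>R (h' x * of_real (- ?L x)))"
      using sin_series_Ln[OF r, of "2 * pi * x"] by (intro sums_scaleR_right sums_mult sums_of_real)
    fix n
    have "norm (\<Sum>m<n. ?t m x) \<le> 1 / (1 - r)"
    proof -
      have "norm (\<Sum>m<n. ?t m x) \<le> (\<Sum>m<n. r ^ m)"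
      proof (intro order.trans[OF norm_sum] sum_mono)
        fix m
        have "\<bar>sin (real m * (2 * pi * x))\<bar> \<le> 1" by simp
        hence "\<bar>sin (real m * (2 * pi * x))\<bar> / real m \<le> 1"
          by (cases "m = 0") (auto simp: divide_le_eq intro: order.trans[of _ 1])
        from mult_left_mono[OF this, of "r ^ m"] show "norm (?t m x) \<le> r ^ m" using r by (simp add: abs_mult)
      qed
      also have "\<dots> \<le> 1 / (1 - r)" using r geometric_sums[of r]
        by (subst sums_unique[of "\<lambda>m. r ^ m" "1 / (1 - r)"]) (auto intro!: sum_le_suminf simp: summable_geometric)
      finally show ?thesis .
    qed
    hence "norm (indicat_real {0<..} x *\<^sub>R h' x) * norm (complex_of_real (\<Sum>m<n. ?t m x)) \<le> norm (indicator {0<..} x *\<^sub>R h' x) * (1 / (1 - r))"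
      unfolding norm_of_real real_norm_def by (rule mult_left_mono) auto
    thus "norm (\<Sum>m<n. indicat_real {0<..} x *\<^sub>R (h' x * of_real (?t m x))) \<le> norm (indicator {0<..} x *\<^sub>R h' x) * (1 / (1 - r))"
      by (simp only: norm_mult [symmetric] of_real_sum sum_distrib_left mult_scaleR_left)
  qed
  from sums_mult[OF this, of "- 1 / pi"]
  have "(\<lambda>m. - 1 / pi * (LBINT x:{0<..}. h' x * of_real (?t m x))) sums (1 / pi * (LBINT x:{0<..}. h' x * of_real (?L x)))"
    by (simp add: set_integral_uminus set_lebesgue_integral_def)
  moreover have "- 1 / pi * (LBINT x:{0<..}. h' x * of_real (?t m x)) =
      of_real (r ^ m) * (if m = 0 then 0 else 2 * (LBINT x:{0<..}. h x * of_real (cos (2 * pi * real m * x))))" for m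
  proof (cases "m = 0")
    case False
    have "(LBINT x:{0<..}. h' x * of_real (?t m x)) = (LBINT x:{0<..}. of_real (r ^ m / real m) * (h' x * of_real (sin (2 * pi * real m * x))))"
      by (rule set_lebesgue_integral_cong) (simp_all add: mult_ac)
    also have "\<dots> = of_real (r ^ m / real m) * (LBINT x:{0<..}. h' x * of_real (sin (2 * pi * real m * x)))"
      by (rule set_integral_mult_right)
    finally have X: "(LBINT x:{0<..}. h' x * of_real (?t m x)) = of_real (r ^ m / real m) * (LBINT x:{0<..}. h' x * of_real (sin (2 * pi * real m * x)))" .
    have "- 1 / pi * (of_real (r ^ m / real m) * J) = of_real (r ^ m) * (2 * (of_real (- 1 / (2 * pi * real m)) * J))" for J :: complex
      using False by simp
    moreover have "m > 0" using False by simp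
    ultimately show ?thesis using False unfolding X cos_coeff_eq_sin_coeff[OF \<open>m > 0\<close>] by (simp only: if_False)
  qed (simp add: set_lebesgue_integral_def)
  ultimately show ?thesis by simp
qed

text \<open>A principal argument never exceeds \<open>pi\<close> in modulus, which gives a majorant
  independent of \<open>r\<close>; pointwise convergence is claimed off the integers, a null
  set.\<close>

lemma tendsto_abel_integral:
  "((\<lambda>r. LBINT x:{0<..}. h' x * of_real (Im (Ln (1 - of_real r * cis (2 * pi * x)))))
     \<longlongrightarrow> (LBINT x:{0<..}. h' x * of_real (pi * (frac x - 1 / 2)))) (at_left 1)"
  unfolding set_lebesgue_integral_def
proof (rule tendsto_integral_dominated_within[where w = "\<lambda>x. norm (indicator {0<..} x *\<^sub>R h' x) * pi"])
  have meas_h': "(\<lambda>x. indicat_real {0<..} x *\<^sub>R h' x) \<in> borel_measurable borel"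
    by (rule borel_measurable_continuous_on_indicator[OF _ cont']) simp
  have "(\<lambda>x. (indicat_real {0<..} x *\<^sub>R h' x) * of_real (pi * (frac x - 1 / 2))) \<in> borel_measurable borel"
    by (rule borel_measurable_times[OF meas_h']) (simp add: frac_def)
  thus "(\<lambda>x. indicat_real {0<..} x *\<^sub>R (h' x * of_real (pi * (frac x - 1 / 2)))) \<in> borel_measurable lborel" by simp
  show "integrable lborel (\<lambda>x. norm (indicator {0<..} x *\<^sub>R h' x) * pi)"
    using int_h' by (simp add: set_integrable_def del: norm_scaleR)
  have Re_pos: "Re (1 - of_real r * cis \<theta>) > 0" if "0 < r" "r < 1" for r \<theta> :: real
  proof -
    have "r * cos \<theta> \<le> r * 1" using that by (intro mult_left_mono) auto
    hence "r * cos \<theta> < 1" using that by linarith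
    thus ?thesis by simp
  qed
  have "\<forall>\<^sub>F r in at_left (1::real). r \<in> {0<..<1}"
    by (rule eventually_at_left_real) simp
  thus "\<forall>\<^sub>F r in at_left 1. (\<lambda>x. indicat_real {0<..} x *\<^sub>R (h' x * of_real (Im (Ln (1 - of_real r * cis (2 * pi * x)))))) \<in> borel_measurable lborel \<and>
      (AE x in lborel. norm (indicat_real {0<..} x *\<^sub>R (h' x * of_real (Im (Ln (1 - of_real r * cis (2 * pi * x)))))) \<le> norm (indicator {0<..} x *\<^sub>R h' x) * pi)"
  proof eventually_elim
    case (elim r)
    have nz: "1 - of_real r * cis (2 * pi * x) \<notin> \<real>\<^sub>\<le>\<^sub>0" for x
      using Re_pos[of r "2 * pi * x"] elim by (auto simp: complex_nonpos_Reals_iff)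
    have "continuous_on UNIV (\<lambda>x. Im (Ln (1 - of_real r * cis (2 * pi * x))))"
      by (intro continuous_on_Im continuous_on_Ln continuous_intros nz)
    hence "(\<lambda>x. (indicat_real {0<..} x *\<^sub>R h' x) * of_real (Im (Ln (1 - of_real r * cis (2 * pi * x))))) \<in> borel_measurable borel"
      by (intro borel_measurable_times[OF meas_h'] borel_measurable_continuous_onI continuous_on_of_real)
    moreover have "norm ((indicat_real {0<..} x *\<^sub>R h' x) * of_real (Im (Ln (1 - of_real r * cis (2 * pi * x))))) \<le> norm (indicator {0<..} x *\<^sub>R h' x) * pi" for x
    proof -
      have "1 - of_real r * cis (2 * pi * x) \<noteq> 0" using nz[of x] by auto
      hence "\<bar>Im (Ln (1 - of_real r * cis (2 * pi * x)))\<bar> \<le> pi"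
        using mpi_less_Im_Ln[of "1 - of_real r * cis (2 * pi * x)"] Im_Ln_le_pi[of "1 - of_real r * cis (2 * pi * x)"] by linarith
      thus ?thesis unfolding norm_mult norm_of_real by (intro mult_left_mono) auto
    qed
    ultimately show ?case by simp
  qed
  have "AE x::real in lborel. x \<notin> \<int>"
    by (intro AE_not_in countable_imp_null_set_lborel countable_int)
  thus "AE x in lborel. ((\<lambda>r. indicat_real {0<..} x *\<^sub>R (h' x * of_real (Im (Ln (1 - of_real r * cis (2 * pi * x))))))
      \<longlongrightarrow> indicat_real {0<..} x *\<^sub>R (h' x * of_real (pi * (frac x - 1 / 2)))) (at_left 1)"
  proof eventually_elim
    case (elim x)
    have "((\<lambda>r. Im (Ln (1 - of_real r * cis (2 * pi * x)))) \<longlongrightarrow> Im (Ln (1 - of_real 1 * cis (2 * pi * x)))) (at_left 1)"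
      by (intro tendsto_intros) (use Im_Ln_1_minus_cis(2)[OF elim] in simp_all)
    thus ?case using Im_Ln_1_minus_cis(1)[OF elim] by (intro tendsto_intros) simp
  qed
qed

text \<open>Euler-Maclaurin summation of first order. Integration by parts on a unit interval yields
  half of \<open>h\<close> at each end, and neighbouring intervals complete the halves; the limit 0
  of \<open>h\<close> at 0 leaves no term there.\<close>

lemma integral_sawtooth:
  "(\<lambda>k. h (real (Suc k))) sums ((LBINT x:{0<..}. h x) + (LBINT x:{0<..}. h' x * of_real (frac x - 1 / 2)))"
proof -
  define G where "G = (\<lambda>x. h' x * of_real (frac x - 1 / 2) + h x)"
  \<comment> \<open>The value \<open>h 0\<close> is unconstrained. At the left end only the right
    limit of \<open>h\<close> matters, and it is 0.\<close>
  define H where "H = (\<lambda>N::nat. if N = 0 then 0 else h (real N))"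
  have int_saw: "set_integrable lborel {0<..} (\<lambda>x. h' x * of_real (frac x - 1 / 2))"
  proof (rule set_integrable_mult_bounded[OF int_h', where C = 1])
    show "norm (complex_of_real (frac x - 1 / 2)) \<le> 1" for x
      unfolding norm_of_real using frac_ge_0[of x] frac_lt_1[of x] by linarith
  qed (simp add: frac_def)
  have int_G: "set_integrable lborel {0<..} G"
    unfolding G_def by (intro set_integral_add int_saw int_h)
  have unit: "(LBINT x=ereal (real N)..ereal (real (Suc N)). G x) = 1 / 2 * h (real (Suc N)) + 1 / 2 * H N" for N
  proof -
    \<comment> \<open>Between \<open>N\<close> and \<open>N + 1\<close> the sawtooth is the linear
      function \<open>x - N - 1 / 2\<close>, with values \<open>- 1 / 2\<close> and
      \<open>1 / 2\<close> at the ends; times \<open>h\<close> it is a primitive of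
      \<open>G\<close>.\<close>
    let ?F = "\<lambda>x. of_real (x - real N - 1 / 2) * h x"
    have cong: "G x = of_real (x - real N - 1 / 2) * h' x + 1 * h x" if "x \<in> einterval (real N) (real (Suc N))" for x
    proof -
      have "frac x = x - real N" using that by (intro frac_unique_iff[THEN iffD2]) auto
      thus ?thesis by (simp add: G_def)
    qed
    have "(LBINT x=ereal (real N)..ereal (real (Suc N)). G x) = (LBINT x=ereal (real N)..ereal (real (Suc N)). of_real (x - real N - 1 / 2) * h' x + 1 * h x)"
      by (rule interval_integral_cong) (use cong in \<open>simp add: min_def max_def\<close>)
    also have "\<dots> = 1 / 2 * h (real (Suc N)) - (- 1 / 2 * H N)"
    proof (rule interval_integral_FTC_integrable[where F = ?F])
      fix x assume "ereal (real N) < ereal x"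
      hence x: "x > 0" by (simp add: order.strict_trans1[of 0 "real N"])
      have "((\<lambda>x. complex_of_real (x - real N - 1 / 2)) has_vector_derivative of_real 1) (at x)"
        by (intro has_vector_derivative_of_real) (auto intro!: derivative_eq_intros simp: has_real_derivative_iff_has_vector_derivative [symmetric])
      from has_vector_derivative_mult[OF this deriv[OF x]]
      show "(?F has_vector_derivative of_real (x - real N - 1 / 2) * h' x + 1 * h x) (at x)" by simp
      show "isCont (\<lambda>x. of_real (x - real N - 1 / 2) * h' x + 1 * h x) x"
        by (intro continuous_intros isCont_h isCont_h' x)
    next
      have "set_integrable lborel (einterval (real N) (real (Suc N))) G"
        by (rule set_integrable_subset[OF int_G]) auto
      also have "?this \<longleftrightarrow> set_integrable lborel (einterval (real N) (real (Suc N))) (\<lambda>x. of_real (x - real N - 1 / 2) * h' x + 1 * h x)"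
        by (rule set_integrable_cong) (use cong in auto)
      finally show "set_integrable lborel (einterval (real N) (real (Suc N))) (\<lambda>x. of_real (x - real N - 1 / 2) * h' x + 1 * h x)" .
      have "(h \<longlongrightarrow> H N) (at_right (real N))"
        using lim_0 isCont_h[of "real N"] by (cases "N = 0") (auto simp: H_def isCont_def filterlim_at_split)
      hence "(?F \<longlongrightarrow> of_real (real N - real N - 1 / 2) * H N) (at_right (real N))"
        by (intro tendsto_intros)
      thus "((?F \<circ> real_of_ereal) \<longlongrightarrow> - 1 / 2 * H N) (at_right (ereal (real N)))"
        unfolding ereal_tendsto_simps by simp
      have "(h \<longlongrightarrow> h (real (Suc N))) (at_left (real (Suc N)))"
        using isCont_h[of "real (Suc N)"] by (auto simp: isCont_def filterlim_at_split)
      hence "(?F \<longlongrightarrow> of_real (real (Suc N) - real N - 1 / 2) * h (real (Suc N))) (at_left (real (Suc N)))"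
        by (intro tendsto_intros)
      thus "((?F \<circ> real_of_ereal) \<longlongrightarrow> 1 / 2 * h (real (Suc N))) (at_left (ereal (real (Suc N))))"
        unfolding ereal_tendsto_simps by simp
    qed auto
    finally show ?thesis by simp
  qed
  have part: "(LBINT x=0..ereal (real N). G x) = (\<Sum>k<N. h (real (Suc k))) - 1 / 2 * H N" for N
  proof (induction N)
    case 0
    show ?case by (simp add: H_def zero_ereal_def [symmetric])
  next
    case (Suc N)
    have "(LBINT x=0..ereal (real N). G x) + (LBINT x=ereal (real N)..ereal (real (Suc N)). G x) = (LBINT x=0..ereal (real (Suc N)). G x)"
    proof (rule interval_integral_sum)
      have "interval_lebesgue_integrable lborel 0 (ereal (real (Suc N))) G"
        unfolding interval_lebesgue_integrable_def by (auto intro: set_integrable_subset[OF int_G] simp: zero_ereal_def)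
      moreover have "min 0 (min (ereal (real N)) (ereal (real (Suc N)))) = 0" "max 0 (max (ereal (real N)) (ereal (real (Suc N)))) = ereal (real (Suc N))"
        by (simp_all add: min_def max_def zero_ereal_def)
      ultimately show "interval_lebesgue_integrable lborel (min 0 (min (ereal (real N)) (ereal (real (Suc N))))) (max 0 (max (ereal (real N)) (ereal (real (Suc N))))) G"
        by simp
    qed
    hence "(LBINT x=0..ereal (real (Suc N)). G x) = (\<Sum>k<N. h (real (Suc k))) + 1 / 2 * h (real (Suc N))"
      unfolding Suc.IH unit by simp
    also have "\<dots> = (\<Sum>k<Suc N. h (real (Suc k))) - 1 / 2 * H (Suc N)" by (simp add: H_def)
    finally show ?case .
  qed
  have "(\<lambda>N. LBINT x:{0<..<real N}. G x) \<longlonglongrightarrow> (LBINT x:(\<Union>N. {0<..<real N}). G x)"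
  proof (rule set_integral_cont_up)
    show "set_integrable lborel (\<Union>N. {0<..<real N}) G" by (rule set_integrable_subset[OF int_G]) auto
    show "incseq (\<lambda>N. {0<..<real N})" by (force simp: incseq_def)
  qed auto
  also have "(\<Union>N. {0<..<real N}) = {0<..}" using reals_Archimedean2 by (fastforce simp del: of_nat_Suc)
  also have "(\<lambda>N. LBINT x:{0<..<real N}. G x) = (\<lambda>N. (\<Sum>k<N. h (real (Suc k))) - 1 / 2 * H N)"
  proof
    fix N
    have "(LBINT x=0..ereal (real N). G x) = (LBINT x:{0<..<real N}. G x)"
      unfolding zero_ereal_def by (simp add: interval_lebesgue_integral_le_eq)
    thus "(LBINT x:{0<..<real N}. G x) = (\<Sum>k<N. h (real (Suc k))) - 1 / 2 * H N" using part[of N] by simp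
  qed
  finally have lim1: "(\<lambda>N. (\<Sum>k<N. h (real (Suc k))) - 1 / 2 * H N) \<longlonglongrightarrow> (LBINT x:{0<..}. G x)" .
  have "(\<lambda>N. h (real N)) \<longlonglongrightarrow> 0"
    using filterlim_compose[OF lim_top filterlim_real_sequentially] .
  hence "H \<longlonglongrightarrow> 0"
    by (rule Lim_transform_eventually) (auto simp: H_def eventually_sequentially intro!: exI[of _ 1])
  from tendsto_add[OF lim1 tendsto_mult[OF tendsto_const[of "1 / 2"] this]]
  have "(\<lambda>k. h (real (Suc k))) sums (LBINT x:{0<..}. G x)" by (simp add: sums_def)
  thus ?thesis unfolding G_def using set_integral_add(2)[OF int_saw int_h] by (simp add: add.commute)
qed

text \<open>The Abel-weighted cosine sum is evaluated in two ways as \<open>r\<close> tends to 1: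
  absolute summability of the coefficients allows Tannery's theorem on the series, and
  \<open>tendsto_abel_integral\<close> gives the sawtooth integral, which
  \<open>integral_sawtooth\<close> compares with the sum of \<open>h\<close>.\<close>

theorem poisson_half_line:
  assumes summ: "summable (\<lambda>m. norm (LBINT x:{0<..}. h x * of_real (cos (2 * pi * real (Suc m) * x))))"
  shows "(\<lambda>k. h (real (Suc k))) sums
    ((LBINT x:{0<..}. h x) + (\<Sum>m. 2 * (LBINT x:{0<..}. h x * of_real (cos (2 * pi * real (Suc m) * x)))))"
proof -
  define c where "c = (\<lambda>m. if m = 0 then 0 else 2 * (LBINT x:{0<..}. h x * of_real (cos (2 * pi * real m * x))))"
  have summ_c: "summable (\<lambda>m. norm (c m))"
    using summable_mult[OF summ, of 2] by (subst summable_Suc_iff [symmetric]) (simp add: c_def norm_mult)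
  have "((\<lambda>r. \<Sum>m. of_real (r ^ m) * c m) \<longlongrightarrow> (\<Sum>m. c m)) (at_left 1)"
  proof (rule tannerys_theorem[THEN conjunct2, THEN conjunct2, OF _ _ summ_c])
    show "((\<lambda>r::real. of_real (r ^ m) * c m) \<longlongrightarrow> c m) (at_left 1)" for m
    proof -
      have "((\<lambda>r::real. of_real (r ^ m) * c m) \<longlongrightarrow> of_real (1 ^ m) * c m) (at_left 1)" by (intro tendsto_intros)
      thus ?thesis by simp
    qed
    have "\<forall>\<^sub>F r in at_left (1::real). r \<in> {0<..<1}"
      by (rule eventually_at_left_real) simp
    hence "\<forall>\<^sub>F r in at_left (1::real). \<forall>m. norm (of_real (r ^ m) * c m) \<le> norm (c m)"
      by eventually_elim (auto simp: norm_mult norm_power power_le_one intro!: mult_left_le_one_le)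
    thus "\<forall>\<^sub>F (m, r) in at_top \<times>\<^sub>F at_left (1::real). norm (of_real (r ^ m) * c m) \<le> norm (c m)"
      by (subst eventually_prod_filter, intro exI[of _ "\<lambda>_. True"] exI[of _ "\<lambda>r. \<forall>m. norm (of_real (r ^ m) * c m) \<le> norm (c m)"]) auto
  qed auto
  moreover have "\<forall>\<^sub>F r in at_left (1::real). (\<Sum>m. of_real (r ^ m) * c m) = 1 / pi * (LBINT x:{0<..}. h' x * of_real (Im (Ln (1 - of_real r * cis (2 * pi * x)))))"
  proof -
    have "\<forall>\<^sub>F r in at_left (1::real). r \<in> {0<..<1}"
      by (rule eventually_at_left_real) simp
    thus ?thesis
    proof eventually_elim
      case (elim r)
      show ?case unfolding c_def by (rule sums_unique [symmetric], rule abel_cos_coeffs) (use elim in auto)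
    qed
  qed
  ultimately have "((\<lambda>r. 1 / pi * (LBINT x:{0<..}. h' x * of_real (Im (Ln (1 - of_real r * cis (2 * pi * x)))))) \<longlongrightarrow> (\<Sum>m. c m)) (at_left (1::real))"
    by (simp add: tendsto_cong)
  moreover have "((\<lambda>r. 1 / pi * (LBINT x:{0<..}. h' x * of_real (Im (Ln (1 - of_real r * cis (2 * pi * x))))))
      \<longlongrightarrow> 1 / pi * (LBINT x:{0<..}. h' x * of_real (pi * (frac x - 1 / 2)))) (at_left (1::real))"
    by (intro tendsto_intros tendsto_abel_integral)
  ultimately have "(\<Sum>m. c m) = 1 / pi * (LBINT x:{0<..}. h' x * of_real (pi * (frac x - 1 / 2)))"
    by (rule tendsto_unique[rotated]) simp
  also have "(LBINT x:{0<..}. h' x * of_real (pi * (frac x - 1 / 2))) = (LBINT x:{0<..}. of_real pi * (h' x * of_real (frac x - 1 / 2)))"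
    by (rule set_lebesgue_integral_cong) simp_all
  also have "\<dots> = of_real pi * (LBINT x:{0<..}. h' x * of_real (frac x - 1 / 2))"
    by (rule set_integral_mult_right)
  finally have "(\<Sum>m. c m) = (LBINT x:{0<..}. h' x * of_real (frac x - 1 / 2))" by simp
  moreover have "(\<Sum>m. c m) = (\<Sum>m. c (Suc m))"
    using suminf_split_head[OF summable_norm_cancel[OF summ_c]] by (simp add: c_def)
  ultimately show ?thesis using integral_sawtooth by (simp add: c_def)
qed

end

section \<open>The zeta function\<close>

declare of_nat_Suc [simp del]

text \<open>Complex powers of the positive integers, the index \<open>k\<close> standing for \<open>k + 1\<close>.\<close>

definition npow :: "nat \<Rightarrow> complex \<Rightarrow> complex" where
  "npow k w = of_real (real (Suc k)) powr w"

lemma norm_npow: "norm (npow k w) = real (Suc k) powr Re w"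
  unfolding npow_def by (rule norm_of_real_powr) simp

lemma npow_add: "npow k (v + w) = npow k v * npow k w"
  unfolding npow_def by (rule powr_add)

lemma holomorphic_npow [holomorphic_intros]:
  "f holomorphic_on A \<Longrightarrow> (\<lambda>z. npow k (f z)) holomorphic_on A"
  unfolding npow_def by (intro holomorphic_intros) auto

lemma summable_on_Suc_powr:
  assumes "a < -1"
  shows "(\<lambda>k. real (Suc k) powr a) summable_on UNIV"
proof (rule norm_summable_imp_summable_on)
  have "summable (\<lambda>k. real k powr a)" using assms by (simp add: summable_real_powr_iff)
  hence "summable (\<lambda>k. real (Suc k) powr a)" by (subst summable_Suc_iff)
  thus "summable (\<lambda>k. norm (real (Suc k) powr a))" by simp
qed

lemma abs_summable_on_norm_bound:
  fixes f :: "'a \<Rightarrow> 'b::banach"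
  assumes "g summable_on A" "\<And>x. x \<in> A \<Longrightarrow> norm (f x) \<le> g x"
  shows "(\<lambda>x. norm (f x)) summable_on A" "f summable_on A" "norm (infsum f A) \<le> infsum g A"
proof -
  show 1: "(\<lambda>x. norm (f x)) summable_on A"
    by (rule summable_on_comparison_test[OF assms(1)]) (use assms(2) in auto)
  show "f summable_on A" using 1 by (rule abs_summable_summable)
  show "norm (infsum f A) \<le> infsum g A"
    using norm_infsum_bound[OF 1] infsum_mono[OF 1 assms(1)] assms(2) by (meson order.trans)
qed

text \<open>The Dirichlet series, meaningful for \<open>Re w > 1\<close>. It is kept apart from
  \<open>zeta\<close>, a chosen continuation whose existence is proved with its help.\<close>

definition zetaD :: "complex \<Rightarrow> complex" where
  "zetaD w = (\<Sum>\<^sub>\<infinity>k. npow k (- w))"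

lemma summable_on_npow:
  assumes "Re w < -1"
  shows "(\<lambda>k. npow k w) summable_on UNIV"
  by (rule abs_summable_on_norm_bound(2)[OF summable_on_Suc_powr[OF assms]]) (simp add: norm_npow)

lemma has_sum_zetaD: "Re w > 1 \<Longrightarrow> ((\<lambda>k. npow k (- w)) has_sum zetaD w) UNIV"
  unfolding zetaD_def by (intro has_sum_infsum summable_on_npow) simp

lemma Re_cball: "z \<in> cball a r \<Longrightarrow> Re a - r \<le> Re z \<and> Re z \<le> Re a + r"
proof -
  assume "z \<in> cball a r"
  hence "\<bar>Re a - Re z\<bar> \<le> r" using abs_Re_le_cmod[of "a - z"] by (simp add: dist_norm)
  thus ?thesis by (simp add: abs_le_iff)
qed

lemma Suc_powr_mono: "a \<le> b \<Longrightarrow> real (Suc k) powr a \<le> real (Suc k) powr b"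
  by (rule powr_mono) auto

lemma holomorphic_zetaD: "zetaD holomorphic_on {w. Re w > 1}"
  unfolding zetaD_def
proof (rule holomorphic_on_infsum)
  fix a :: complex assume a: "a \<in> {w. Re w > 1}"
  define r where "r = (Re a - 1) / 2"
  have r: "r > 0" "Re a - r > 1" using a by (auto simp: r_def field_simps)
  show "\<exists>r>0. \<exists>w. cball a r \<subseteq> {w. Re w > 1} \<and> w summable_on UNIV \<and> (\<forall>z\<in>cball a r. \<forall>k\<in>UNIV. norm (npow k (- z)) \<le> w k)"
  proof (intro exI[of _ r] exI[of _ "\<lambda>k. real (Suc k) powr (- (Re a - r))"] conjI ballI r(1))
    show "cball a r \<subseteq> {w. Re w > 1}" using Re_cball r by force
    show "(\<lambda>k. real (Suc k) powr (- (Re a - r))) summable_on UNIV" using r by (intro summable_on_Suc_powr) auto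
    show "norm (npow k (- z)) \<le> real (Suc k) powr (- (Re a - r))" if "z \<in> cball a r" for z k
      unfolding norm_npow using Re_cball[OF that] by (intro Suc_powr_mono) auto
  qed
qed (auto intro!: holomorphic_intros simp: open_halfspace_Re_gt)

section \<open>Power sums with a Gaussian weight\<close>

definition gauss_sum :: "complex \<Rightarrow> real \<Rightarrow> complex" where
  "gauss_sum s c = (\<Sum>\<^sub>\<infinity>k. npow k (s - 1) * of_real (exp (- c * real (Suc k) ^ 2)))"

lemma exp_le_Suc_powr:
  assumes "c > 0"
  shows "\<exists>C. \<forall>k. exp (- c * real (Suc k) ^ 2) \<le> C * real (Suc k) powr - a"
proof -
  have "((\<lambda>k. exp (- c * real (Suc k) ^ 2) * real (Suc k) powr a) \<longlongrightarrow> 0) at_top"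
    using assms by real_asymp
  hence "Bseq (\<lambda>k. exp (- c * real (Suc k) ^ 2) * real (Suc k) powr a)"
    by (intro convergent_imp_Bseq) (auto simp: convergent_def)
  then obtain C where C: "\<And>k. norm (exp (- c * real (Suc k) ^ 2) * real (Suc k) powr a) \<le> C"
    unfolding Bseq_def by blast
  have "exp (- c * real (Suc k) ^ 2) \<le> C * real (Suc k) powr - a" for k
    using C[of k] by (simp add: powr_minus field_simps del: of_nat_Suc)
  thus ?thesis by blast
qed

text \<open>The Gaussian is traded for the power \<open>- (b + 1)\<close>, so that the exponents add
  up to \<open>(b - 1) - (b + 1) = -2\<close> throughout \<open>Re s \<le> b\<close>. As
  \<open>b\<close> is arbitrary, the sum is entire in \<open>s\<close>.\<close>

lemma gauss_sum_bound:
  assumes "c > 0"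
  shows "\<exists>C. \<forall>s k. Re s \<le> b \<longrightarrow> norm (npow k (s - 1) * of_real (exp (- c * real (Suc k) ^ 2))) \<le> C * real (Suc k) powr -2"
proof -
  obtain C where C: "\<And>k. exp (- c * real (Suc k) ^ 2) \<le> C * real (Suc k) powr - (b + 1)"
    using exp_le_Suc_powr[OF assms] by blast
  have "norm (npow k (s - 1) * of_real (exp (- c * real (Suc k) ^ 2))) \<le> C * real (Suc k) powr -2" if "Re s \<le> b" for s k
  proof -
    have "norm (npow k (s - 1) * of_real (exp (- c * real (Suc k) ^ 2))) = real (Suc k) powr (Re s - 1) * exp (- c * real (Suc k) ^ 2)"
      by (simp add: norm_mult norm_npow del: of_nat_Suc)
    also have "\<dots> \<le> real (Suc k) powr (b - 1) * (C * real (Suc k) powr - (b + 1))"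
      using that by (intro mult_mono C Suc_powr_mono) auto
    also have "\<dots> = C * (real (Suc k) powr (b - 1) * real (Suc k) powr - (b + 1))" by (simp only: mult_ac)
    also have "real (Suc k) powr (b - 1) * real (Suc k) powr - (b + 1) = real (Suc k) powr -2"
      by (simp add: powr_add [symmetric])
    finally show ?thesis .
  qed
  thus ?thesis by blast
qed

lemma summable_on_gauss_sum:
  assumes "c > 0"
  shows "(\<lambda>k. npow k (s - 1) * of_real (exp (- c * real (Suc k) ^ 2))) summable_on UNIV"
proof -
  obtain C where C: "\<And>z k. Re z \<le> Re s \<Longrightarrow> norm (npow k (z - 1) * of_real (exp (- c * real (Suc k) ^ 2))) \<le> C * real (Suc k) powr -2"
    using gauss_sum_bound[OF assms] by blast
  show ?thesis
    by (rule abs_summable_on_norm_bound(2)[where g = "\<lambda>k. C * real (Suc k) powr -2"])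
       (use C[of s] in \<open>auto intro!: summable_on_cmult_right summable_on_Suc_powr\<close>)
qed

lemma holomorphic_gauss_sum:
  assumes "c > 0"
  shows "(\<lambda>s. gauss_sum s c) holomorphic_on UNIV"
  unfolding gauss_sum_def
proof (rule holomorphic_on_infsum)
  fix a :: complex
  obtain C where C: "\<And>z k. Re z \<le> Re a + 1 \<Longrightarrow> norm (npow k (z - 1) * of_real (exp (- c * real (Suc k) ^ 2))) \<le> C * real (Suc k) powr -2"
    using gauss_sum_bound[OF assms] by blast
  show "\<exists>r>0. \<exists>w. cball a r \<subseteq> UNIV \<and> w summable_on UNIV \<and> (\<forall>z\<in>cball a r. \<forall>k\<in>UNIV. norm (npow k (z - 1) * of_real (exp (- c * real (Suc k) ^ 2))) \<le> w k)"
    by (intro exI[of _ "1::real"] exI[of _ "\<lambda>k. C * real (Suc k) powr -2"] conjI ballI C)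
       (use Re_cball[of _ a 1] in \<open>auto intro!: summable_on_cmult_right summable_on_Suc_powr\<close>)
qed (auto intro!: holomorphic_intros)

text \<open>Substituting \<open>x = t / sqrt c\<close> in the cosine coefficient of a Gaussian of
  scale \<open>c\<close> produces both the frequency and the factor \<open>c powr (- s / 2)\<close>.
  The index \<open>m\<close> stands for the frequency number \<open>m + 1\<close>.\<close>

definition rem_term :: "complex \<Rightarrow> real \<Rightarrow> nat \<Rightarrow> complex" where
  "rem_term s c m = of_real c powr (- s / 2) * cos_transform_rem s (2 * pi * real (Suc m) / sqrt c)"

definition rem_sum :: "complex \<Rightarrow> real \<Rightarrow> complex" where
  "rem_sum s c = (\<Sum>\<^sub>\<infinity>m. rem_term s c m)"

lemma powr_le_sum_endpoints:
  assumes "a \<le> x" "x \<le> b" "t > (0::real)"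
  shows "t powr x \<le> t powr a + t powr b"
proof (cases "t \<ge> 1")
  case True
  hence "t powr x \<le> t powr b" using assms by (intro powr_mono) auto
  thus ?thesis by (intro order.trans[OF _ add_increasing[OF _ order_refl]]) auto
next
  case False
  hence "t powr x \<le> t powr a" using assms by (intro powr_mono') auto
  thus ?thesis by (intro order.trans[OF _ add_increasing2[OF _ order_refl]]) auto
qed

text \<open>The power of \<open>c\<close> hidden in the frequency combines with
  \<open>c powr (- s / 2)\<close> to exactly \<open>c\<^sup>2\<close>, whatever \<open>s\<close> is;
  this square later makes the sum over \<open>k\<close> converge. The exponent
  \<open>- Re s - 4\<close> of the frequency is below -1 precisely for
  \<open>Re s > -3\<close>.\<close>

lemma rem_term_bound:
  assumes a: "Re a > -3"
  shows "\<exists>r>0. \<exists>C\<ge>0. \<exists>e. e < -1 \<and> cball a r \<subseteq> {s. Re s > -3} \<and>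
     (\<forall>z\<in>cball a r. \<forall>c>0. \<forall>m. norm (rem_term z c m) \<le> C * c\<^sup>2 * real (Suc m) powr e)"
proof -
  define r where "r = (Re a + 3) / 2"
  have r: "r > 0" "Re a - r > -3" using a by (auto simp: r_def field_simps)
  let ?I = "\<lambda>x::real. LBINT t:{0<..}. t powr (x + 4 - 1) * exp (- sin (pi / 8) * t)"
  have int: "set_integrable lborel {0<..} (\<lambda>t::real. t powr (x + 4 - 1) * exp (- sin (pi / 8) * t))" if "x > -4" for x
    using that sin_pi_8_pos by (intro set_integrable_powr_exp) auto
  define G where "G = ?I (Re a - r) + ?I (Re a + r)"
  have I_nonneg: "?I x \<ge> 0" for x
    unfolding set_lebesgue_integral_def by (rule Bochner_Integration.integral_nonneg) (auto simp: indicator_def)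
  have G: "?I x \<le> G" if x: "Re a - r \<le> x" "x \<le> Re a + r" for x
  proof -
    have "?I x \<le> (LBINT t:{0<..}. t powr (Re a - r + 4 - 1) * exp (- sin (pi / 8) * t) + t powr (Re a + r + 4 - 1) * exp (- sin (pi / 8) * t))"
    proof (intro set_integral_mono set_integral_add int)
      fix t :: real assume "t \<in> {0<..}"
      hence "t powr (x + 4 - 1) \<le> t powr (Re a - r + 4 - 1) + t powr (Re a + r + 4 - 1)"
        using x by (intro powr_le_sum_endpoints) auto
      thus "t powr (x + 4 - 1) * exp (- sin (pi / 8) * t) \<le> t powr (Re a - r + 4 - 1) * exp (- sin (pi / 8) * t) + t powr (Re a + r + 4 - 1) * exp (- sin (pi / 8) * t)"
        unfolding distrib_right [symmetric] by (rule mult_right_mono) auto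
    qed (use x r in auto)
    also have "\<dots> = G" unfolding G_def using r by (intro set_integral_add int) auto
    finally show ?thesis .
  qed
  have G0: "G \<ge> 0" unfolding G_def by (intro add_nonneg_nonneg I_nonneg)
  define E where "E = exp (pi * (\<bar>Im a\<bar> + r) / 8)"
  define e where "e = - (Re a - r) - 4"
  have main: "norm (rem_term z c m) \<le> 2 * E * G * c\<^sup>2 * real (Suc m) powr e" if z: "z \<in> cball a r" and c: "c > 0" for z c m
  proof -
    let ?n = "real (Suc m)"
    define y where "y = 2 * pi * ?n / sqrt c"
    have y: "y > 0" using c by (simp add: y_def)
    note Rz = Re_cball[OF z]
    have Iz: "\<bar>Im z\<bar> \<le> \<bar>Im a\<bar> + r"
      using z abs_Im_le_cmod[of "a - z"] by (simp add: dist_norm)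
    have ray: "norm (ray_rem \<eta> z y) \<le> E * G * y powr (- Re z - 4)" if "\<eta> = \<i> \<or> \<eta> = -\<i>" for \<eta>
    proof -
      have "norm (ray_rem \<eta> z y) \<le> exp (pi * \<bar>Im z\<bar> / 8) * ?I (Re z) * y powr (- Re z - 4)"
        using Rz r by (intro norm_ray_rem_le that y) auto
      also have "\<dots> \<le> E * G * y powr (- Re z - 4)"
        unfolding E_def using Iz G[of "Re z"] Rz by (intro mult_right_mono mult_mono I_nonneg) auto
      finally show ?thesis .
    qed
    have "norm (rem_term z c m) = c powr (- Re z / 2) * norm (cos_transform_rem z y)"
      using c by (simp add: rem_term_def norm_mult norm_of_real_powr y_def)
    also have "norm (cos_transform_rem z y) \<le> 2 * E * G * y powr (- Re z - 4)"
      unfolding cos_transform_rem_def using norm_triangle_ineq[of "ray_rem \<i> z y" "ray_rem (-\<i>) z y"] ray[of "\<i>"] ray[of "-\<i>"] by simp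
    also have "c powr (- Re z / 2) * (2 * E * G * y powr (- Re z - 4)) = 2 * E * G * (c powr (- Re z / 2) * y powr (- Re z - 4))"
      by (simp only: mult_ac)
    also have "c powr (- Re z / 2) * y powr (- Re z - 4) = c\<^sup>2 * (2 * pi * ?n) powr (- Re z - 4)"
    proof -
      have "y powr (- Re z - 4) = (2 * pi * ?n) powr (- Re z - 4) / (c powr (1 / 2)) powr (- Re z - 4)"
        unfolding y_def using c by (simp add: powr_divide powr_half_sqrt del: of_nat_Suc)
      also have "(c powr (1 / 2)) powr (- Re z - 4) = c powr (- Re z / 2 - 2)"
        by (simp add: powr_powr field_simps)
      also have "\<dots> = c powr (- Re z / 2) / c\<^sup>2"
        using c by (simp add: powr_diff)
      finally show ?thesis using c by simp
    qed
    also have "(2 * pi * ?n) powr (- Re z - 4) \<le> ?n powr e"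
    proof -
      have "?n \<le> 2 * pi * ?n" using pi_gt3 by simp
      hence "(2 * pi * ?n) powr (- Re z - 4) \<le> ?n powr (- Re z - 4)" using Rz r by (intro powr_mono2') auto
      also have "\<dots> \<le> ?n powr e" using Rz by (intro Suc_powr_mono) (auto simp: e_def)
      finally show ?thesis .
    qed
    finally show ?thesis using G0 by (simp add: E_def mult_left_mono mult.assoc)
  qed
  show ?thesis
  proof (rule exI[of _ r], intro conjI r(1), rule exI[of _ "2 * E * G"], intro conjI, goal_cases)
    case 2
    show ?case
    proof (rule exI[of _ e], intro conjI ballI allI impI main)
      show "cball a r \<subseteq> {s. Re s > -3}" using Re_cball r by force
    qed (use r in \<open>auto simp: e_def\<close>)
  qed (use G0 in \<open>auto simp: E_def\<close>)
qed

lemma holomorphic_rem_term: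
  assumes "c > 0"
  shows "(\<lambda>s. rem_term s c m) holomorphic_on {s. Re s > -3}"
proof -
  have "(\<lambda>s. ray_rem \<eta> s (2 * pi * real (Suc m) / sqrt c)) holomorphic_on {s. Re s > -3}" if "\<eta> = \<i> \<or> \<eta> = -\<i>" for \<eta>
    by (rule holomorphic_on_subset[OF holomorphic_ray_rem[OF that]]) (use assms in auto)
  thus ?thesis unfolding rem_term_def cos_transform_rem_def using assms by (intro holomorphic_intros) auto
qed

lemma summable_on_rem_term:
  assumes "Re s > -3" "c > 0"
  shows "(\<lambda>m. rem_term s c m) summable_on UNIV"
proof -
  obtain r C e where *: "r > 0" "e < -1" "\<And>z c m. z \<in> cball s r \<Longrightarrow> c > 0 \<Longrightarrow> norm (rem_term z c m) \<le> C * c\<^sup>2 * real (Suc m) powr e"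
    using rem_term_bound[OF assms(1)] by metis
  show ?thesis
  proof (rule abs_summable_on_norm_bound(2))
    show "(\<lambda>m. C * c\<^sup>2 * real (Suc m) powr e) summable_on UNIV"
      using *(2) by (intro summable_on_cmult_right summable_on_Suc_powr)
    show "norm (rem_term s c m) \<le> C * c\<^sup>2 * real (Suc m) powr e" for m
      using *(1,3) assms(2) by simp
  qed
qed

lemma holomorphic_rem_sum:
  assumes "c > 0"
  shows "(\<lambda>s. rem_sum s c) holomorphic_on {s. Re s > -3}"
  unfolding rem_sum_def
proof (rule holomorphic_on_infsum)
  fix a assume "a \<in> {s. Re s > -3}"
  then obtain r C e where "r > 0" "e < -1" "cball a r \<subseteq> {s. Re s > -3}"
      "\<And>z c m. z \<in> cball a r \<Longrightarrow> c > 0 \<Longrightarrow> norm (rem_term z c m) \<le> C * c\<^sup>2 * real (Suc m) powr e"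
    using rem_term_bound[of a] by (metis mem_Collect_eq)
  thus "\<exists>r>0. \<exists>w. cball a r \<subseteq> {s. Re s > -3} \<and> w summable_on UNIV \<and> (\<forall>z\<in>cball a r. \<forall>m\<in>UNIV. norm (rem_term z c m) \<le> w m)"
    using assms
    by (intro exI[of _ r] exI[of _ "\<lambda>m. C * c\<^sup>2 * real (Suc m) powr e"] conjI) (auto intro!: summable_on_cmult_right summable_on_Suc_powr)
qed (use assms in \<open>auto intro!: holomorphic_rem_term simp: open_halfspace_Re_gt\<close>)

text \<open>The factor \<open>c\<^sup>2\<close> of the uniform bound makes the whole remainder
  vanish with the scale, which isolates zeta values in the limit.\<close>

lemma tendsto_rem_sum:
  assumes "Re s > -3"
  shows "((\<lambda>c. rem_sum s c) \<longlongrightarrow> 0) (at_right 0)"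
proof -
  obtain r C e where *: "r > 0" "e < -1" "\<And>z c m. z \<in> cball s r \<Longrightarrow> c > 0 \<Longrightarrow> norm (rem_term z c m) \<le> C * c\<^sup>2 * real (Suc m) powr e"
    using rem_term_bound[OF assms(1)] by metis
  define Q where "Q = (\<Sum>\<^sub>\<infinity>m. real (Suc m) powr e)"
  have bd: "norm (rem_sum s c) \<le> C * c\<^sup>2 * Q" if "c > 0" for c
  proof -
    have "norm (rem_sum s c) \<le> (\<Sum>\<^sub>\<infinity>m. C * c\<^sup>2 * real (Suc m) powr e)"
      unfolding rem_sum_def using * that
      by (intro abs_summable_on_norm_bound(3) summable_on_cmult_right summable_on_Suc_powr) auto
    also have "\<dots> = C * c\<^sup>2 * Q"
      unfolding Q_def using * by (intro infsum_cmult_right summable_on_Suc_powr)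
    finally show ?thesis .
  qed
  show ?thesis
  proof (rule Lim_null_comparison)
    show "\<forall>\<^sub>F c in at_right 0. norm (rem_sum s c) \<le> C * c\<^sup>2 * Q"
      using eventually_at_right_less[of 0] by eventually_elim (use bd in auto)
    have "((\<lambda>c. C * c\<^sup>2 * Q) \<longlongrightarrow> C * 0\<^sup>2 * Q) (at_right 0)" by (intro tendsto_intros)
    thus "((\<lambda>c. C * c\<^sup>2 * Q) \<longlongrightarrow> 0) (at_right 0)" by simp
  qed
qed

section \<open>Poisson summation of the Gaussian-weighted sums\<close>

lemma of_real_frequency_powr:
  assumes "c > 0"
  shows "complex_of_real (2 * pi * real (Suc m) / sqrt c) powr w = of_real (2 * pi) powr w * npow m w * of_real c powr (- w / 2)"
proof -
  have "ln (2 * pi * real (Suc m) / sqrt c) = ln (2 * pi) + ln (real (Suc m)) - ln c / 2"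
    using assms by (simp add: ln_div ln_mult ln_sqrt)
  hence "complex_of_real (2 * pi * real (Suc m) / sqrt c) powr w = exp (w * (of_real (ln (2 * pi)) + of_real (ln (real (Suc m))) - of_real (ln c / 2)))"
    using assms by (subst of_real_powr_exp) (auto simp del: of_real_mult of_real_divide)
  also have "\<dots> = exp (w * of_real (ln (2 * pi))) * exp (w * of_real (ln (real (Suc m)))) * exp (- w / 2 * of_real (ln c))"
    unfolding exp_add [symmetric] by (rule arg_cong[where f = exp]) (simp add: algebra_simps)
  also have "\<dots> = of_real (2 * pi) powr w * npow m w * of_real c powr (- w / 2)"
    unfolding npow_def using assms by (subst (1 2 3) of_real_powr_exp) auto
  finally show ?thesis .
qed

text \<open>The factor of the functional equation
  \<open>zeta (1 - s) = fe_factor s * zeta s\<close>. It arises here as the leading asymptotic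
  coefficient of the cosine transform at the frequencies \<open>2 * pi * m\<close>.\<close>

definition fe_factor :: "complex \<Rightarrow> complex" where
  "fe_factor s = 2 * Gamma s * cos (of_real pi * s / 2) * of_real (2 * pi) powr (- s)"

lemma fe_factor_plus_2:
  "fe_factor (s + 2) = - (2 * Gamma (s + 2) * cos (of_real pi * s / 2) * of_real (2 * pi) powr (- s - 2))"
proof -
  have "cos (of_real pi * (s + 2) / 2) = cos (of_real pi * s / 2 + of_real pi)"
    by (rule arg_cong[where f = cos]) (simp add: field_simps)
  also have "\<dots> = - cos (of_real pi * s / 2)"
    unfolding cos_add cos_of_real sin_of_real by simp
  finally have 1: "cos (of_real pi * (s + 2) / 2) = - cos (of_real pi * s / 2)" .
  have 2: "- (s + 2) = - s - 2" by simp
  show ?thesis unfolding fe_factor_def 1 2 by simp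
qed

text \<open>After scaling, the powers of \<open>c\<close> cancel in the leading term and leave one
  factor \<open>c\<close> in the second. The independence of the leading term from the scale is what
  drives the continuation of zeta.\<close>

lemma scaled_cos_transform_eq:
  assumes c: "c > 0" and s: "Re s > 0"
  shows "of_real c powr (- s / 2) * cos_transform s (2 * pi * real (Suc m) / sqrt c) =
     fe_factor s * npow m (- s) + (- (fe_factor (s + 2) * of_real c)) * npow m (- (s + 2)) + rem_term s c m"
proof -
  have y: "2 * pi * real (Suc m) / sqrt c > 0" using c by simp
  have 1: "of_real c powr (- s / 2) * of_real c powr (- (- s) / 2) = 1"
    using c by (simp flip: powr_add)
  have 2: "of_real c powr (- s / 2) * of_real c powr (- (- s - 2) / 2) = of_real c"
  proof -
    have "of_real c powr (- s / 2) * of_real c powr (- (- s - 2) / 2) = of_real c powr (- s / 2 + (- (- s - 2) / 2))"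
      by (simp only: powr_add)
    also have "- s / 2 + (- (- s - 2) / 2) = 1" by (simp add: field_simps)
    finally show ?thesis using c by simp
  qed
  have e: "- (s + 2) = - s - 2" by simp
  have "of_real c powr (- s / 2) * cos_transform s (2 * pi * real (Suc m) / sqrt c) =
     2 * Gamma s * cos (of_real pi * s / 2) * of_real (2 * pi) powr (- s) * npow m (- s) * (of_real c powr (- s / 2) * of_real c powr (- (- s) / 2))
     + 2 * Gamma (s + 2) * cos (of_real pi * s / 2) * of_real (2 * pi) powr (- s - 2) * npow m (- s - 2) * (of_real c powr (- s / 2) * of_real c powr (- (- s - 2) / 2))
     + rem_term s c m"
    unfolding cos_transform_expansion[OF y s] rem_term_def of_real_frequency_powr[OF c] by (simp only: ring_distribs mult_ac)
  also have "\<dots> = 2 * Gamma s * cos (of_real pi * s / 2) * of_real (2 * pi) powr (- s) * npow m (- s)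
     + 2 * Gamma (s + 2) * cos (of_real pi * s / 2) * of_real (2 * pi) powr (- s - 2) * npow m (- s - 2) * of_real c + rem_term s c m"
    unfolding 1 2 by simp
  finally show ?thesis unfolding fe_factor_plus_2 e by (simp add: fe_factor_def mult_ac)
qed

lemma has_sum_scaled_cos_transform:
  assumes c: "c > 0" and s: "Re s > 1"
  shows "((\<lambda>m. of_real c powr (- s / 2) * cos_transform s (2 * pi * real (Suc m) / sqrt c)) has_sum
     (fe_factor s * zetaD s - fe_factor (s + 2) * zetaD (s + 2) * of_real c + rem_sum s c)) UNIV"
proof -
  have s0: "Re s > 0" using s by simp
  have "((\<lambda>m. rem_term s c m) has_sum rem_sum s c) UNIV"
    unfolding rem_sum_def using c s by (intro has_sum_infsum summable_on_rem_term) auto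
  moreover have "((\<lambda>m. npow m (- s)) has_sum zetaD s) UNIV" "((\<lambda>m. npow m (- (s + 2))) has_sum zetaD (s + 2)) UNIV"
    using s by (auto intro!: has_sum_zetaD simp del: minus_add_distrib)
  ultimately have "((\<lambda>m. fe_factor s * npow m (- s) + (- (fe_factor (s + 2) * of_real c)) * npow m (- (s + 2)) + rem_term s c m) has_sum
     (fe_factor s * zetaD s + (- (fe_factor (s + 2) * of_real c)) * zetaD (s + 2) + rem_sum s c)) UNIV"
    by (intro has_sum_add has_sum_cmult_right)
  thus ?thesis unfolding scaled_cos_transform_eq[OF c s0] by (simp add: algebra_simps)
qed

lemma gauss_cos_integral:
  assumes c: "c > 0" and s: "Re s > 0" and y: "y = 2 * pi * real m / sqrt c"
  shows "(LBINT x:{0<..}. of_real x powr (s - 1) * exp (- of_real c * of_real x ^ 2) * of_real (cos (2 * pi * real m * x)))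
     = 1 / 2 * (of_real c powr (- s / 2) * cos_transform s y)"
proof -
  define a where "a = 1 / sqrt c"
  have a: "a > 0" using c by (simp add: a_def)
  let ?f = "\<lambda>x. of_real x powr (s - 1) * exp (- of_real c * of_real x ^ 2) * of_real (cos (2 * pi * real m * x))"
  have "?f (a * t) = of_real a powr (s - 1) * (of_real t powr (s - 1) * exp (- (of_real t ^ 2)) * cos (of_real (y * t)))" if "t > 0" for t
  proof -
    have "of_real (a * t) powr (s - 1) = of_real a powr (s - 1) * of_real t powr (s - 1)"
      by (rule of_real_powr_mult_left[OF a that])
    moreover have "complex_of_real c * of_real (a * t) ^ 2 = of_real t ^ 2"
    proof -
      have "c * (a * t) ^ 2 = t ^ 2" using c by (simp add: a_def power_mult_distrib power_divide)
      thus ?thesis by (simp only: of_real_power [symmetric] of_real_mult [symmetric])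
    qed
    moreover have "2 * pi * real m * (a * t) = y * t" by (simp add: y a_def)
    ultimately show ?thesis by (simp only: mult_minus_left cos_of_real mult.assoc)
  qed
  hence "(LBINT t:{0<..}. ?f (a * t)) = (LBINT t:{0<..}. of_real a powr (s - 1) * (of_real t powr (s - 1) * exp (- (of_real t ^ 2)) * cos (of_real (y * t))))"
    by (intro set_lebesgue_integral_cong) auto
  also have "\<dots> = of_real a powr (s - 1) * (LBINT t:{0<..}. of_real t powr (s - 1) * exp (- (of_real t ^ 2)) * cos (of_real (y * t)))"
    by (rule set_integral_mult_right)
  also have "\<dots> = of_real a powr (s - 1) * (1 / 2 * cos_transform s y)" by (simp add: cos_transform_def)
  finally have "(LBINT x:{0<..}. ?f x) = (of_real a * of_real a powr (s - 1)) * (1 / 2 * cos_transform s y)"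
    using set_integral_pos_scale[OF a, of ?f] by (simp add: scaleR_conv_of_real)
  also have "of_real a * of_real a powr (s - 1) = of_real c powr (- s / 2)"
  proof -
    have "of_real a * of_real a powr (s - 1) = of_real a powr s"
      using a by (simp add: powr_diff)
    also have "ln a = - ln c / 2" using c by (simp add: a_def ln_div ln_sqrt)
    hence "of_real a powr s = of_real c powr (- s / 2)" using a c by (simp add: of_real_powr_exp)
    finally show ?thesis .
  qed
  finally show ?thesis by (simp only: mult_ac)
qed

lemma tendsto_powr_gauss_0:
  assumes "a > 0" "c > 0"
  shows "((\<lambda>x::real. x powr a * exp (- c * x\<^sup>2)) \<longlongrightarrow> 0) (at_right 0)" "((\<lambda>x::real. x powr a * exp (- c * x\<^sup>2)) \<longlongrightarrow> 0) at_top"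
  using assms by real_asymp+

text \<open>The condition \<open>Re s > 1\<close> makes \<open>x powr (s - 1)\<close> vanish at 0,
  as Poisson summation on the half-line demands, and makes the leading terms summable to
  \<open>zetaD s\<close>.\<close>

lemma gauss_sum_poisson:
  assumes c: "c > 0" and s: "Re s > 1"
  shows "gauss_sum s c = 1 / 2 * Gamma (s / 2) * of_real c powr (- s / 2)
     + fe_factor s * zetaD s - fe_factor (s + 2) * zetaD (s + 2) * of_real c + rem_sum s c"
proof -
  define h where "h = (\<lambda>x::real. complex_of_real x powr (s - 1) * exp (- of_real c * of_real x ^ 2))"
  \<comment> \<open>The summand \<open>0 * of_real x\<close> and the exponent
    \<open>s + 1 - 1\<close> keep both terms in the shape of
    \<open>set_integrable_cpowr_gauss\<close> with \<open>\<mu> = 0\<close>.\<close>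
  define h' where "h' = (\<lambda>x::real. (s - 1) * (complex_of_real x powr (s - 1 - 1) * exp (0 * of_real x - of_real c * of_real x ^ 2))
     - 2 * of_real c * (of_real x powr (s + 1 - 1) * exp (0 * of_real x - of_real c * of_real x ^ 2)))"
  let ?u = "\<lambda>m. of_real c powr (- s / 2) * cos_transform s (2 * pi * real (Suc m) / sqrt c)"
  have s0: "Re s > 0" using s by simp
  have norm_h: "norm (h x) = x powr (Re s - 1) * exp (- c * x\<^sup>2)" if "x > 0" for x
    using that by (simp add: h_def norm_mult norm_of_real_powr norm_exp_eq_Re flip: of_real_power)
  have cosint: "(LBINT x:{0<..}. h x * of_real (cos (2 * pi * real (Suc m) * x))) = 1 / 2 * ?u m" for m
    unfolding h_def by (rule gauss_cos_integral[OF c s0 refl])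
  note hs = has_sum_scaled_cos_transform[OF c s]
  \<comment> \<open>For complex terms unordered summability is absolute summability, the form
    required by \<open>poisson_half_line\<close>.\<close>
  have abs: "summable (\<lambda>m. norm (?u m))"
    using has_sum_imp_summable[OF hs] by (intro summable_on_imp_summable) (simp add: summable_on_iff_abs_summable_on_complex)
  have "(\<lambda>k. h (real (Suc k))) sums ((LBINT x:{0<..}. h x) + (\<Sum>m. 2 * (LBINT x:{0<..}. h x * of_real (cos (2 * pi * real (Suc m) * x)))))"
  proof (rule poisson_half_line[where h' = h'])
    fix x :: real assume x: "x > 0"
    have "((\<lambda>z. z powr (s - 1) * exp (- of_real c * z ^ 2)) has_field_derivative h' x) (at (of_real x))"
      unfolding h'_def using x by (auto intro!: derivative_eq_intros simp: powr_diff field_simps power2_eq_square)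
    from has_vector_derivative_real_field[OF this]
    show "(h has_vector_derivative h' x) (at x)" by (simp add: h_def)
  next
    have "continuous_on {0<..} (\<lambda>x. exp (0 * complex_of_real x - of_real c * of_real x ^ 2))"
      by (intro continuous_intros)
    thus "continuous_on {0<..} h'" unfolding h'_def
      by (intro continuous_on_diff continuous_on_mult continuous_on_const continuous_on_of_real_powr)
    show "set_integrable lborel {0<..} h" unfolding h_def
      using set_integrable_cpowr_gauss[OF s0, of "of_real c" 0] c by simp
    show "set_integrable lborel {0<..} h'" unfolding h'_def
      by (intro set_integral_diff set_integrable_mult_right impI set_integrable_cpowr_gauss) (use s c in auto)
    show "(h \<longlongrightarrow> 0) (at_right 0)"
    proof (rule Lim_null_comparison)
      show "\<forall>\<^sub>F x in at_right 0. norm (h x) \<le> x powr (Re s - 1) * exp (- c * x\<^sup>2)"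
        using eventually_at_right_less[of "0::real"] by eventually_elim (use norm_h in auto)
    qed (use s c tendsto_powr_gauss_0(1)[of "Re s - 1" c] in simp)
    show "(h \<longlongrightarrow> 0) at_top"
    proof (rule Lim_null_comparison)
      show "\<forall>\<^sub>F x in at_top. norm (h x) \<le> x powr (Re s - 1) * exp (- c * x\<^sup>2)"
        using eventually_gt_at_top[of "0::real"] by eventually_elim (use norm_h in auto)
    qed (use s c tendsto_powr_gauss_0(2)[of "Re s - 1" c] in simp)
    show "summable (\<lambda>m. norm (LBINT x:{0<..}. h x * of_real (cos (2 * pi * real (Suc m) * x))))"
      unfolding cosint norm_mult[of "1 / 2"] by (intro summable_mult abs)
  qed
  moreover have G: "(\<lambda>k. h (real (Suc k))) sums gauss_sum s c"
  proof -
    have "(\<lambda>k. npow k (s - 1) * of_real (exp (- c * real (Suc k) ^ 2))) sums gauss_sum s c"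
      unfolding gauss_sum_def by (intro has_sum_imp_sums has_sum_infsum summable_on_gauss_sum c)
    thus ?thesis by (simp add: h_def npow_def exp_of_real [symmetric])
  qed
  moreover have "(LBINT x:{0<..}. h x) = 1 / 2 * Gamma (s / 2) * of_real c powr (- s / 2)"
    unfolding h_def using c by (intro Gamma_set_integral_gauss s0) auto
  moreover have "(\<Sum>m. 2 * (LBINT x:{0<..}. h x * of_real (cos (2 * pi * real (Suc m) * x)))) =
      fe_factor s * zetaD s - fe_factor (s + 2) * zetaD (s + 2) * of_real c + rem_sum s c"
    using sums_unique[OF has_sum_imp_sums[OF hs]] unfolding cosint by simp
  ultimately have "(\<lambda>k. h (real (Suc k))) sums (1 / 2 * Gamma (s / 2) * of_real c powr (- s / 2) +
      (fe_factor s * zetaD s - fe_factor (s + 2) * zetaD (s + 2) * of_real c + rem_sum s c))" by (simp only:)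
  from sums_unique2[OF G this] show ?thesis by (simp only: add_diff_eq add.assoc [symmetric])
qed

text \<open>
  For \<open>Re s > 1\<close> this is \<open>fe_factor s * zetaD s\<close>, hence independent of \<open>c\<close> also on the larger domain
  \<open>Re s > -1\<close>; letting \<open>c\<close> tend to \<open>0\<close> for \<open>Re s < 0\<close> gives \<open>zetaD (1 - s)\<close>. Both the existence of the continuation
  and the functional equation come from this.
\<close>

definition zeta_cont :: "real \<Rightarrow> complex \<Rightarrow> complex" where
  "zeta_cont c s = gauss_sum s c - 1 / 2 * Gamma (s / 2) * of_real c powr (- s / 2)
     + fe_factor (s + 2) * zetaD (s + 2) * of_real c - rem_sum s c"

lemma not_nonpos_Int_if_Re_gt:
  assumes "Re z > - 1" "z \<noteq> 0"
  shows "z \<notin> \<int>\<^sub>\<le>\<^sub>0"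
proof
  assume "z \<in> \<int>\<^sub>\<le>\<^sub>0"
  then obtain n where n: "z = - of_nat n" by (auto elim!: nonpos_Ints_cases')
  hence "n = 0" using assms(1) by simp
  thus False using n assms(2) by simp
qed

lemma not_nonpos_Int_if_Re_pos: "Re z > 0 \<Longrightarrow> z \<notin> \<int>\<^sub>\<le>\<^sub>0"
  by (rule not_nonpos_Int_if_Re_gt) auto

lemma holomorphic_fe_factor: "(\<And>z. z \<in> A \<Longrightarrow> Re (f z) > 0) \<Longrightarrow> f holomorphic_on A \<Longrightarrow> (\<lambda>z. fe_factor (f z)) holomorphic_on A"
  unfolding fe_factor_def by (intro holomorphic_intros) (auto dest: not_nonpos_Int_if_Re_pos)

lemma holomorphic_zeta_cont:
  assumes "c > 0"
  shows "zeta_cont c holomorphic_on {s. Re s > -1} - {0}"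
proof -
  have "(\<lambda>s. gauss_sum s c) holomorphic_on {s. Re s > -1} - {0}" "(\<lambda>s. rem_sum s c) holomorphic_on {s. Re s > -1} - {0}"
    by (rule holomorphic_on_subset[OF holomorphic_gauss_sum[OF assms]] holomorphic_on_subset[OF holomorphic_rem_sum[OF assms]]; auto)+
  moreover have "(\<lambda>s. fe_factor (s + 2)) holomorphic_on {s. Re s > -1} - {0}"
    by (rule holomorphic_fe_factor) (auto intro!: holomorphic_intros)
  moreover have "(\<lambda>s. zetaD (s + 2)) holomorphic_on {s. Re s > -1} - {0}"
    by (rule holomorphic_on_compose_gen[OF _ holomorphic_zetaD, unfolded o_def]) (auto intro!: holomorphic_intros)
  moreover have "z / 2 \<notin> \<int>\<^sub>\<le>\<^sub>0" if "z \<in> {s. Re s > -1} - {0}" for z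
    using that by (intro not_nonpos_Int_if_Re_gt) auto
  ultimately show ?thesis unfolding zeta_cont_def using assms
    by (intro holomorphic_intros) auto
qed

lemma connected_halfplane_minus_finite:
  assumes "finite F"
  shows "connected ({s. Re s > x} - F)"
  by (rule connected_open_diff_countable)
     (use assms in \<open>auto simp: open_halfspace_Re_gt countable_finite convex_connected convex_halfspace_Re_gt\<close>)

lemma open_halfplane_minus_finite:
  assumes "finite F"
  shows "open ({s. Re s > x} - F)"
  using assms by (intro open_Diff finite_imp_closed) (auto simp: open_halfspace_Re_gt)

lemma zeta_cont_eq_if_Re_gt_1:
  assumes "c > 0" "Re s > 1"
  shows "zeta_cont c s = fe_factor s * zetaD s"
  unfolding zeta_cont_def gauss_sum_poisson[OF assms] by simp

lemma zeta_cont_indep: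
  assumes "c > 0" "Re s > -1" "s \<noteq> 0"
  shows "zeta_cont c s = zeta_cont 1 s"
proof (rule analytic_continuation_open[where f = "zeta_cont c" and g = "zeta_cont 1" and s = "{s. Re s > 1}" and s' = "{s. Re s > -1} - {0}"])
  show "{s. Re s > 1} \<noteq> {}" by (auto intro: exI[of _ 2])
qed (use assms in \<open>auto simp: zeta_cont_eq_if_Re_gt_1 open_halfspace_Re_gt
       intro!: holomorphic_zeta_cont connected_halfplane_minus_finite open_halfplane_minus_finite\<close>)

text \<open>For \<open>Re s < 0\<close> the series without Gaussian weight converges absolutely and
  dominates, so Tannery's theorem applies.\<close>

lemma tendsto_gauss_sum:
  assumes "Re s < 0"
  shows "((\<lambda>c. gauss_sum s c) \<longlongrightarrow> zetaD (1 - s)) (at_right 0)"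
proof -
  let ?a = "\<lambda>k c. npow k (s - 1) * of_real (exp (- c * real (Suc k) ^ 2))"
  have pos: "\<forall>\<^sub>F c in at_right (0::real). c > 0" by (rule eventually_at_right_less)
  have summ: "(\<lambda>k. real (Suc k) powr (Re s - 1)) summable_on UNIV"
    using assms by (intro summable_on_Suc_powr) auto
  have "((\<lambda>c. \<Sum>k. ?a k c) \<longlongrightarrow> (\<Sum>k. npow k (s - 1))) (at_right 0)"
  proof (rule tannerys_theorem[THEN conjunct2, THEN conjunct2])
    show "((\<lambda>c. ?a k c) \<longlongrightarrow> npow k (s - 1)) (at_right 0)" for k
    proof -
      have "((\<lambda>c. ?a k c) \<longlongrightarrow> npow k (s - 1) * of_real (exp (- 0 * real (Suc k) ^ 2))) (at_right 0)"
        by (intro tendsto_intros)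
      thus ?thesis by simp
    qed
    have "\<forall>\<^sub>F c in at_right (0::real). \<forall>k. norm (?a k c) \<le> real (Suc k) powr (Re s - 1)"
      using pos by eventually_elim (auto simp: norm_mult norm_npow intro!: mult_left_le)
    thus "\<forall>\<^sub>F (k, c) in at_top \<times>\<^sub>F at_right (0::real). norm (?a k c) \<le> real (Suc k) powr (Re s - 1)"
      by (subst eventually_prod_filter, intro exI[of _ "\<lambda>_. True"] exI[of _ "\<lambda>c. \<forall>k. norm (?a k c) \<le> real (Suc k) powr (Re s - 1)"]) auto
    show "summable (\<lambda>k. real (Suc k) powr (Re s - 1))" using summ by (rule summable_on_imp_summable)
  qed auto
  moreover have "(\<Sum>k. npow k (s - 1)) = zetaD (1 - s)"
    using has_sum_imp_sums[OF has_sum_zetaD[of "1 - s"]] assms by (simp add: sums_iff)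
  moreover have "\<forall>\<^sub>F c in at_right 0. (\<Sum>k. ?a k c) = gauss_sum s c"
    using pos
  proof eventually_elim
    case (elim c)
    show ?case unfolding gauss_sum_def
      by (rule sums_unique [symmetric], rule has_sum_imp_sums, rule has_sum_infsum, rule summable_on_gauss_sum[OF elim])
  qed
  ultimately show ?thesis by (simp add: tendsto_cong)
qed

lemma tendsto_of_real_powr_0:
  assumes "Re w > 0"
  shows "((\<lambda>c. complex_of_real c powr w) \<longlongrightarrow> 0) (at_right 0)"
proof (rule Lim_null_comparison)
  show "\<forall>\<^sub>F c in at_right 0. norm (complex_of_real c powr w) \<le> c powr Re w"
    using eventually_at_right_less[of "0::real"] by eventually_elim (simp add: norm_of_real_powr)
  show "((\<lambda>c. c powr Re w) \<longlongrightarrow> 0) (at_right 0)" using assms by real_asymp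
qed

lemma zeta_cont_eq_zetaD:
  assumes "-1 < Re s" "Re s < 0"
  shows "zeta_cont 1 s = zetaD (1 - s)"
proof -
  have "((\<lambda>c. zeta_cont c s) \<longlongrightarrow> zetaD (1 - s) - 1 / 2 * Gamma (s / 2) * 0 + fe_factor (s + 2) * zetaD (s + 2) * of_real 0 - 0) (at_right 0)"
    unfolding zeta_cont_def using assms by (intro tendsto_intros tendsto_gauss_sum tendsto_of_real_powr_0 tendsto_rem_sum) auto
  moreover have "\<forall>\<^sub>F c in at_right 0. zeta_cont c s = zeta_cont 1 s"
    using eventually_at_right_less[of "0::real"] by eventually_elim (use assms in \<open>auto intro!: zeta_cont_indep\<close>)
  ultimately have "((\<lambda>c::real. zeta_cont 1 s) \<longlongrightarrow> zetaD (1 - s)) (at_right 0)"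
    by (simp add: tendsto_cong)
  thus ?thesis by (simp add: tendsto_const_iff)
qed

text \<open>Makes the choice in the definition of \<open>zeta\<close> meaningful. The pieces
  \<open>zetaD\<close> on \<open>Re w > 1\<close> and \<open>zeta_cont 1 (1 - w)\<close> on
  \<open>Re w < 2\<close> agree on the strip between by \<open>zeta_cont_eq_zetaD\<close>, and
  together they miss only the point 1.\<close>

lemma zeta_exists:
  "\<exists>f. f holomorphic_on - {1} \<and> (\<forall>s. Re s > 1 \<longrightarrow> (\<lambda>n. 1 / of_nat (Suc n) powr s) sums f s)"
proof (intro exI conjI allI impI)
  define f where "f = (\<lambda>w. if Re w > 1 then zetaD w else zeta_cont 1 (1 - w))"
  have f2: "f w = zeta_cont 1 (1 - w)" if "Re w < 2" for w
    using that zeta_cont_eq_zetaD[of "1 - w"] by (auto simp: f_def)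
  have "f holomorphic_on {w. Re w > 1}"
    by (rule holomorphic_transform[OF holomorphic_zetaD]) (simp add: f_def)
  moreover have "(\<lambda>w. zeta_cont 1 (1 - w)) holomorphic_on {w. Re w < 2} - {1}"
    by (rule holomorphic_on_compose_gen[OF _ holomorphic_zeta_cont[of 1], unfolded o_def]) (auto intro!: holomorphic_intros)
  hence "f holomorphic_on {w. Re w < 2} - {1}"
    by (rule holomorphic_transform) (simp add: f2)
  ultimately have "f holomorphic_on {w. Re w > 1} \<union> ({w. Re w < 2} - {1})"
    by (intro holomorphic_on_Un) (auto simp: open_halfspace_Re_gt open_halfspace_Re_lt)
  also have "{w. Re w > 1} \<union> ({w. Re w < 2} - {1}) = - {1}" by auto
  finally show "f holomorphic_on - {1}" .
  fix s :: complex assume s: "Re s > 1"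
  have "(\<lambda>n. npow n (- s)) sums f s" using has_sum_imp_sums[OF has_sum_zetaD[OF s]] s by (simp add: f_def)
  thus "(\<lambda>n. 1 / of_nat (Suc n) powr s) sums f s" by (simp add: npow_def powr_minus divide_inverse)
qed

section \<open>The zeta function and its functional equation\<close>

lemma zeta_spec:
  "zeta holomorphic_on - {1}" "Re s > 1 \<Longrightarrow> (\<lambda>n. 1 / of_nat (Suc n) powr s) sums zeta s"
  using someI_ex[OF zeta_exists] unfolding zeta_def by blast+

lemma zeta_eq_zetaD:
  assumes "Re s > 1"
  shows "zeta s = zetaD s"
proof -
  have "(\<lambda>n. npow n (- s)) sums zeta s"
    using zeta_spec(2)[OF assms] by (simp add: npow_def powr_minus divide_inverse)
  thus ?thesis using has_sum_imp_sums[OF has_sum_zetaD[OF assms]] by (rule sums_unique2)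
qed

lemma holomorphic_zeta [holomorphic_intros]:
  assumes "f holomorphic_on A" "\<And>z. z \<in> A \<Longrightarrow> f z \<noteq> 1"
  shows "(\<lambda>z. zeta (f z)) holomorphic_on A"
  by (rule holomorphic_on_compose_gen[OF assms(1) zeta_spec(1), unfolded o_def]) (use assms in auto)

lemma zeta_eq_zeta_cont:
  assumes "c > 0" "Re s > -1" "s \<noteq> 0"
  shows "zeta (1 - s) = zeta_cont c s"
proof -
  have "zeta (1 - s) = zeta_cont 1 s"
  proof (rule analytic_continuation_open[where f = "\<lambda>s. zeta (1 - s)" and g = "zeta_cont 1" and s = "{s. Re s > -1} \<inter> {s. Re s < 0}" and s' = "{s. Re s > -1} - {0}"])
    have "- 1 / 2 \<in> {s. Re s > -1} \<inter> {s. Re s < 0}" by simp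
    thus "{s. Re s > -1} \<inter> {s. Re s < 0} \<noteq> {}" by blast
  qed (use assms in \<open>auto simp: zeta_cont_eq_zetaD zeta_eq_zetaD open_halfspace_Re_gt open_halfspace_Re_lt
       intro!: holomorphic_zeta_cont connected_halfplane_minus_finite open_halfplane_minus_finite holomorphic_intros\<close>)
  thus ?thesis using zeta_cont_indep[OF assms] by simp
qed

text \<open>\<open>zeta_cont\<close> represents \<open>zeta (1 - s)\<close> on its whole domain and
  equals \<open>fe_factor s * zetaD s\<close> for \<open>Re s > 1\<close>; the identity theorem
  spreads the equation over the right half-plane without 1.\<close>

theorem zeta_functional_equation:
  assumes "Re s > 0" "s \<noteq> 1"
  shows "zeta (1 - s) = fe_factor s * zeta s"
proof (rule analytic_continuation_open[where f = "\<lambda>s. zeta (1 - s)" and g = "\<lambda>s. fe_factor s * zeta s" and s = "{s. Re s > 1}" and s' = "{s. Re s > 0} - {1}"])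
  show "{s. Re s > 1} \<noteq> {}" by (auto intro: exI[of _ 2])
  fix z assume "z \<in> {s. Re s > 1}"
  thus "zeta (1 - z) = fe_factor z * zeta z"
    by (subst zeta_eq_zeta_cont[of 1]) (auto simp: zeta_cont_eq_if_Re_gt_1 zeta_eq_zetaD)
qed (use assms in \<open>auto simp: open_halfspace_Re_gt
       intro!: connected_halfplane_minus_finite open_halfplane_minus_finite holomorphic_intros holomorphic_fe_factor\<close>)

text \<open>Continuation of \<open>gauss_sum_poisson\<close>, whose left side is entire. The
  excluded points are poles of single terms: 0 for \<open>zeta (1 - s)\<close> and
  \<open>Gamma (s / 2)\<close>, -1 for \<open>zeta (s + 2)\<close>. The next poles lie at -2, which
  fixes the half-plane.\<close>

theorem gauss_sum_expansion:
  assumes c: "c > 0" and s: "Re s > -2" "s \<noteq> -1" "s \<noteq> 0"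
  shows "gauss_sum s c = zeta (1 - s) + 1 / 2 * Gamma (s / 2) * of_real c powr (- s / 2)
     - fe_factor (s + 2) * zeta (s + 2) * of_real c + rem_sum s c"
proof (rule analytic_continuation_open[where f = "\<lambda>s. gauss_sum s c" and s = "{s. Re s > 1}" and s' = "{s. Re s > -2} - {-1, 0}"
     and g = "\<lambda>s. zeta (1 - s) + 1 / 2 * Gamma (s / 2) * of_real c powr (- s / 2) - fe_factor (s + 2) * zeta (s + 2) * of_real c + rem_sum s c"])
  show "{s. Re s > 1} \<noteq> {}" by (auto intro: exI[of _ 2])
  fix z assume "z \<in> {s. Re s > 1}"
  thus "gauss_sum z c = zeta (1 - z) + 1 / 2 * Gamma (z / 2) * of_real c powr (- z / 2) - fe_factor (z + 2) * zeta (z + 2) * of_real c + rem_sum z c"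
    using c by (subst zeta_eq_zeta_cont[of c]) (auto simp: zeta_cont_def zeta_eq_zetaD)
next
  have nonpos: "z / 2 \<notin> \<int>\<^sub>\<le>\<^sub>0" if "Re z > -2" "z \<noteq> 0" for z :: complex
    using that by (intro not_nonpos_Int_if_Re_gt) auto
  have "(\<lambda>s. gauss_sum s c) holomorphic_on {s. Re s > -2} - {-1, 0}" "(\<lambda>s. rem_sum s c) holomorphic_on {s. Re s > -2} - {-1, 0}"
    by (rule holomorphic_on_subset[OF holomorphic_gauss_sum[OF c]] holomorphic_on_subset[OF holomorphic_rem_sum[OF c]]; auto)+
  moreover have "(\<lambda>s. fe_factor (s + 2)) holomorphic_on {s. Re s > -2} - {-1, 0}"
    by (rule holomorphic_fe_factor) (auto intro!: holomorphic_intros)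
  moreover have "z + 2 \<noteq> 1" if "z \<noteq> -1" for z :: complex
  proof
    assume "z + 2 = 1"
    hence "z = 1 - 2" by (simp only: eq_diff_eq)
    thus False using that by simp
  qed
  ultimately show "(\<lambda>s. gauss_sum s c) holomorphic_on {s. Re s > -2} - {-1, 0}"
     "(\<lambda>s. zeta (1 - s) + 1 / 2 * Gamma (s / 2) * of_real c powr (- s / 2) - fe_factor (s + 2) * zeta (s + 2) * of_real c + rem_sum s c) holomorphic_on {s. Re s > -2} - {-1, 0}"
    using c by (auto intro!: holomorphic_intros dest: nonpos)
qed (use s in \<open>auto simp: open_halfspace_Re_gt intro!: connected_halfplane_minus_finite open_halfplane_minus_finite\<close>)

section \<open>Poisson summation for an inverse exponential\<close>

lemma infsum_eq_suminf_nat: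
  fixes f :: "nat \<Rightarrow> 'a::{banach}"
  assumes "f summable_on UNIV"
  shows "(\<Sum>\<^sub>\<infinity>k. f k) = (\<Sum>k. f k)"
  using has_sum_imp_sums[OF has_sum_infsum[OF assms]] by (rule sums_unique)

lemma tendsto_infsum_dominated:
  fixes a :: "nat \<Rightarrow> 'b \<Rightarrow> complex"
  assumes lim: "\<And>k. ((\<lambda>c. a k c) \<longlongrightarrow> b k) F"
    and bd: "\<forall>\<^sub>F c in F. \<forall>k. norm (a k c) \<le> M k"
    and M: "M summable_on UNIV" and F: "F \<noteq> bot"
  shows "((\<lambda>c. \<Sum>\<^sub>\<infinity>k. a k c) \<longlongrightarrow> (\<Sum>\<^sub>\<infinity>k. b k)) F"
proof -
  have "\<forall>\<^sub>F (k, c) in at_top \<times>\<^sub>F F. norm (a k c) \<le> M k"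
    using bd by (subst eventually_prod_filter, intro exI[of _ "\<lambda>_. True"] exI[of _ "\<lambda>c. \<forall>k. norm (a k c) \<le> M k"]) auto
  hence "((\<lambda>c. \<Sum>k. a k c) \<longlongrightarrow> (\<Sum>k. b k)) F"
    by (intro tannerys_theorem[THEN conjunct2, THEN conjunct2, OF lim _ summable_on_imp_summable[OF M] F]) auto
  moreover have "\<forall>\<^sub>F c in F. (\<Sum>k. a k c) = (\<Sum>\<^sub>\<infinity>k. a k c)"
    using bd
  proof eventually_elim
    case (elim c)
    thus ?case using abs_summable_on_norm_bound(2)[OF M, of "\<lambda>k. a k c"] by (simp add: infsum_eq_suminf_nat)
  qed
  moreover have "(\<Sum>k. b k) = (\<Sum>\<^sub>\<infinity>k. b k)"
  proof -
    have "norm (b k) \<le> M k" for k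
    proof (rule tendsto_upperbound[OF tendsto_norm[OF lim] _ F])
      show "\<forall>\<^sub>F c in F. norm (a k c) \<le> M k" using bd by eventually_elim auto
    qed
    thus ?thesis using abs_summable_on_norm_bound(2)[OF M, of b] by (simp add: infsum_eq_suminf_nat)
  qed
  ultimately show ?thesis by (simp add: tendsto_cong)
qed

lemma powr_minus_half:
  assumes "x > (0::real)"
  shows "x powr (- (1 / 2)) = 1 / sqrt x"
proof -
  have "x powr (1 / 2) = sqrt x" using assms by (intro powr_half_sqrt) simp
  thus ?thesis by (simp only: powr_minus inverse_eq_divide)
qed

lemma of_real_powr_minus_half:
  assumes "x > 0"
  shows "complex_of_real x powr (1 / 2 - 1) = of_real (1 / sqrt x)"
proof -
  have "complex_of_real x powr of_real (- (1 / 2)) = of_real (x powr (- (1 / 2)))"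
    using assms by (subst powr_of_real) auto
  thus ?thesis unfolding powr_minus_half[OF assms] by simp
qed

lemma npow_minus_half: "npow k (1 / 2 - 1) = of_real (1 / sqrt (real (Suc k)))"
  unfolding npow_def by (rule of_real_powr_minus_half) simp

lemma set_integrable_inverse_sqrt_exp:
  assumes "b > 0"
  shows "set_integrable lborel {0<..} (\<lambda>x. exp (- b * x) / sqrt x)"
proof -
  have "set_integrable lborel {0<..} (\<lambda>x. exp (- b * x) / sqrt x) = set_integrable lborel {0<..} (\<lambda>t::real. t powr (1 / 2 - 1) * exp (- b * t))"
    by (rule set_integrable_cong) (auto simp: powr_minus_half)
  thus ?thesis using set_integrable_powr_exp[of "1 / 2" b] assms by simp
qed

text \<open>Serves as the majorant for the comparison of regularizations: integrable at 0 and at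
  infinity alike.\<close>

lemma set_integrable_inverse_sqrt_1_plus:
  "set_integrable lborel {0<..} (\<lambda>x::real. 1 / (sqrt x * (1 + x)))"
proof -
  have "set_integrable lborel (einterval 0 \<infinity>) (\<lambda>x::real. 1 / (sqrt x * (1 + x)))"
  proof (rule interval_integral_FTC_nonneg(1)[where F = "\<lambda>x. 2 * arctan (sqrt x)" and A = 0 and B = pi])
    fix x :: real assume "0 < ereal x"
    hence x: "x > 0" by simp
    have "2 * (inverse u * (inverse v / 2)) = 1 / (v * u)" if "u > 0" "v > 0" for u v :: real
      using that by (simp add: field_simps)
    from this[of "1 + x" "sqrt x"] have eq: "2 * (inverse (1 + (sqrt x)\<^sup>2) * (inverse (sqrt x) / 2)) = 1 / (sqrt x * (1 + x))"
      using x by simp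
    have "((\<lambda>x. 2 * arctan (sqrt x)) has_real_derivative 2 * (inverse (1 + (sqrt x)\<^sup>2) * (inverse (sqrt x) / 2))) (at x)"
      using x by (auto intro!: derivative_eq_intros)
    thus "((\<lambda>x. 2 * arctan (sqrt x)) has_real_derivative 1 / (sqrt x * (1 + x))) (at x)"
      unfolding eq .
    show "isCont (\<lambda>x. 1 / (sqrt x * (1 + x))) x" using x by (intro continuous_intros) auto
  next
    have "((\<lambda>x. 2 * arctan (sqrt x)) \<longlongrightarrow> 2 * arctan (sqrt 0)) (at_right 0)" by (intro tendsto_intros)
    thus "(((\<lambda>x. 2 * arctan (sqrt x)) \<circ> real_of_ereal) \<longlongrightarrow> 0) (at_right 0)"
      unfolding zero_ereal_def ereal_tendsto_simps by simp
    have "((\<lambda>x. 2 * arctan (sqrt x)) \<longlongrightarrow> pi) at_top" by real_asymp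
    thus "(((\<lambda>x. 2 * arctan (sqrt x)) \<circ> real_of_ereal) \<longlongrightarrow> pi) (at_left \<infinity>)"
      unfolding ereal_tendsto_simps .
  qed auto
  thus ?thesis by (simp add: zero_ereal_def)
qed

lemma x_exp_minus_le_1: "x * exp (- x) \<le> (1::real)"
proof -
  have "x \<le> exp x" using exp_ge_add_one_self[of x] by linarith
  thus ?thesis by (simp add: exp_minus field_simps)
qed

lemma abs_exp_minus_diff_le:
  assumes "a \<ge> 0" "b \<ge> (0::real)"
  shows "\<bar>exp (- a) - exp (- b)\<bar> \<le> \<bar>a - b\<bar>"
proof -
  have *: "\<bar>exp (- a) - exp (- b)\<bar> \<le> \<bar>a - b\<bar>" if "0 \<le> a" "a \<le> b" for a b :: real
  proof -
    have "exp (- a) - exp (- b) = exp (- a) * (1 - exp (- (b - a)))" by (simp add: right_diff_distrib mult_exp_exp)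
    also have "1 - exp (- (b - a)) \<le> b - a" using exp_ge_add_one_self[of "- (b - a)"] by linarith
    hence "exp (- a) * (1 - exp (- (b - a))) \<le> 1 * (b - a)" using that by (intro mult_mono) auto
    finally show ?thesis using that by simp
  qed
  show ?thesis using *[of a b] *[of b a] assms by (cases "a \<le> b") (auto simp: abs_minus_commute)
qed

section \<open>The value zeta (1 / 2) as an exponentially regularized sum\<close>

definition exp_sum :: "real \<Rightarrow> complex" where
  "exp_sum c = (\<Sum>\<^sub>\<infinity>k. of_real (exp (- c * real (Suc k)) / sqrt (real (Suc k))))"

lemma exp_decay_bound:
  assumes "c > 0"
  shows "\<exists>C. \<forall>k. exp (- c * real (Suc k)) / sqrt (real (Suc k)) \<le> C * real (Suc k) powr -2"
proof -
  have "((\<lambda>k. exp (- c * real (Suc k)) / sqrt (real (Suc k)) * real (Suc k) powr 2) \<longlongrightarrow> 0) at_top"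
    using assms by real_asymp
  hence "Bseq (\<lambda>k. exp (- c * real (Suc k)) / sqrt (real (Suc k)) * real (Suc k) powr 2)"
    by (intro convergent_imp_Bseq) (auto simp: convergent_def)
  then obtain C where C: "\<And>k. norm (exp (- c * real (Suc k)) / sqrt (real (Suc k)) * real (Suc k) powr 2) \<le> C"
    unfolding Bseq_def by blast
  have "exp (- c * real (Suc k)) / sqrt (real (Suc k)) \<le> C * real (Suc k) powr -2" for k
    using C[of k] by (simp add: powr_minus field_simps)
  thus ?thesis by blast
qed

lemma summable_on_exp_sum:
  assumes "c > 0"
  shows "(\<lambda>k. complex_of_real (exp (- c * real (Suc k)) / sqrt (real (Suc k)))) summable_on UNIV"
proof -
  obtain C where "\<And>k. exp (- c * real (Suc k)) / sqrt (real (Suc k)) \<le> C * real (Suc k) powr -2"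
    using exp_decay_bound[OF assms] by blast
  hence bd: "norm (complex_of_real (exp (- c * real (Suc k)) / sqrt (real (Suc k)))) \<le> C * real (Suc k) powr -2" for k
    unfolding norm_of_real by simp
  have "(\<lambda>k. C * real (Suc k) powr -2) summable_on UNIV"
    by (intro summable_on_cmult_right summable_on_Suc_powr) simp
  thus ?thesis by (rule abs_summable_on_norm_bound(2)[OF _ bd])
qed

text \<open>
  The Gaussian regularization of \<open>zeta (1 / 2)\<close> is known from \<open>gauss_sum_expansion\<close>; the exponential one is
  compared with it by applying \<open>integral_sawtooth\<close> to the difference.
\<close>

definition exp_gauss_diff :: "real \<Rightarrow> real \<Rightarrow> real" where
  "exp_gauss_diff c x = (exp (- c * x) - exp (- c * x\<^sup>2)) / sqrt x"

definition exp_gauss_diff' :: "real \<Rightarrow> real \<Rightarrow> real" where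
  "exp_gauss_diff' c x = (- c * exp (- c * x) + 2 * c * x * exp (- c * x\<^sup>2)) / sqrt x
     - (exp (- c * x) - exp (- c * x\<^sup>2)) / (2 * x * sqrt x)"

text \<open>A majorant uniform in \<open>c \<le> 1\<close>. Near 0 the cancellation between the two
  exponentials counts (\<open>d \<le> x\<close>), near infinity the inequality
  \<open>y * exp (- y) \<le> 1\<close>.\<close>

lemma exp_gauss_diff'_bound:
  assumes c: "0 < c" "c \<le> 1" and x: "x > 0"
  shows "\<bar>exp_gauss_diff' c x\<bar> \<le> 7 * (1 / (sqrt x * (1 + x)))"
proof -
  define d where "d = \<bar>exp (- (c * x)) - exp (- (c * x\<^sup>2))\<bar>"
  have d1: "d \<le> 1"
  proof -
    have "exp (- (c * x)) \<le> 1" "exp (- (c * x\<^sup>2)) \<le> 1" "exp (- (c * x)) \<ge> 0" "exp (- (c * x\<^sup>2)) \<ge> 0"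
      using c x by auto
    thus ?thesis unfolding d_def by linarith
  qed
  have d2: "d \<le> x"
  proof (cases "x \<le> 1")
    case True
    have "d \<le> \<bar>c * x - c * x\<^sup>2\<bar>" unfolding d_def using c x by (intro abs_exp_minus_diff_le) auto
    also have "c * x - c * x\<^sup>2 = (c * (1 - x)) * x" by (simp add: algebra_simps power2_eq_square)
    also have "\<bar>\<dots>\<bar> = (c * (1 - x)) * x" using True c x by (intro abs_of_nonneg) auto
    also have "\<dots> \<le> 1 * x" using True c x by (intro mult_right_mono mult_le_one) auto
    finally show ?thesis by simp
  next
    case False
    thus ?thesis using d1 by simp
  qed
  define p where "p = c * exp (- (c * x))"
  define q where "q = c * x * exp (- (c * x\<^sup>2))"
  have p: "0 \<le> p" "p \<le> 1" "p * x \<le> 1"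
  proof -
    show "0 \<le> p" using c by (simp add: p_def)
    show "p \<le> 1" unfolding p_def using c x by (intro mult_le_one) auto
    show "p * x \<le> 1" unfolding p_def using x_exp_minus_le_1[of "c * x"] c x by (simp add: mult_ac)
  qed
  have qx: "q * x \<le> 1" unfolding q_def using x_exp_minus_le_1[of "c * x\<^sup>2"] c by (simp add: mult_ac power2_eq_square)
  have q0: "0 \<le> q" using c x by (simp add: q_def)
  have q1: "q \<le> 1"
  proof (cases "x \<le> 1")
    case True
    thus ?thesis unfolding q_def using c x by (intro mult_le_one) auto
  next
    case False
    hence "q * 1 \<le> q * x" using q0 by (intro mult_left_mono) auto
    thus ?thesis using qx by simp
  qed
  have "\<bar>exp_gauss_diff' c x\<bar> * sqrt x = \<bar>- p + 2 * q - (exp (- (c * x)) - exp (- (c * x\<^sup>2))) / (2 * x)\<bar>"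
  proof -
    have "exp_gauss_diff' c x * sqrt x = - p + 2 * q - (exp (- (c * x)) - exp (- (c * x\<^sup>2))) / (2 * x)"
    proof -
      have "(M / r - N / (2 * x * r)) * r = M - N / (2 * x)" if "r > 0" for M N r :: real
        using that x by (simp add: field_simps)
      from this[of "sqrt x"] show ?thesis using x by (simp add: exp_gauss_diff'_def p_def q_def)
    qed
    thus ?thesis using x by (metis abs_mult abs_of_pos real_sqrt_gt_zero)
  qed
  also have "\<dots> \<le> p + 2 * q + d / (2 * x)"
  proof -
    have "\<bar>(exp (- (c * x)) - exp (- (c * x\<^sup>2))) / (2 * x)\<bar> = d / (2 * x)" using x by (simp add: d_def abs_divide)
    thus ?thesis using p q0 by linarith
  qed
  finally have *: "\<bar>exp_gauss_diff' c x\<bar> * sqrt x \<le> p + 2 * q + d / (2 * x)" .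
  have "\<bar>exp_gauss_diff' c x\<bar> * sqrt x * (1 + x) \<le> (p + 2 * q + d / (2 * x)) * (1 + x)"
    using * x by (intro mult_right_mono) auto
  also have "\<dots> = p + p * x + 2 * q + 2 * (q * x) + d / x / 2 + d / 2"
    using x by (simp add: field_simps)
  \<comment> \<open>The six summands are at most 1, 1, 2, 2, 1/2 and 1/2.\<close>
  also have "\<dots> \<le> 7"
  proof -
    define e where "e = d / x"
    have "e \<le> 1" using d2 x by (simp add: e_def)
    thus ?thesis using p q1 qx d1 unfolding e_def [symmetric] by linarith
  qed
  finally have "\<bar>exp_gauss_diff' c x\<bar> * (sqrt x * (1 + x)) \<le> 7" by (simp only: mult.assoc)
  moreover have "0 < sqrt x * (1 + x)" using x by simp
  ultimately show ?thesis by (simp add: pos_le_divide_eq)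
qed

text \<open>Each regularization alone behaves like \<open>1 / sqrt x\<close> at 0 and violates the
  boundary condition of \<open>integral_sawtooth\<close>; their difference tends to 0 there.\<close>

lemma exp_gauss_diff_sawtooth:
  assumes c: "0 < c" "c \<le> 1"
  shows "exp_sum c - of_real (sqrt (pi / c)) = gauss_sum (1 / 2) c - 1 / 2 * Gamma (1 / 4) * of_real c powr (- 1 / 4)
     + (LBINT x:{0<..}. of_real (exp_gauss_diff' c x) * of_real (frac x - 1 / 2))"
proof -
  let ?h = "\<lambda>x. complex_of_real (exp_gauss_diff c x)" and ?h' = "\<lambda>x. complex_of_real (exp_gauss_diff' c x)"
  have half: "?h x = of_real x powr (1 / 2 - 1) * exp (- of_real c * of_real x) - of_real x powr (1 / 2 - 1) * exp (- of_real c * of_real x ^ 2)"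
    if "x > 0" for x
    unfolding of_real_powr_minus_half[OF that]
    by (simp add: exp_gauss_diff_def exp_of_real [symmetric] diff_divide_distrib)
  have int1: "set_integrable lborel {0<..} (\<lambda>x. of_real x powr (1 / 2 - 1) * exp (- of_real c * complex_of_real x))"
    using c by (intro set_integrable_cpowr_exp) auto
  have int2: "set_integrable lborel {0<..} (\<lambda>x. of_real x powr (1 / 2 - 1) * exp (- of_real c * complex_of_real x ^ 2))"
    using set_integrable_cpowr_gauss[of "1 / 2" "of_real c" 0] c by simp
  have "(\<lambda>k. ?h (real (Suc k))) sums ((LBINT x:{0<..}. ?h x) + (LBINT x:{0<..}. ?h' x * of_real (frac x - 1 / 2)))"
  proof (rule integral_sawtooth)
    fix x :: real assume x: "x > 0"
    have "(exp_gauss_diff c has_real_derivative exp_gauss_diff' c x) (at x)"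
    proof -
      have "((\<lambda>x. exp (- c * x) - exp (- c * x\<^sup>2)) has_real_derivative - c * exp (- c * x) + 2 * c * x * exp (- c * x\<^sup>2)) (at x)"
        by (auto intro!: derivative_eq_intros)
      moreover have "(sqrt has_real_derivative inverse (sqrt x) / 2) (at x)" using x by (rule DERIV_real_sqrt)
      moreover have "(M * r - N * (inverse r / 2)) / (r * r) = M / r - N / (2 * r\<^sup>2 * r)" if "r > 0" for M N r :: real
        using that by (simp add: field_simps power2_eq_square)
      from this[of "sqrt x"] have "(M * sqrt x - N * (inverse (sqrt x) / 2)) / (sqrt x * sqrt x) = M / sqrt x - N / (2 * x * sqrt x)" for M N
        using x by simp
      ultimately show ?thesis unfolding exp_gauss_diff_def [abs_def] exp_gauss_diff'_def
        using DERIV_divide[of _ _ x UNIV sqrt "inverse (sqrt x) / 2"] x by fastforce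
    qed
    thus "(?h has_vector_derivative ?h' x) (at x)"
      by (intro has_vector_derivative_of_real) (simp add: has_real_derivative_iff_has_vector_derivative)
  next
    show cont: "continuous_on {0<..} ?h'" unfolding exp_gauss_diff'_def by (intro continuous_intros) auto
    show "set_integrable lborel {0<..} ?h"
    proof -
      have "set_integrable lborel {0<..} ?h = set_integrable lborel {0<..} (\<lambda>x. of_real x powr (1 / 2 - 1) * exp (- of_real c * complex_of_real x)
          - of_real x powr (1 / 2 - 1) * exp (- of_real c * of_real x ^ 2))"
        by (rule set_integrable_cong) (use half in auto)
      thus ?thesis using set_integral_diff(1)[OF int1 int2] by (simp only:)
    qed
    show "set_integrable lborel {0<..} ?h'"
      by (rule set_integrable_pos_bound[OF cont set_integrable_mult_right[OF set_integrable_inverse_sqrt_1_plus, of 7]])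
         (use exp_gauss_diff'_bound[OF c] in auto)
    show "(?h \<longlongrightarrow> 0) (at_right 0)"
    proof -
      have "(exp_gauss_diff c \<longlongrightarrow> 0) (at_right 0)"
        unfolding exp_gauss_diff_def [abs_def] using c by real_asymp
      from tendsto_of_real[OF this] show ?thesis by simp
    qed
    show "(?h \<longlongrightarrow> 0) at_top"
    proof -
      have "(exp_gauss_diff c \<longlongrightarrow> 0) at_top"
        unfolding exp_gauss_diff_def [abs_def] using c by real_asymp
      from tendsto_of_real[OF this] show ?thesis by simp
    qed
  qed
  moreover have "(\<lambda>k. ?h (real (Suc k))) sums (exp_sum c - gauss_sum (1 / 2) c)"
  proof -
    have "(\<lambda>k. of_real (exp (- c * real (Suc k)) / sqrt (real (Suc k))) - npow k (1 / 2 - 1) * of_real (exp (- c * real (Suc k) ^ 2))) sums (exp_sum c - gauss_sum (1 / 2) c)"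
      unfolding exp_sum_def gauss_sum_def using c
      by (intro sums_diff has_sum_imp_sums has_sum_infsum summable_on_gauss_sum summable_on_exp_sum)
    thus ?thesis unfolding npow_minus_half by (simp add: exp_gauss_diff_def diff_divide_distrib)
  qed
  moreover have "(LBINT x:{0<..}. ?h x) = of_real (sqrt (pi / c)) - 1 / 2 * Gamma (1 / 4) * of_real c powr (- 1 / 4)"
  proof -
    have "(LBINT x:{0<..}. ?h x) = (LBINT x:{0<..}. of_real x powr (1 / 2 - 1) * exp (- of_real c * of_real x) - of_real x powr (1 / 2 - 1) * exp (- of_real c * of_real x ^ 2))"
      by (rule set_lebesgue_integral_cong) (use half in auto)
    also have "\<dots> = Gamma (1 / 2) * of_real c powr (- (1 / 2)) - 1 / 2 * Gamma (1 / 2 / 2) * of_real c powr (- (1 / 2) / 2)"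
      using c by (subst set_integral_diff(2)[OF int1 int2], subst Gamma_set_integral_scaled, simp, simp, subst Gamma_set_integral_gauss) auto
    also have "Gamma (1 / 2) * complex_of_real c powr (- (1 / 2)) = of_real (sqrt (pi / c))"
      using c of_real_powr_minus_half[of c] by (simp add: Gamma_one_half_complex real_sqrt_divide)
    finally show ?thesis by simp
  qed
  ultimately have "exp_sum c - gauss_sum (1 / 2) c = of_real (sqrt (pi / c)) - 1 / 2 * Gamma (1 / 4) * of_real c powr (- 1 / 4)
     + (LBINT x:{0<..}. ?h' x * of_real (frac x - 1 / 2))"
    by (elim sums_unique2[of _ "exp_sum c - gauss_sum (1 / 2) c"]) (simp only:)
  thus ?thesis by (simp add: algebra_simps)
qed

text \<open>The sawtooth integral tends to 0 by domination, since \<open>exp_gauss_diff'\<close>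
  vanishes at \<open>c = 0\<close>. What remains is the Gaussian expansion at
  \<open>s = 1 / 2\<close>, whose constant term is \<open>zeta (1 - s)\<close>.\<close>

theorem zeta_half_limit:
  "((\<lambda>c. exp_sum c - of_real (sqrt (pi / c))) \<longlongrightarrow> zeta (1 / 2)) (at_right 0)"
proof -
  have ev: "\<forall>\<^sub>F c in at_right (0::real). c \<in> {0<..<1}"
    by (rule eventually_at_right_real) simp
  have "((\<lambda>c. LBINT x:{0<..}. complex_of_real (exp_gauss_diff' c x) * of_real (frac x - 1 / 2)) \<longlongrightarrow> (LBINT x:{0::real<..}. 0)) (at_right 0)"
    unfolding set_lebesgue_integral_def
  proof (rule tendsto_integral_dominated_within[where w = "\<lambda>x. indicator {0<..} x *\<^sub>R (7 * (1 / (sqrt x * (1 + x))))"])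
    show "integrable lborel (\<lambda>x. indicat_real {0<..} x *\<^sub>R (7 * (1 / (sqrt x * (1 + x)))))"
      using set_integrable_mult_right[OF set_integrable_inverse_sqrt_1_plus, of 7] by (simp add: set_integrable_def)
    show "\<forall>\<^sub>F c in at_right 0. (\<lambda>x. indicat_real {0<..} x *\<^sub>R (complex_of_real (exp_gauss_diff' c x) * of_real (frac x - 1 / 2))) \<in> borel_measurable lborel \<and>
       (AE x in lborel. norm (indicat_real {0<..} x *\<^sub>R (complex_of_real (exp_gauss_diff' c x) * of_real (frac x - 1 / 2))) \<le> indicator {0<..} x *\<^sub>R (7 * (1 / (sqrt x * (1 + x)))))"
      using ev
    proof eventually_elim
      case (elim c)
      have "norm (complex_of_real (exp_gauss_diff' c x) * of_real (frac x - 1 / 2)) \<le> 7 * (1 / (sqrt x * (1 + x)))" if "x > 0" for x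
      proof -
        have "\<bar>exp_gauss_diff' c x\<bar> \<le> 7 * (1 / (sqrt x * (1 + x)))" using elim that by (intro exp_gauss_diff'_bound) auto
        moreover have "\<bar>frac x - 1 / 2\<bar> \<le> 1" using frac_ge_0[of x] frac_lt_1[of x] by linarith
        ultimately have "\<bar>exp_gauss_diff' c x\<bar> * \<bar>frac x - 1 / 2\<bar> \<le> 7 * (1 / (sqrt x * (1 + x))) * 1"
          using that by (intro mult_mono) auto
        thus ?thesis unfolding norm_mult norm_of_real by simp
      qed
      moreover have "(\<lambda>x. indicat_real {0<..} x *\<^sub>R (complex_of_real (exp_gauss_diff' c x) * of_real (frac x - 1 / 2))) \<in> borel_measurable borel"
        unfolding exp_gauss_diff'_def frac_def by measurable
      ultimately show ?case by (auto simp: indicator_def intro!: AE_I2)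
    qed
    show "AE x in lborel. ((\<lambda>c. indicat_real {0<..} x *\<^sub>R (complex_of_real (exp_gauss_diff' c x) * of_real (frac x - 1 / 2))) \<longlongrightarrow> indicat_real {0<..} x *\<^sub>R 0) (at_right 0)"
    proof (rule AE_I2)
      fix x :: real
      have "((\<lambda>c. exp_gauss_diff' c x) \<longlongrightarrow> exp_gauss_diff' 0 x) (at_right 0)"
        unfolding exp_gauss_diff'_def divide_inverse by (intro tendsto_intros)
      hence "((\<lambda>c. exp_gauss_diff' c x) \<longlongrightarrow> 0) (at_right 0)" by (simp add: exp_gauss_diff'_def)
      hence "((\<lambda>c. indicat_real {0<..} x *\<^sub>R (complex_of_real (exp_gauss_diff' c x) * of_real (frac x - 1 / 2))) \<longlongrightarrow> indicat_real {0<..} x *\<^sub>R (of_real 0 * of_real (frac x - 1 / 2))) (at_right 0)"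
        by (intro tendsto_intros)
      thus "((\<lambda>c. indicat_real {0<..} x *\<^sub>R (complex_of_real (exp_gauss_diff' c x) * of_real (frac x - 1 / 2))) \<longlongrightarrow> indicat_real {0<..} x *\<^sub>R 0) (at_right 0)"
        by simp
    qed
  qed auto
  moreover have "((\<lambda>c. gauss_sum (1 / 2) c - 1 / 2 * Gamma (1 / 4) * of_real c powr (- 1 / 4)) \<longlongrightarrow> zeta (1 / 2)) (at_right 0)"
  proof -
    have "((\<lambda>c. zeta (1 / 2) - fe_factor (1 / 2 + 2) * zeta (1 / 2 + 2) * of_real c + rem_sum (1 / 2) c) \<longlongrightarrow> zeta (1 / 2) - fe_factor (1 / 2 + 2) * zeta (1 / 2 + 2) * of_real 0 + 0) (at_right 0)"
      by (intro tendsto_intros tendsto_rem_sum) auto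
    moreover have "\<forall>\<^sub>F c in at_right 0. gauss_sum (1 / 2) c - 1 / 2 * Gamma (1 / 4) * of_real c powr (- 1 / 4) =
        zeta (1 / 2) - fe_factor (1 / 2 + 2) * zeta (1 / 2 + 2) * of_real c + rem_sum (1 / 2) c"
      using eventually_at_right_less[of "0::real"]
    proof eventually_elim
      case (elim c)
      have "1 / 2 \<noteq> (- 1 :: complex)" by (simp add: complex_eq_iff)
      thus ?case using gauss_sum_expansion[of c "1 / 2"] elim by simp
    qed
    ultimately show ?thesis by (simp add: tendsto_cong)
  qed
  ultimately have "((\<lambda>c. gauss_sum (1 / 2) c - 1 / 2 * Gamma (1 / 4) * of_real c powr (- 1 / 4) + (LBINT x:{0<..}. complex_of_real (exp_gauss_diff' c x) * of_real (frac x - 1 / 2))) \<longlongrightarrow> zeta (1 / 2) + 0) (at_right 0)"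
    by (intro tendsto_add) (simp_all add: set_lebesgue_integral_def)
  moreover have "\<forall>\<^sub>F c in at_right 0. exp_sum c - of_real (sqrt (pi / c)) = gauss_sum (1 / 2) c - 1 / 2 * Gamma (1 / 4) * of_real c powr (- 1 / 4) + (LBINT x:{0<..}. complex_of_real (exp_gauss_diff' c x) * of_real (frac x - 1 / 2))"
    using ev by eventually_elim (use exp_gauss_diff_sawtooth in auto)
  ultimately show ?thesis by (simp add: tendsto_cong)
qed

section \<open>The Laplace transform of exp (- A / x) / sqrt x\<close>

definition gauss_primitive :: "real \<Rightarrow> real" where
  "gauss_primitive y = (LBINT t=0..ereal y. exp (- (t\<^sup>2)))"

lemma has_real_derivative_gauss_primitive:
  "(gauss_primitive has_real_derivative exp (- (y\<^sup>2))) (at y)"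
proof -
  \<comment> \<open>The interval contains both 0 and \<open>y\<close> in its interior, so the
    derivative within it is the full derivative for either sign of \<open>y\<close>.\<close>
  let ?b = "\<bar>y\<bar> + 1"
  have "((\<lambda>u. LBINT t=ereal 0..ereal u. exp (- (t\<^sup>2))) has_vector_derivative exp (- (y\<^sup>2))) (at y within {-?b..?b})"
    by (rule interval_integral_FTC2) (auto intro!: continuous_intros)
  moreover have "at y within {-?b..?b} = at y"
    by (rule at_within_interior) auto
  ultimately show ?thesis
    by (simp add: gauss_primitive_def [abs_def] has_real_derivative_iff_has_vector_derivative zero_ereal_def)
qed

lemma gauss_primitive_minus: "gauss_primitive (- y) = - gauss_primitive y"
proof -
  have "gauss_primitive (- y) = (LBINT t=ereal (- (- y))..ereal (- 0). exp (- ((- t)\<^sup>2)))"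
    unfolding gauss_primitive_def zero_ereal_def by (subst interval_integral_reflect) simp
  also have "\<dots> = - gauss_primitive y"
    unfolding gauss_primitive_def zero_ereal_def
    using interval_integral_endpoints_reverse[of "ereal y" "ereal 0" "\<lambda>t. exp (- (t\<^sup>2))"] by simp
  finally show ?thesis .
qed

text \<open>\<open>gauss_primitive\<close> is \<open>sqrt pi / 2\<close> times the error function.
  Along the integers the limit is the Gamma integral at \<open>1 / 2\<close>, and monotonicity fills
  the gaps.\<close>

lemma tendsto_gauss_primitive: "(gauss_primitive \<longlongrightarrow> sqrt pi / 2) at_top"
proof -
  have "set_integrable lborel {0<..} (\<lambda>t::real. t powr (1 - 1) * exp (0 * t - 1 * t\<^sup>2))"
    by (rule set_integrable_powr_exp_quadratic) auto
  also have "?this \<longleftrightarrow> set_integrable lborel {0<..} (\<lambda>t::real. exp (- (t\<^sup>2)))"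
    by (rule set_integrable_cong) auto
  finally have int: "set_integrable lborel {0<..} (\<lambda>t::real. exp (- (t\<^sup>2)))" .
  have "(\<lambda>N. LBINT t:{0<..<real N}. exp (- (t\<^sup>2))) \<longlonglongrightarrow> (LBINT t:(\<Union>N. {0<..<real N}). exp (- (t\<^sup>2)))"
  proof (rule set_integral_cont_up)
    show "set_integrable lborel (\<Union>N. {0<..<real N}) (\<lambda>t. exp (- (t\<^sup>2)))" by (rule set_integrable_subset[OF int]) auto
    show "incseq (\<lambda>N. {0<..<real N})" by (force simp: incseq_def)
  qed auto
  moreover have "(\<Union>N. {0<..<real N}) = {0<..}" using reals_Archimedean2 by fastforce
  moreover have "(LBINT t:{0<..<real N}. exp (- (t\<^sup>2))) = gauss_primitive (real N)" for N
    unfolding gauss_primitive_def zero_ereal_def by (simp add: interval_lebesgue_integral_le_eq)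
  moreover have "(LBINT t:{0<..}. exp (- (t\<^sup>2))) = sqrt pi / 2"
  proof -
    have "complex_of_real (LBINT t:{0<..}. exp (- (t\<^sup>2))) = (LBINT t:{0<..}. complex_of_real (exp (- (t\<^sup>2))))"
      by (rule set_integral_complex_of_real [symmetric])
    also have "\<dots> = (LBINT t:{0<..}. of_real t powr (1 - 1) * exp (- 1 * of_real t ^ 2))"
      by (rule set_lebesgue_integral_cong) (auto simp: exp_of_real [symmetric])
    also have "\<dots> = 1 / 2 * Gamma (1 / 2) * 1 powr (- 1 / 2)" by (rule Gamma_set_integral_gauss) auto
    also have "\<dots> = of_real (sqrt pi / 2)" by (simp add: Gamma_one_half_complex)
    finally show ?thesis by (simp only: of_real_eq_iff)
  qed
  ultimately have lim: "(\<lambda>N. gauss_primitive (real N)) \<longlonglongrightarrow> sqrt pi / 2" by simp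
  have mono: "gauss_primitive x \<le> gauss_primitive y" if "x \<le> y" for x y
    by (rule DERIV_nonneg_imp_nondecreasing[OF that]) (use has_real_derivative_gauss_primitive in \<open>auto intro!: exI\<close>)
  show ?thesis
  proof (rule tendsto_sandwich)
    have fl: "filterlim (\<lambda>x::real. nat \<lfloor>x\<rfloor>) sequentially at_top" "filterlim (\<lambda>x::real. nat \<lceil>x\<rceil>) sequentially at_top"
    proof -
      show fl: "filterlim (\<lambda>x::real. nat \<lfloor>x\<rfloor>) sequentially at_top"
        by (intro filterlim_compose[OF filterlim_nat_sequentially] filterlim_floor_sequentially)
      show "filterlim (\<lambda>x::real. nat \<lceil>x\<rceil>) sequentially at_top"
        by (rule filterlim_at_top_mono[OF fl]) (auto intro!: always_eventually nat_mono floor_le_ceiling)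
    qed
    show "((\<lambda>x::real. gauss_primitive (real (nat \<lfloor>x\<rfloor>))) \<longlongrightarrow> sqrt pi / 2) at_top"
      by (rule filterlim_compose[OF lim fl(1)])
    show "((\<lambda>x::real. gauss_primitive (real (nat \<lceil>x\<rceil>))) \<longlongrightarrow> sqrt pi / 2) at_top"
      by (rule filterlim_compose[OF lim fl(2)])
    show "\<forall>\<^sub>F x in at_top. gauss_primitive (real (nat \<lfloor>x\<rfloor>)) \<le> gauss_primitive x"
      using eventually_ge_at_top[of 0] by eventually_elim (auto intro!: mono)
    show "\<forall>\<^sub>F x in at_top. gauss_primitive x \<le> gauss_primitive (real (nat \<lceil>x\<rceil>))"
      using eventually_ge_at_top[of 0] by eventually_elim (auto intro!: mono)
  qed
qed

lemma laplace_inverse_exp_real: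
  assumes B: "B > 0" and q: "q > 0"
  shows "(LBINT x:{0<..}. exp (- (B\<^sup>2 / x) - q\<^sup>2 * x) / sqrt x) = sqrt pi / q * exp (- 2 * B * q)"
proof -
  let ?P = "gauss_primitive"
  \<comment> \<open>The squares of \<open>q * sqrt x + B / sqrt x\<close> and
    \<open>q * sqrt x - B / sqrt x\<close> differ from \<open>q\<^sup>2 * x + B\<^sup>2 / x\<close>
    by \<open>2 * B * q\<close> up to sign, which the outer exponentials undo; in the derivative the
    terms with \<open>B\<close> cancel. At 0 the two arguments tend to opposite infinities, so only
    \<open>exp (- 2 * B * q)\<close> survives.\<close>
  let ?F = "\<lambda>x. 1 / q * (exp (2 * B * q) * ?P (q * sqrt x + B / sqrt x) + exp (- 2 * B * q) * ?P (q * sqrt x - B / sqrt x))"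
  have bot: "(?P \<longlongrightarrow> - (sqrt pi / 2)) at_bot"
  proof -
    have "((\<lambda>y. - ?P y) \<longlongrightarrow> - (sqrt pi / 2)) at_top" by (intro tendsto_intros tendsto_gauss_primitive)
    thus ?thesis unfolding filterlim_at_bot_mirror gauss_primitive_minus .
  qed
  have "(LBINT x=0..\<infinity>. exp (- (B\<^sup>2 / x) - q\<^sup>2 * x) / sqrt x) =
     1 / q * (exp (2 * B * q) * (sqrt pi / 2) + exp (- 2 * B * q) * (sqrt pi / 2))
     - 1 / q * (exp (2 * B * q) * (sqrt pi / 2) + exp (- 2 * B * q) * (- (sqrt pi / 2)))"
  proof (rule interval_integral_FTC_nonneg(2)[where F = ?F])
    fix x :: real assume "0 < ereal x"
    hence x: "x > 0" by simp
    define r where "r = sqrt x"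
    have r: "r > 0" "r\<^sup>2 = x" "sqrt x = r" using x by (auto simp: r_def)
    have d1: "((\<lambda>x. q * sqrt x + B / sqrt x) has_real_derivative q / (2 * r) - B / (2 * r ^ 3)) (at x)"
      using x r by (auto intro!: derivative_eq_intros simp: field_simps power2_eq_square power3_eq_cube)
    have d2: "((\<lambda>x. q * sqrt x - B / sqrt x) has_real_derivative q / (2 * r) + B / (2 * r ^ 3)) (at x)"
      using x r by (auto intro!: derivative_eq_intros simp: field_simps power2_eq_square power3_eq_cube)
    have e1: "exp (2 * B * q) * exp (- ((q * r + B / r)\<^sup>2)) = exp (- (B\<^sup>2 / r\<^sup>2) - q\<^sup>2 * r\<^sup>2)"
      unfolding exp_add [symmetric] using r(1) by (intro arg_cong[where f = exp]) (simp add: field_simps power2_eq_square)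
    have e2: "exp (- 2 * B * q) * exp (- ((q * r - B / r)\<^sup>2)) = exp (- (B\<^sup>2 / r\<^sup>2) - q\<^sup>2 * r\<^sup>2)"
      unfolding exp_add [symmetric] using r(1) by (intro arg_cong[where f = exp]) (simp add: field_simps power2_eq_square)
    have "(?F has_real_derivative 1 / q * (exp (2 * B * q) * (exp (- ((q * sqrt x + B / sqrt x)\<^sup>2)) * (q / (2 * r) - B / (2 * r ^ 3)))
        + exp (- 2 * B * q) * (exp (- ((q * sqrt x - B / sqrt x)\<^sup>2)) * (q / (2 * r) + B / (2 * r ^ 3))))) (at x)"
      by (intro DERIV_cmult DERIV_add DERIV_chain2[OF has_real_derivative_gauss_primitive] d1 d2)
    also have "1 / q * (exp (2 * B * q) * (exp (- ((q * sqrt x + B / sqrt x)\<^sup>2)) * (q / (2 * r) - B / (2 * r ^ 3)))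
        + exp (- 2 * B * q) * (exp (- ((q * sqrt x - B / sqrt x)\<^sup>2)) * (q / (2 * r) + B / (2 * r ^ 3))))
        = 1 / q * (exp (- (B\<^sup>2 / r\<^sup>2) - q\<^sup>2 * r\<^sup>2) * (q / (2 * r) - B / (2 * r ^ 3)) + exp (- (B\<^sup>2 / r\<^sup>2) - q\<^sup>2 * r\<^sup>2) * (q / (2 * r) + B / (2 * r ^ 3)))"
      unfolding r(3) mult.assoc [symmetric] e1 e2 ..
    also have "\<dots> = exp (- (B\<^sup>2 / x) - q\<^sup>2 * x) / sqrt x"
      unfolding r using q r(1) by (simp add: field_simps)
    finally show "(?F has_real_derivative exp (- (B\<^sup>2 / x) - q\<^sup>2 * x) / sqrt x) (at x)" .
    show "isCont (\<lambda>x. exp (- (B\<^sup>2 / x) - q\<^sup>2 * x) / sqrt x) x" using x by (intro continuous_intros) auto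
  next
    have "filterlim (\<lambda>x. q * sqrt x + B / sqrt x) at_top at_top" "filterlim (\<lambda>x. q * sqrt x - B / sqrt x) at_top at_top"
      using B q by real_asymp+
    note top = this[THEN filterlim_compose[OF tendsto_gauss_primitive]]
    show "((?F \<circ> real_of_ereal) \<longlongrightarrow> 1 / q * (exp (2 * B * q) * (sqrt pi / 2) + exp (- 2 * B * q) * (sqrt pi / 2))) (at_left \<infinity>)"
      unfolding ereal_tendsto_simps by (intro tendsto_intros top)
    have "filterlim (\<lambda>x. q * sqrt x + B / sqrt x) at_top (at_right 0)" "filterlim (\<lambda>x. q * sqrt x - B / sqrt x) at_bot (at_right 0)"
      using B q by real_asymp+
    note zero = this(1)[THEN filterlim_compose[OF tendsto_gauss_primitive]] this(2)[THEN filterlim_compose[OF bot]]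
    show "((?F \<circ> real_of_ereal) \<longlongrightarrow> 1 / q * (exp (2 * B * q) * (sqrt pi / 2) + exp (- 2 * B * q) * (- (sqrt pi / 2)))) (at_right 0)"
      unfolding zero_ereal_def ereal_tendsto_simps by (intro tendsto_intros zero)
  qed auto
  also have "\<dots> = sqrt pi / q * exp (- 2 * B * q)"
    by (simp add: algebra_simps)
  finally show ?thesis unfolding interval_lebesgue_integral_0_infty .
qed

lemma set_integrable_laplace_inverse_exp:
  assumes "A > 0" "Re p > 0"
  shows "set_integrable lborel {0<..} (\<lambda>x. of_real (exp (- (A / x)) / sqrt x) * exp (- p * of_real x))"
proof (rule set_integrable_pos_bound[OF _ set_integrable_inverse_sqrt_exp[OF assms(2)]])
  show "continuous_on {0<..} (\<lambda>x. complex_of_real (exp (- (A / x)) / sqrt x) * exp (- p * of_real x))"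
    by (intro continuous_intros) auto
  fix x :: real assume x: "x > 0"
  have "norm (complex_of_real (exp (- (A / x)) / sqrt x) * exp (- p * of_real x)) = exp (- (A / x)) * (exp (- Re p * x) / sqrt x)"
    unfolding norm_mult norm_of_real using x by (simp add: norm_exp_eq_Re)
  also have "\<dots> \<le> 1 * (exp (- Re p * x) / sqrt x)" using x assms by (intro mult_right_mono) auto
  finally show "norm (complex_of_real (exp (- (A / x)) / sqrt x) * exp (- p * of_real x)) \<le> exp (- Re p * x) / sqrt x" by simp
qed

text \<open>The Laplace transform for \<open>Re p > 0\<close>. The closed form keeps its meaning on
  the imaginary axis away from 0, where the integral no longer converges absolutely; those are the
  values wanted in the end.\<close>

definition laplace_value :: "real \<Rightarrow> complex \<Rightarrow> complex" where
  "laplace_value A p = of_real (sqrt pi) / csqrt p * exp (- 2 * of_real (sqrt A) * csqrt p)"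

lemma laplace_inverse_exp:
  assumes A: "A > 0" and p: "Re p > 0"
  shows "(LBINT x:{0<..}. of_real (exp (- (A / x)) / sqrt x) * exp (- p * of_real x)) = laplace_value A p"
proof (rule holomorphic_eq_of_eq_on_pos_reals[where S = "{p. Re p > 0}" and z = p and g = "laplace_value A"
      and f = "\<lambda>p. LBINT x:{0<..}. of_real (exp (- (A / x)) / sqrt x) * exp (- p * of_real x)"])
  show "(\<lambda>p. LBINT x:{0<..}. of_real (exp (- (A / x)) / sqrt x) * exp (- p * of_real x)) holomorphic_on {p. Re p > 0}"
    unfolding set_lebesgue_integral_def
  proof (rule holomorphic_on_integral)
    show "(\<lambda>x. indicat_real {0<..} x *\<^sub>R (complex_of_real (exp (- (A / x)) / sqrt x) * exp (- p * of_real x))) \<in> borel_measurable lborel" for p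
    proof -
      have "(\<lambda>x. indicat_real {0<..} x *\<^sub>R (complex_of_real (exp (- (A / x)) / sqrt x) * exp (- p * of_real x))) \<in> borel_measurable borel"
        by (intro borel_measurable_continuous_on_indicator continuous_intros) auto
      thus ?thesis by simp
    qed
    fix a :: complex assume a: "a \<in> {p. Re p > 0}"
    define r where "r = Re a / 2"
    have r: "r > 0" using a by (simp add: r_def)
    show "\<exists>r>0. \<exists>w. cball a r \<subseteq> {p. Re p > 0} \<and> integrable lborel w \<and>
        (\<forall>z\<in>cball a r. \<forall>x\<in>space lborel. norm (indicat_real {0<..} x *\<^sub>R (complex_of_real (exp (- (A / x)) / sqrt x) * exp (- z * of_real x))) \<le> w x)"
    proof (intro exI[of _ r] exI[of _ "\<lambda>x. indicator {0<..} x *\<^sub>R (exp (- r * x) / sqrt x)"] conjI ballI r)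
      have Re_ge: "Re z \<ge> r" if "z \<in> cball a r" for z using Re_cball[OF that] by (simp add: r_def)
      show "cball a r \<subseteq> {p. Re p > 0}" using Re_ge r by force
      show "integrable lborel (\<lambda>x. indicat_real {0<..} x *\<^sub>R (exp (- r * x) / sqrt x))"
        using set_integrable_inverse_sqrt_exp[OF r] by (simp add: set_integrable_def)
      fix z x assume z: "z \<in> cball a r"
      have "norm (complex_of_real (exp (- (A / x)) / sqrt x) * exp (- z * of_real x)) \<le> exp (- r * x) / sqrt x" if x: "x > 0"
      proof -
        have "norm (complex_of_real (exp (- (A / x)) / sqrt x) * exp (- z * of_real x)) = exp (- (A / x)) * (exp (- Re z * x) / sqrt x)"
          unfolding norm_mult norm_of_real using x by (simp add: norm_exp_eq_Re)
        also have "\<dots> \<le> 1 * (exp (- r * x) / sqrt x)" using x A Re_ge[OF z] by (intro mult_mono divide_right_mono) auto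
        finally show ?thesis by simp
      qed
      thus "norm (indicat_real {0<..} x *\<^sub>R (complex_of_real (exp (- (A / x)) / sqrt x) * exp (- z * of_real x))) \<le> indicator {0<..} x *\<^sub>R (exp (- r * x) / sqrt x)"
        by (auto simp: indicator_def)
    qed
  qed (auto intro!: holomorphic_intros simp: open_halfspace_Re_gt)
  show "laplace_value A holomorphic_on {p. Re p > 0}"
  proof -
    show ?thesis unfolding laplace_value_def [abs_def]
      by (intro holomorphic_intros) (auto simp: complex_nonpos_Reals_iff)
  qed
next
  fix x :: real assume x: "x > 0"
  have "(LBINT t:{0<..}. of_real (exp (- (A / t)) / sqrt t) * exp (- of_real x * complex_of_real t))
     = (LBINT t:{0<..}. complex_of_real (exp (- ((sqrt A)\<^sup>2 / t) - (sqrt x)\<^sup>2 * t) / sqrt t))"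
  proof (rule set_lebesgue_integral_cong, simp, intro allI impI)
    fix t :: real assume "t \<in> {0<..}"
    have "exp (- of_real x * complex_of_real t) = of_real (exp (- x * t))" by (simp add: exp_of_real [symmetric])
    moreover have "exp (- ((sqrt A)\<^sup>2 / t) - (sqrt x)\<^sup>2 * t) / sqrt t = exp (- (A / t)) / sqrt t * exp (- x * t)"
      using A x by (simp add: exp_diff exp_minus divide_inverse)
    ultimately show "of_real (exp (- (A / t)) / sqrt t) * exp (- of_real x * complex_of_real t) = complex_of_real (exp (- ((sqrt A)\<^sup>2 / t) - (sqrt x)\<^sup>2 * t) / sqrt t)"
      by (simp only: of_real_mult)
  qed
  also have "\<dots> = of_real (LBINT t:{0<..}. exp (- ((sqrt A)\<^sup>2 / t) - (sqrt x)\<^sup>2 * t) / sqrt t)"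
    by (rule set_integral_complex_of_real)
  also have "\<dots> = laplace_value A (of_real x)"
    using laplace_inverse_exp_real[of "sqrt A" "sqrt x"] A x
    by (simp add: laplace_value_def csqrt_of_real_nonneg exp_of_real [symmetric])
  finally show "(LBINT t:{0<..}. of_real (exp (- (A / t)) / sqrt t) * exp (- of_real x * complex_of_real t)) = laplace_value A (of_real x)" .
qed (use p in \<open>auto simp: open_halfspace_Re_gt convex_connected convex_halfspace_Re_gt\<close>)

text \<open>\<open>Re (csqrt p) = sqrt ((norm p + Re p) / 2)\<close> stays above
  \<open>sqrt (b / 2)\<close> up to the imaginary axis, so the decay in the frequency is uniform as
  the real part of \<open>p\<close> tends to 0.\<close>

lemma norm_laplace_value_le:
  assumes A: "A > 0" and p: "Re p \<ge> 0" "norm p \<ge> b" "b > 0"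
  shows "norm (laplace_value A p) \<le> sqrt pi / sqrt b * exp (- (sqrt (2 * A * b)))"
proof -
  have "norm (csqrt p) = sqrt (norm p)" by simp
  hence 1: "norm (csqrt p) \<ge> sqrt b" using p by simp
  have "Re (csqrt p) = sqrt ((norm p + Re p) / 2)" by simp
  also have "\<dots> \<ge> sqrt (b / 2)" using p by (intro real_sqrt_le_mono) auto
  finally have 2: "Re (csqrt p) \<ge> sqrt (b / 2)" .
  have "sqrt (2 * A * b) = 2 * sqrt A * sqrt (b / 2)"
    by (rule real_sqrt_unique) (use A p in \<open>auto simp: power_mult_distrib\<close>)
  also have "\<dots> \<le> 2 * sqrt A * Re (csqrt p)" using A 2 by (intro mult_left_mono) auto
  finally have 3: "exp (- (2 * sqrt A * Re (csqrt p))) \<le> exp (- (sqrt (2 * A * b)))" by simp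
  have "norm (laplace_value A p) = sqrt pi / norm (csqrt p) * exp (- (2 * sqrt A * Re (csqrt p)))"
    unfolding laplace_value_def norm_mult norm_divide norm_exp_eq_Re by simp
  also have "\<dots> \<le> sqrt pi / sqrt b * exp (- (sqrt (2 * A * b)))"
  proof (intro mult_mono divide_left_mono 1 3)
    have "csqrt p \<noteq> 0" using p by auto
    thus "0 < norm (csqrt p) * sqrt b" using p by simp
  qed (use p in auto)
  finally show ?thesis .
qed

section \<open>Poisson summation with an exponential cutoff\<close>

lemma x2_exp_minus_le_2: "x \<ge> 0 \<Longrightarrow> x\<^sup>2 * exp (- x) \<le> (2::real)"
  using exp_lower_Taylor_quadratic[of x] by (simp add: exp_minus field_simps)

text \<open>The factor \<open>exp (- \<epsilon> * x)\<close> is a cutoff: without it the function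
  decays only like \<open>1 / sqrt x\<close> and is not integrable at infinity.\<close>

definition inv_exp :: "real \<Rightarrow> real \<Rightarrow> real \<Rightarrow> real" where
  "inv_exp A \<epsilon> x = exp (- (A / x) - \<epsilon> * x) / sqrt x"

definition inv_exp' :: "real \<Rightarrow> real \<Rightarrow> real \<Rightarrow> real" where
  "inv_exp' A \<epsilon> x = exp (- (A / x) - \<epsilon> * x) * (A / x\<^sup>2 - \<epsilon>) / sqrt x - exp (- (A / x) - \<epsilon> * x) / (2 * x * sqrt x)"

lemma has_real_derivative_inv_exp:
  assumes x: "x > 0"
  shows "(inv_exp A \<epsilon> has_real_derivative inv_exp' A \<epsilon> x) (at x)"
proof -
  have "((\<lambda>x. exp (- (A / x) - \<epsilon> * x)) has_real_derivative exp (- (A / x) - \<epsilon> * x) * (A / x\<^sup>2 - \<epsilon>)) (at x)"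
    using x by (auto intro!: derivative_eq_intros simp: power2_eq_square)
  moreover have "(sqrt has_real_derivative inverse (sqrt x) / 2) (at x)" using x by (rule DERIV_real_sqrt)
  moreover have "(M * r - N * (inverse r / 2)) / (r * r) = M / r - N / (2 * r\<^sup>2 * r)" if "r > 0" for M N r :: real
    using that by (simp add: field_simps power2_eq_square)
  from this[of "sqrt x"] have "(M * sqrt x - N * (inverse (sqrt x) / 2)) / (sqrt x * sqrt x) = M / sqrt x - N / (2 * x * sqrt x)" for M N
    using x by simp
  ultimately show ?thesis unfolding inv_exp_def [abs_def] inv_exp'_def
    using DERIV_divide[of _ _ x UNIV sqrt "inverse (sqrt x) / 2"] x by fastforce
qed

lemma inv_exp'_bound:
  assumes A: "A > 0" and \<epsilon>: "\<epsilon> > 0" and x: "x > 0"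
  shows "\<bar>inv_exp' A \<epsilon> x\<bar> \<le> (2 / A + \<epsilon> + 1 / (2 * A)) * (exp (- \<epsilon> * x) / sqrt x)"
proof -
  \<comment> \<open>In the variable \<open>u = A / x\<close> the singular factors at 0 become
    \<open>u\<^sup>2 * exp (- u) \<le> 2\<close> and \<open>u * exp (- u) \<le> 1\<close>; together
    with the cutoff they give the three constants of the bound.\<close>
  define u where "u = A / x"
  have u: "u > 0" using A x by (simp add: u_def)
  have eq: "inv_exp' A \<epsilon> x = (u\<^sup>2 * exp (- u) / A - \<epsilon> * exp (- u) - u * exp (- u) / (2 * A)) * (exp (- \<epsilon> * x) / sqrt x)"
  proof -
    have e: "exp (- (A / x) - \<epsilon> * x) = exp (- u) * exp (- \<epsilon> * x)" by (simp add: u_def exp_diff exp_minus field_simps)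
    have 1: "A / x\<^sup>2 = u\<^sup>2 / A" using A x by (simp add: u_def power2_eq_square)
    have 2: "E / (2 * x * r) = u / (2 * A) * E / r" if "r > 0" for E r :: real
      using A x that by (simp add: u_def)
    have "inv_exp' A \<epsilon> x = exp (- u) * exp (- \<epsilon> * x) * (u\<^sup>2 / A - \<epsilon>) / sqrt x - u / (2 * A) * (exp (- u) * exp (- \<epsilon> * x)) / sqrt x"
      unfolding inv_exp'_def e 1 using x by (subst 2) auto
    thus ?thesis by (simp add: algebra_simps diff_divide_distrib)
  qed
  have bd: "\<bar>u\<^sup>2 * exp (- u) / A - \<epsilon> * exp (- u) - u * exp (- u) / (2 * A)\<bar> \<le> 2 / A + \<epsilon> + 1 / (2 * A)"
  proof -
    have "u\<^sup>2 * exp (- u) / A \<le> 2 / A" "u\<^sup>2 * exp (- u) / A \<ge> 0" using x2_exp_minus_le_2[of u] u A by (auto intro: divide_right_mono)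
    moreover have "\<epsilon> * exp (- u) \<le> \<epsilon> * 1" using u \<epsilon> by (intro mult_left_mono) auto
    moreover have "\<epsilon> * exp (- u) \<ge> 0" using \<epsilon> by simp
    moreover have "u * exp (- u) / (2 * A) \<le> 1 / (2 * A)" "u * exp (- u) / (2 * A) \<ge> 0"
      using x_exp_minus_le_1[of u] u A by (auto intro: divide_right_mono)
    ultimately show ?thesis by linarith
  qed
  have "\<bar>exp (- \<epsilon> * x) / sqrt x\<bar> = exp (- \<epsilon> * x) / sqrt x" using x by (intro abs_of_nonneg) auto
  moreover have "0 \<le> exp (- \<epsilon> * x) / sqrt x" using x by auto
  ultimately show ?thesis unfolding eq abs_mult by (simp only: mult_right_mono[OF bd])
qed

text \<open>Twice the cosine coefficient of \<open>inv_exp\<close> at frequency number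
  \<open>m + 1\<close> if \<open>\<epsilon> > 0\<close>; the closed form also admits
  \<open>\<epsilon> = 0\<close>.\<close>

definition laplace_pair :: "real \<Rightarrow> nat \<Rightarrow> real \<Rightarrow> complex" where
  "laplace_pair A m \<epsilon> = laplace_value A (Complex \<epsilon> (- (2 * pi * real (Suc m)))) + laplace_value A (Complex \<epsilon> (2 * pi * real (Suc m)))"

lemma inv_exp_cos_integral:
  assumes A: "A > 0" and \<epsilon>: "\<epsilon> > 0"
  shows "2 * (LBINT x:{0<..}. of_real (inv_exp A \<epsilon> x) * of_real (cos (2 * pi * real (Suc m) * x))) = laplace_pair A m \<epsilon>"
proof -
  define p where "p = Complex \<epsilon> (- (2 * pi * real (Suc m)))"
  define q where "q = Complex \<epsilon> (2 * pi * real (Suc m))"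
  have pq: "Re p > 0" "Re q > 0" using \<epsilon> by (auto simp: p_def q_def)
  have "2 * (LBINT x:{0<..}. of_real (inv_exp A \<epsilon> x) * of_real (cos (2 * pi * real (Suc m) * x))) =
      (LBINT x:{0<..}. 2 * (of_real (inv_exp A \<epsilon> x) * complex_of_real (cos (2 * pi * real (Suc m) * x))))"
    by (rule set_integral_mult_right [symmetric])
  also have "\<dots> = (LBINT x:{0<..}. of_real (exp (- (A / x)) / sqrt x) * exp (- p * of_real x) + of_real (exp (- (A / x)) / sqrt x) * exp (- q * of_real x))"
  proof (rule set_lebesgue_integral_cong, simp, intro allI impI)
    fix x :: real assume "x \<in> {0<..}"
    have 1: "exp (- p * of_real x) = of_real (exp (- \<epsilon> * x)) * cis (2 * pi * real (Suc m) * x)"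
      "exp (- q * of_real x) = of_real (exp (- \<epsilon> * x)) * cis (- (2 * pi * real (Suc m) * x))"
      by (simp_all add: exp_eq_polar p_def q_def)
    have "inv_exp A \<epsilon> x = exp (- (A / x)) / sqrt x * exp (- \<epsilon> * x)"
      by (simp add: inv_exp_def exp_diff exp_minus field_simps)
    thus "2 * (of_real (inv_exp A \<epsilon> x) * complex_of_real (cos (2 * pi * real (Suc m) * x))) =
      of_real (exp (- (A / x)) / sqrt x) * exp (- p * of_real x) + of_real (exp (- (A / x)) / sqrt x) * exp (- q * of_real x)"
      unfolding 1 by (simp add: complex_eq_iff)
  qed
  also have "\<dots> = laplace_value A p + laplace_value A q"
    using laplace_inverse_exp[OF A] set_integrable_laplace_inverse_exp[OF A] pq by (simp add: set_integral_add)
  finally show ?thesis by (simp add: laplace_pair_def p_def q_def)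
qed

lemma norm_laplace_pair_le:
  assumes A: "A > 0" and \<epsilon>: "\<epsilon> \<ge> 0"
  shows "norm (laplace_pair A m \<epsilon>) \<le> 2 * (sqrt pi / sqrt (2 * pi * real (Suc m)) * exp (- (sqrt (2 * A * (2 * pi * real (Suc m))))))"
proof -
  let ?b = "2 * pi * real (Suc m)"
  have "norm (Complex \<epsilon> y) \<ge> \<bar>y\<bar>" for y using abs_Im_le_cmod[of "Complex \<epsilon> y"] by simp
  from this[of "- ?b"] this[of ?b] have "norm (Complex \<epsilon> (- ?b)) \<ge> ?b" "norm (Complex \<epsilon> ?b) \<ge> ?b" by (simp_all add: abs_mult)
  hence "norm (laplace_value A (Complex \<epsilon> (- ?b))) \<le> sqrt pi / sqrt ?b * exp (- (sqrt (2 * A * ?b)))"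
     "norm (laplace_value A (Complex \<epsilon> ?b)) \<le> sqrt pi / sqrt ?b * exp (- (sqrt (2 * A * ?b)))"
    using \<epsilon> by (intro norm_laplace_value_le A; simp)+
  thus ?thesis unfolding laplace_pair_def using norm_triangle_ineq[of "laplace_value A (Complex \<epsilon> (- ?b))" "laplace_value A (Complex \<epsilon> ?b)"]
    by linarith
qed

lemma summable_on_laplace_bound:
  assumes A: "A > 0"
  shows "(\<lambda>m. 2 * (sqrt pi / sqrt (2 * pi * real (Suc m)) * exp (- (sqrt (2 * A * (2 * pi * real (Suc m))))))) summable_on UNIV"
proof -
  let ?f = "\<lambda>m. 2 * (sqrt pi / sqrt (2 * pi * real (Suc m)) * exp (- (sqrt (2 * A * (2 * pi * real (Suc m))))))"
  have "((\<lambda>m. ?f m * real (Suc m) powr 2) \<longlongrightarrow> 0) at_top"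
    using assms by real_asymp
  hence "Bseq (\<lambda>m. ?f m * real (Suc m) powr 2)"
    by (intro convergent_imp_Bseq) (auto simp: convergent_def)
  then obtain C where C: "\<And>m. norm (?f m * real (Suc m) powr 2) \<le> C"
    unfolding Bseq_def by blast
  have bd: "norm (?f m) \<le> C * real (Suc m) powr -2" for m
  proof -
    have "norm (?f m) * real (Suc m) powr 2 \<le> C" using C[of m] unfolding norm_mult by simp
    moreover have "real (Suc m) powr 2 * real (Suc m) powr -2 = 1" by (simp only: powr_add [symmetric]) simp
    ultimately show ?thesis
      using mult_right_mono[of "norm (?f m) * real (Suc m) powr 2" C "real (Suc m) powr -2"] by (simp only: mult.assoc) simp
  qed
  have "(\<lambda>m. C * real (Suc m) powr -2) summable_on UNIV" by (intro summable_on_cmult_right summable_on_Suc_powr) simp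
  thus ?thesis by (rule abs_summable_on_norm_bound(2)[OF _ bd])
qed

lemma poisson_inverse_exp:
  assumes A: "A > 0" and \<epsilon>: "\<epsilon> > 0"
  shows "(\<lambda>k. complex_of_real (inv_exp A \<epsilon> (real (Suc k)))) sums
     (of_real (sqrt (pi / \<epsilon>) * exp (- 2 * sqrt (A * \<epsilon>))) + (\<Sum>\<^sub>\<infinity>m. laplace_pair A m \<epsilon>))"
proof -
  let ?h = "\<lambda>x. complex_of_real (inv_exp A \<epsilon> x)" and ?h' = "\<lambda>x. complex_of_real (inv_exp' A \<epsilon> x)"
  have abs: "(\<lambda>m. norm (laplace_pair A m \<epsilon>)) summable_on UNIV" "(\<lambda>m. laplace_pair A m \<epsilon>) summable_on UNIV"
    using abs_summable_on_norm_bound(1,2)[OF summable_on_laplace_bound[OF A] norm_laplace_pair_le[OF A]] \<epsilon> by auto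
  have half: "(LBINT x:{0<..}. ?h x * of_real (cos (2 * pi * real (Suc m) * x))) = 1 / 2 * laplace_pair A m \<epsilon>" for m
  proof -
    have "I = 1 / 2 * L" if "2 * I = L" for I L :: complex
      by (simp add: that [symmetric])
    from this[OF inv_exp_cos_integral[OF assms]] show ?thesis .
  qed
  have split: "?h x = of_real (exp (- (A / x)) / sqrt x) * exp (- of_real \<epsilon> * of_real x)" for x
    by (simp add: inv_exp_def exp_diff exp_minus exp_of_real [symmetric] field_simps)
  have "(\<lambda>k. ?h (real (Suc k))) sums ((LBINT x:{0<..}. ?h x) + (\<Sum>m. 2 * (LBINT x:{0<..}. ?h x * of_real (cos (2 * pi * real (Suc m) * x)))))"
  proof (rule poisson_half_line)
    fix x :: real assume x: "x > 0"
    show "(?h has_vector_derivative ?h' x) (at x)"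
      using has_real_derivative_inv_exp[OF x]
      by (intro has_vector_derivative_of_real) (simp add: has_real_derivative_iff_has_vector_derivative)
  next
    show cont: "continuous_on {0<..} ?h'" unfolding inv_exp'_def by (intro continuous_intros) auto
    show "set_integrable lborel {0<..} ?h"
      unfolding split using A \<epsilon> by (intro set_integrable_laplace_inverse_exp) auto
    show "set_integrable lborel {0<..} ?h'"
      by (rule set_integrable_pos_bound[OF cont set_integrable_mult_right[OF set_integrable_inverse_sqrt_exp[OF \<epsilon>], of "2 / A + \<epsilon> + 1 / (2 * A)"]])
         (use inv_exp'_bound[OF A \<epsilon>] in auto)
    show "(?h \<longlongrightarrow> 0) (at_right 0)"
    proof -
      have "(inv_exp A \<epsilon> \<longlongrightarrow> 0) (at_right 0)"
        unfolding inv_exp_def [abs_def] using A \<epsilon> by real_asymp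
      from tendsto_of_real[OF this] show ?thesis by simp
    qed
    show "(?h \<longlongrightarrow> 0) at_top"
    proof -
      have "(inv_exp A \<epsilon> \<longlongrightarrow> 0) at_top"
        unfolding inv_exp_def [abs_def] using A \<epsilon> by real_asymp
      from tendsto_of_real[OF this] show ?thesis by simp
    qed
    show "summable (\<lambda>m. norm (LBINT x:{0<..}. ?h x * of_real (cos (2 * pi * real (Suc m) * x))))"
      unfolding half norm_mult[of "1 / 2"] by (intro summable_mult summable_on_imp_summable abs)
  qed
  moreover have "(LBINT x:{0<..}. ?h x) = of_real (sqrt (pi / \<epsilon>) * exp (- 2 * sqrt (A * \<epsilon>)))"
  proof -
    have "(LBINT x:{0<..}. ?h x) = laplace_value A (of_real \<epsilon>)"
      unfolding split using A \<epsilon> by (intro laplace_inverse_exp) auto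
    also have "\<dots> = of_real (sqrt pi / sqrt \<epsilon> * exp (- 2 * sqrt A * sqrt \<epsilon>))"
      using \<epsilon> by (simp add: laplace_value_def csqrt_of_real_nonneg exp_of_real [symmetric])
    finally show ?thesis by (simp add: real_sqrt_divide real_sqrt_mult mult_ac)
  qed
  moreover have "(\<Sum>m. 2 * (LBINT x:{0<..}. ?h x * of_real (cos (2 * pi * real (Suc m) * x)))) = (\<Sum>\<^sub>\<infinity>m. laplace_pair A m \<epsilon>)"
    unfolding half infsum_eq_suminf_nat[OF abs(2)] by simp
  ultimately show ?thesis by (simp only:)
qed

text \<open>The parameter is chosen so that \<open>2 * sqrt A * sqrt pi = a\<close>. The square
  roots of a purely imaginary number lie on the diagonals: equal real and imaginary parts give
  damping and oscillation the same rate, and their reciprocals give the phase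
  \<open>pi / 4\<close>.\<close>

lemma laplace_pair_0:
  assumes a: "a > 0"
  shows "laplace_pair (a\<^sup>2 / (4 * pi)) m 0 =
     of_real (sqrt 2 * (exp (- a * sqrt (real (Suc m))) * sin (pi / 4 - a * sqrt (real (Suc m))) / sqrt (real (Suc m))))"
proof -
  define n where "n = real (Suc m)"
  define A where "A = a\<^sup>2 / (4 * pi)"
  have n: "n > 0" by (simp add: n_def)
  have val: "laplace_value A (Complex 0 (\<sigma> * (2 * pi * n))) = (1 - of_real \<sigma> * \<i>) / of_real (2 * sqrt n) * (of_real (exp (- a * sqrt n)) * cis (- \<sigma> * (a * sqrt n)))"
    if \<sigma>: "\<sigma> = 1 \<or> \<sigma> = -1" for \<sigma> :: real
  proof -
    have "csqrt (Complex 0 (\<sigma> * (2 * pi * n))) = Complex (sqrt (pi * n)) (\<sigma> * sqrt (pi * n))"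
      using \<sigma> n by (auto simp: complex_eq_iff cmod_def abs_mult sgn_mult)
    also have "\<dots> = of_real (sqrt pi * sqrt n) * (1 + of_real \<sigma> * \<i>)"
      by (simp add: complex_eq_iff real_sqrt_mult)
    finally have cs: "csqrt (Complex 0 (\<sigma> * (2 * pi * n))) = of_real (sqrt pi * sqrt n) * (1 + of_real \<sigma> * \<i>)" .
    have sA: "2 * sqrt A * sqrt pi = a"
      using a by (simp add: A_def real_sqrt_divide real_sqrt_mult)
    have e: "- 2 * of_real (sqrt A) * (of_real (sqrt pi * sqrt n) * (1 + of_real \<sigma> * \<i>)) = of_real (- a * sqrt n) + \<i> * of_real (- \<sigma> * (a * sqrt n))"
    proof -
      have "- 2 * of_real (sqrt A) * (of_real (sqrt pi * sqrt n) * (1 + of_real \<sigma> * \<i>)) = - of_real (2 * sqrt A * sqrt pi) * of_real (sqrt n) * (1 + of_real \<sigma> * \<i>)"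
        by simp
      thus ?thesis unfolding sA by (simp add: algebra_simps)
    qed
    have d: "of_real (sqrt pi) / (of_real (sqrt pi * sqrt n) * (1 + of_real \<sigma> * \<i>)) = (1 - of_real \<sigma> * \<i>) / of_real (2 * sqrt n)"
    proof -
      have "(1 + of_real \<sigma> * \<i>) * (1 - of_real \<sigma> * \<i>) = 2" using \<sigma> by (auto simp: algebra_simps)
      moreover from this have "1 + of_real \<sigma> * \<i> \<noteq> 0" by auto
      ultimately show ?thesis using n by (simp add: divide_eq_eq eq_divide_eq mult_ac)
    qed
    show ?thesis unfolding laplace_value_def cs e d exp_add exp_of_real cis_conv_exp ..
  qed
  have s: "sqrt 2 * sin (pi / 4 - x) = cos x - sin x" for x :: real
  proof -
    have "sqrt 2 * (sqrt 2 / 2) = (1::real)" by simp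
    thus ?thesis by (simp add: sin_diff sin_45 cos_45 right_diff_distrib mult.assoc [symmetric])
  qed
  have "laplace_pair A m 0 = (1 + \<i>) / of_real (2 * sqrt n) * (of_real (exp (- a * sqrt n)) * cis (a * sqrt n))
     + (1 - \<i>) / of_real (2 * sqrt n) * (of_real (exp (- a * sqrt n)) * cis (- (a * sqrt n)))"
    using val[of "-1"] val[of 1] by (simp add: laplace_pair_def n_def [symmetric])
  also have "\<dots> = of_real (exp (- a * sqrt n) / (2 * sqrt n)) * ((1 + \<i>) * cis (a * sqrt n) + (1 - \<i>) * cis (- (a * sqrt n)))"
  proof -
    have "u / d * (e * c) + v / d * (e * c') = e / d * (u * c + v * c')" for u v d e c c' :: complex
      by (simp add: divide_inverse algebra_simps)
    thus ?thesis unfolding of_real_divide .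
  qed
  also have "(1 + \<i>) * cis (a * sqrt n) + (1 - \<i>) * cis (- (a * sqrt n)) = of_real (2 * (cos (a * sqrt n) - sin (a * sqrt n)))"
    by (simp add: complex_eq_iff)
  also have "of_real (exp (- a * sqrt n) / (2 * sqrt n)) * complex_of_real (2 * (cos (a * sqrt n) - sin (a * sqrt n))) =
      of_real (exp (- a * sqrt n) * (sqrt 2 * sin (pi / 4 - a * sqrt n)) / sqrt n)"
  proof -
    have "e / (2 * r) * (2 * x) = e * x / r" for e r x :: real by simp
    thus ?thesis unfolding s of_real_mult [symmetric] by (simp only:)
  qed
  finally show ?thesis by (simp add: A_def n_def mult_ac)
qed

section \<open>Removal of the cutoff\<close>

lemma tendsto_laplace_pair: "((\<lambda>\<epsilon>. laplace_pair A m \<epsilon>) \<longlongrightarrow> laplace_pair A m 0) (at_right 0)"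
proof -
  have "((\<lambda>\<epsilon>. laplace_value A (Complex \<epsilon> y)) \<longlongrightarrow> laplace_value A (Complex 0 y)) (at_right 0)" if "y \<noteq> 0" for y
  proof -
    have "((\<lambda>\<epsilon>. Complex \<epsilon> y) \<longlongrightarrow> Complex 0 y) (at_right 0)" by (intro tendsto_intros)
    moreover have "isCont csqrt (Complex 0 y)" using that by (intro continuous_at_csqrt) (auto simp: complex_nonpos_Reals_iff)
    ultimately have "((\<lambda>\<epsilon>. csqrt (Complex \<epsilon> y)) \<longlongrightarrow> csqrt (Complex 0 y)) (at_right 0)"
      by (rule isCont_tendsto_compose[rotated])
    thus ?thesis unfolding laplace_value_def using that by (intro tendsto_intros) (auto simp: complex_eq_iff)
  qed
  thus ?thesis unfolding laplace_pair_def by (intro tendsto_add) auto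
qed

lemma one_minus_exp_bounds: "x \<ge> 0 \<Longrightarrow> \<bar>exp (- x) - 1\<bar> \<le> (x::real)"
proof -
  assume "x \<ge> 0"
  hence "exp (- x) \<le> 1" by simp
  thus ?thesis using exp_ge_add_one_self[of "- x"] by linarith
qed

lemma summable_on_exp_inverse:
  assumes A: "A \<ge> 0"
  shows "norm (complex_of_real ((exp (- (A / real (Suc k))) - 1) / sqrt (real (Suc k)))) \<le> A * real (Suc k) powr - (3 / 2)"
    "(\<lambda>k. complex_of_real ((exp (- (A / real (Suc k))) - 1) / sqrt (real (Suc k)))) summable_on UNIV"
proof -
  show bd: "norm (complex_of_real ((exp (- (A / real (Suc k))) - 1) / sqrt (real (Suc k)))) \<le> A * real (Suc k) powr - (3 / 2)" for k
  proof -
    let ?n = "real (Suc k)"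
    have "norm (complex_of_real ((exp (- (A / ?n)) - 1) / sqrt ?n)) = \<bar>exp (- (A / ?n)) - 1\<bar> / sqrt ?n"
      unfolding norm_of_real abs_divide by simp
    also have "\<dots> \<le> A / ?n / sqrt ?n" using A by (intro divide_right_mono one_minus_exp_bounds) auto
    also have "\<dots> = A * (?n powr - 1 * ?n powr - (1 / 2))"
    proof -
      have n: "?n > 0" by simp
      show ?thesis unfolding powr_minus_half[OF n] powr_neg_one[OF n] by simp
    qed
    also have "?n powr - 1 * ?n powr - (1 / 2) = ?n powr - (3 / 2)" by (simp only: powr_add [symmetric]) simp
    finally show ?thesis .
  qed
  have "(\<lambda>k. A * real (Suc k) powr - (3 / 2)) summable_on UNIV" by (intro summable_on_cmult_right summable_on_Suc_powr) simp
  thus "(\<lambda>k. complex_of_real ((exp (- (A / real (Suc k))) - 1) / sqrt (real (Suc k)))) summable_on UNIV"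
    by (rule abs_summable_on_norm_bound(2)[OF _ bd])
qed

text \<open>The divergent quantity \<open>sqrt (pi / \<epsilon>)\<close> is subtracted and added.
  Taken off \<open>exp_sum\<close> it leaves \<open>zeta (1 / 2)\<close>; combined with the integral
  term as \<open>sqrt (pi / \<epsilon>) * (1 - exp (- 2 * sqrt (A * \<epsilon>)))\<close> it tends
  to \<open>2 * sqrt (pi * A) = a\<close>. The remaining sum is dominated, as subtracting 1 gains a
  factor \<open>A / k\<close>.\<close>

theorem damped_sine_sum:
  assumes a: "a > 0"
  shows "(\<Sum>\<^sub>\<infinity>m. complex_of_real (sqrt 2 * (exp (- a * sqrt (real (Suc m))) * sin (pi / 4 - a * sqrt (real (Suc m))) / sqrt (real (Suc m)))))
     = of_real a + zeta (1 / 2) + (\<Sum>\<^sub>\<infinity>k. of_real ((exp (- (a\<^sup>2 / (4 * pi) / real (Suc k))) - 1) / sqrt (real (Suc k))))"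
proof -
  define A where "A = a\<^sup>2 / (4 * pi)"
  have A: "A > 0" using a by (simp add: A_def)
  let ?b = "\<lambda>k. (exp (- (A / real (Suc k))) - 1) / sqrt (real (Suc k))"
  have pos: "\<forall>\<^sub>F \<epsilon> in at_right (0::real). \<epsilon> > 0" by (rule eventually_at_right_less)
  have T1: "((\<lambda>\<epsilon>. \<Sum>\<^sub>\<infinity>m. laplace_pair A m \<epsilon>) \<longlongrightarrow> (\<Sum>\<^sub>\<infinity>m. laplace_pair A m 0)) (at_right 0)"
  proof (rule tendsto_infsum_dominated[OF tendsto_laplace_pair _ summable_on_laplace_bound[OF A]])
    show "\<forall>\<^sub>F \<epsilon> in at_right 0. \<forall>m. norm (laplace_pair A m \<epsilon>) \<le> 2 * (sqrt pi / sqrt (2 * pi * real (Suc m)) * exp (- (sqrt (2 * A * (2 * pi * real (Suc m))))))"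
      using pos by eventually_elim (use norm_laplace_pair_le[OF A] in auto)
  qed auto
  have E: "\<forall>\<^sub>F \<epsilon> in at_right 0. (\<Sum>\<^sub>\<infinity>m. laplace_pair A m \<epsilon>) = (exp_sum \<epsilon> - of_real (sqrt (pi / \<epsilon>)))
     + (\<Sum>\<^sub>\<infinity>k. of_real (?b k * exp (- \<epsilon> * real (Suc k)))) + of_real (sqrt (pi / \<epsilon>) * (1 - exp (- 2 * sqrt (A * \<epsilon>))))"
    using pos
  proof eventually_elim
    case (elim \<epsilon>)
    have 1: "(\<lambda>k. complex_of_real (?b k * exp (- \<epsilon> * real (Suc k)))) summable_on UNIV"
    proof (rule abs_summable_on_norm_bound(2))
      show "(\<lambda>k. A * real (Suc k) powr - (3 / 2)) summable_on UNIV" by (intro summable_on_cmult_right summable_on_Suc_powr) simp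
      fix k
      have "norm (complex_of_real (?b k * exp (- \<epsilon> * real (Suc k)))) = norm (complex_of_real (?b k)) * exp (- \<epsilon> * real (Suc k))"
        unfolding of_real_mult norm_mult by (simp only: norm_of_real abs_exp_cancel)
      also have "\<dots> \<le> norm (complex_of_real (?b k)) * 1" using elim by (intro mult_left_mono) auto
      finally show "norm (complex_of_real (?b k * exp (- \<epsilon> * real (Suc k)))) \<le> A * real (Suc k) powr - (3 / 2)"
        using summable_on_exp_inverse(1)[of A k] A by simp
    qed
    have "(\<lambda>k. complex_of_real (exp (- \<epsilon> * real (Suc k)) / sqrt (real (Suc k))) + of_real (?b k * exp (- \<epsilon> * real (Suc k)))) sums
       (exp_sum \<epsilon> + (\<Sum>\<^sub>\<infinity>k. of_real (?b k * exp (- \<epsilon> * real (Suc k)))))"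
      unfolding exp_sum_def using elim 1 by (intro sums_add has_sum_imp_sums has_sum_infsum summable_on_exp_sum)
    moreover have "complex_of_real (exp (- \<epsilon> * real (Suc k)) / sqrt (real (Suc k))) + of_real (?b k * exp (- \<epsilon> * real (Suc k))) = of_real (inv_exp A \<epsilon> (real (Suc k)))" for k
    proof -
      have "E / r + (F - 1) / r * E = F * E / r" for E F r :: real by (simp add: diff_divide_distrib algebra_simps)
      thus ?thesis unfolding inv_exp_def of_real_add [symmetric] by (simp add: exp_diff exp_minus divide_inverse)
    qed
    ultimately have "(\<lambda>k. complex_of_real (inv_exp A \<epsilon> (real (Suc k)))) sums (exp_sum \<epsilon> + (\<Sum>\<^sub>\<infinity>k. of_real (?b k * exp (- \<epsilon> * real (Suc k)))))"
      by (simp only:)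
    from sums_unique2[OF this poisson_inverse_exp[OF A elim]] show ?case by (simp add: algebra_simps)
  qed
  have T2: "((\<lambda>\<epsilon>. (exp_sum \<epsilon> - of_real (sqrt (pi / \<epsilon>))) + (\<Sum>\<^sub>\<infinity>k. of_real (?b k * exp (- \<epsilon> * real (Suc k))))
       + of_real (sqrt (pi / \<epsilon>) * (1 - exp (- 2 * sqrt (A * \<epsilon>))))) \<longlongrightarrow> zeta (1 / 2) + (\<Sum>\<^sub>\<infinity>k. of_real (?b k)) + of_real a) (at_right 0)"
  proof (intro tendsto_add zeta_half_limit)
    show "((\<lambda>\<epsilon>. \<Sum>\<^sub>\<infinity>k. complex_of_real (?b k * exp (- \<epsilon> * real (Suc k)))) \<longlongrightarrow> (\<Sum>\<^sub>\<infinity>k. of_real (?b k))) (at_right 0)"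
    proof (rule tendsto_infsum_dominated)
      show "(\<lambda>k. A * real (Suc k) powr - (3 / 2)) summable_on UNIV" by (intro summable_on_cmult_right summable_on_Suc_powr) simp
      show "((\<lambda>\<epsilon>. complex_of_real (?b k * exp (- \<epsilon> * real (Suc k)))) \<longlongrightarrow> of_real (?b k)) (at_right 0)" for k
      proof -
        have "((\<lambda>\<epsilon>. complex_of_real (?b k * exp (- \<epsilon> * real (Suc k)))) \<longlongrightarrow> of_real (?b k * exp (- 0 * real (Suc k)))) (at_right 0)"
          by (intro tendsto_intros)
        thus ?thesis by simp
      qed
      show "\<forall>\<^sub>F \<epsilon> in at_right 0. \<forall>k. norm (complex_of_real (?b k * exp (- \<epsilon> * real (Suc k)))) \<le> A * real (Suc k) powr - (3 / 2)"
        using pos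
      proof eventually_elim
        case (elim \<epsilon>)
        show ?case
        proof
          fix k
          have "norm (complex_of_real (?b k * exp (- \<epsilon> * real (Suc k)))) = norm (complex_of_real (?b k)) * exp (- \<epsilon> * real (Suc k))"
            unfolding of_real_mult norm_mult by (simp only: norm_of_real abs_exp_cancel)
          also have "\<dots> \<le> norm (complex_of_real (?b k)) * 1" using elim by (intro mult_left_mono) auto
          finally show "norm (complex_of_real (?b k * exp (- \<epsilon> * real (Suc k)))) \<le> A * real (Suc k) powr - (3 / 2)"
            using summable_on_exp_inverse(1)[of A k] A by simp
        qed
      qed
    qed auto
    have "((\<lambda>\<epsilon>. sqrt (pi / \<epsilon>) * (1 - exp (- 2 * sqrt (A * \<epsilon>)))) \<longlongrightarrow> pi powr (1 / 2) * (2 * A powr (1 / 2))) (at_right 0)"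
      using A by real_asymp
    also have "pi powr (1 / 2) * (2 * A powr (1 / 2)) = 2 * sqrt pi * sqrt A" using A by (simp add: powr_half_sqrt)
    also have "2 * sqrt pi * sqrt A = a" using a by (simp add: A_def real_sqrt_divide real_sqrt_mult)
    finally show "((\<lambda>\<epsilon>. complex_of_real (sqrt (pi / \<epsilon>) * (1 - exp (- 2 * sqrt (A * \<epsilon>))))) \<longlongrightarrow> of_real a) (at_right 0)"
      by (rule tendsto_of_real)
  qed
  have "(\<Sum>\<^sub>\<infinity>m. laplace_pair A m 0) = zeta (1 / 2) + (\<Sum>\<^sub>\<infinity>k. of_real (?b k)) + of_real a"
    by (rule tendsto_unique[OF _ Lim_transform_eventually[OF T1 E] T2]) simp
  thus ?thesis unfolding A_def laplace_pair_0[OF a] by (simp only: add_ac)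
qed

section \<open>The double series and its analytic continuation\<close>

lemma summable_on_powr_product:
  assumes "a < -1" "b < -1"
  shows "(\<lambda>(j, m). C * (real (Suc j) powr a * real (Suc m) powr b)) summable_on UNIV"
proof -
  have "(\<lambda>(j, m). real (Suc j) powr a * real (Suc m) powr b) summable_on UNIV \<times> UNIV"
  proof (rule summable_on_SigmaI)
    show "((\<lambda>m. case (j, m) of (j, m) \<Rightarrow> real (Suc j) powr a * real (Suc m) powr b) has_sum
        real (Suc j) powr a * (\<Sum>\<^sub>\<infinity>m. real (Suc m) powr b)) UNIV" for j
      using assms by (simp, intro has_sum_cmult_right has_sum_infsum summable_on_Suc_powr)
    show "(\<lambda>j. real (Suc j) powr a * (\<Sum>\<^sub>\<infinity>m. real (Suc m) powr b)) summable_on UNIV"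
      using assms by (intro summable_on_cmult_left summable_on_Suc_powr)
  qed auto
  from summable_on_cmult_right[OF this, of C] show ?thesis by (simp add: case_prod_unfold)
qed

text \<open>The inequality \<open>x \<le> exp x\<close> at \<open>x = d * t / N\<close>, raised to
  the power \<open>N\<close>.\<close>

lemma exp_minus_le_powr:
  assumes "d > 0" "N > 0" "t > (0::real)"
  shows "exp (- (d * t)) \<le> (N / d) powr N * t powr (- N)"
proof -
  have "d * t / N \<le> exp (d * t / N)" using exp_ge_add_one_self[of "d * t / N"] by linarith
  hence "t \<le> N / d * exp (d * t / N)" using assms by (simp add: field_simps)
  hence "t powr N \<le> (N / d * exp (d * t / N)) powr N" using assms by (intro powr_mono2) auto
  also have "\<dots> = (N / d) powr N * exp (d * t)"
  proof -
    have "exp (d * t / N) powr N = exp (d * t)" using assms by (simp add: exp_powr_real)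
    thus ?thesis using assms by (simp add: powr_mult del: times_divide_eq_left times_divide_eq_right)
  qed
  finally show ?thesis using assms by (simp add: powr_minus exp_minus field_simps)
qed

section \<open>The double series of the left side\<close>

definition damped_sine :: "real \<Rightarrow> nat \<Rightarrow> nat \<Rightarrow> real" where
  "damped_sine \<beta> j m = (let a = real (Suc j) * sqrt \<beta> in
     exp (- a * sqrt (real (Suc m))) * sin (pi / 4 - a * sqrt (real (Suc m))) / sqrt (real (Suc m)))"

text \<open>The pair \<open>(j, m)\<close> stands for \<open>n = (m + 1) * (j + 1)\<^sup>2\<close>.
  Splitting \<open>sqrt n\<close> accordingly lowers the exponent of the divisor from
  \<open>s\<close> to \<open>s - 1\<close>.\<close>

definition left_sum :: "real \<Rightarrow> complex \<Rightarrow> complex" where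
  "left_sum \<beta> s = (\<Sum>\<^sub>\<infinity>(j, m). npow j (s - 1) * of_real (damped_sine \<beta> j m))"

lemma left_term_bound:
  assumes \<beta>: "\<beta> > 0"
  shows "\<exists>C. \<forall>s j m. Re s \<le> b \<longrightarrow> norm (npow j (s - 1) * of_real (damped_sine \<beta> j m)) \<le> C * (real (Suc j) powr - 2 * real (Suc m) powr - (3 / 2))"
proof -
  \<comment> \<open>Large enough for both exponents whatever the sign of \<open>b\<close>:
    \<open>b - 1 - N \<le> -2\<close> and \<open>- N / 2 \<le> - 3 / 2\<close>.\<close>
  define N where "N = \<bar>b\<bar> + 3"
  define C where "C = (N / sqrt \<beta>) powr N"
  have N: "N > 0" by (simp add: N_def)
  have C0: "C \<ge> 0" by (simp add: C_def)
  have "norm (npow j (s - 1) * of_real (damped_sine \<beta> j m)) \<le> C * (real (Suc j) powr - 2 * real (Suc m) powr - (3 / 2))"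
    if s: "Re s \<le> b" for s j m
  proof -
    let ?j = "real (Suc j)" and ?m = "real (Suc m)"
    define t where "t = ?j * sqrt ?m"
    have t: "t > 0" by (simp add: t_def)
    define X where "X = pi / 4 - ?j * sqrt \<beta> * sqrt ?m"
    have "\<bar>damped_sine \<beta> j m\<bar> = exp (- (sqrt \<beta> * t)) * \<bar>sin X\<bar> / sqrt ?m"
      by (simp add: damped_sine_def Let_def t_def X_def abs_mult mult_ac)
    also have "\<dots> \<le> exp (- (sqrt \<beta> * t)) * 1 / 1"
      by (intro frac_le mult_left_mono) auto
    also have "\<dots> \<le> C * t powr (- N)"
      unfolding C_def using exp_minus_le_powr[of "sqrt \<beta>" N t] \<beta> N t by simp
    also have "t powr (- N) = ?j powr (- N) * ?m powr (- (N / 2))"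
    proof -
      have "sqrt ?m powr (- N) = (?m powr (1 / 2)) powr (- N)" by (simp add: powr_half_sqrt)
      also have "\<dots> = ?m powr (- (N / 2))" by (simp only: powr_powr) simp
      finally show ?thesis by (simp add: t_def powr_mult)
    qed
    finally have 1: "\<bar>damped_sine \<beta> j m\<bar> \<le> C * (?j powr (- N) * ?m powr (- (N / 2)))" .
    have "norm (npow j (s - 1) * of_real (damped_sine \<beta> j m)) = ?j powr (Re s - 1) * \<bar>damped_sine \<beta> j m\<bar>"
      unfolding norm_mult norm_npow norm_of_real by simp
    also have "\<dots> \<le> ?j powr (Re s - 1) * (C * (?j powr (- N) * ?m powr (- (N / 2))))"
      by (intro mult_left_mono 1) auto
    also have "\<dots> = C * (?j powr (Re s - 1 - N) * ?m powr (- (N / 2)))"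
    proof -
      have e: "?j powr (Re s - 1 - N) = ?j powr (Re s - 1) * ?j powr (- N)"
        by (simp only: powr_add [symmetric]) simp
      show ?thesis unfolding e by (simp only: mult_ac)
    qed
    also have "\<dots> \<le> C * (?j powr - 2 * ?m powr - (3 / 2))"
      using s C0 by (intro mult_left_mono mult_mono Suc_powr_mono) (auto simp: N_def)
    finally show ?thesis .
  qed
  thus ?thesis by blast
qed

lemma summable_on_left:
  assumes "\<beta> > 0"
  shows "(\<lambda>(j, m). npow j (s - 1) * of_real (damped_sine \<beta> j m)) summable_on UNIV"
proof -
  obtain C where C: "\<And>z j m. Re z \<le> Re s \<Longrightarrow> norm (npow j (z - 1) * of_real (damped_sine \<beta> j m)) \<le> C * (real (Suc j) powr - 2 * real (Suc m) powr - (3 / 2))"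
    using left_term_bound[OF assms] by blast
  have "(\<lambda>(j, m). C * (real (Suc j) powr - 2 * real (Suc m) powr - (3 / 2))) summable_on UNIV"
    by (rule summable_on_powr_product) auto
  thus ?thesis
    by (rule abs_summable_on_norm_bound(2)) (use C[of s] in auto)
qed

lemma holomorphic_left_sum:
  assumes "\<beta> > 0"
  shows "left_sum \<beta> holomorphic_on UNIV"
  unfolding left_sum_def [abs_def]
proof (rule holomorphic_on_infsum)
  show "(\<lambda>s. case p of (j, m) \<Rightarrow> npow j (s - 1) * of_real (damped_sine \<beta> j m)) holomorphic_on UNIV" for p
    by (cases p) (auto intro!: holomorphic_intros)
  fix a :: complex
  obtain C where C: "\<And>z j m. Re z \<le> Re a + 1 \<Longrightarrow> norm (npow j (z - 1) * of_real (damped_sine \<beta> j m)) \<le> C * (real (Suc j) powr - 2 * real (Suc m) powr - (3 / 2))"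
    using left_term_bound[OF assms] by blast
  show "\<exists>r>0. \<exists>w. cball a r \<subseteq> UNIV \<and> w summable_on UNIV \<and>
     (\<forall>z\<in>cball a r. \<forall>p\<in>UNIV. norm (case p of (j, m) \<Rightarrow> npow j (z - 1) * of_real (damped_sine \<beta> j m)) \<le> w p)"
  proof (rule exI[of _ 1], intro conjI, simp, rule exI, intro conjI ballI)
    show "(\<lambda>(j, m). C * (real (Suc j) powr - 2 * real (Suc m) powr - (3 / 2))) summable_on UNIV"
      by (rule summable_on_powr_product) auto
    fix z p assume "z \<in> cball a 1"
    hence "Re z \<le> Re a + 1" using Re_cball by blast
    thus "norm (case p of (j, m) \<Rightarrow> npow j (z - 1) * of_real (damped_sine \<beta> j m)) \<le> (case p of (j, m) \<Rightarrow> C * (real (Suc j) powr - 2 * real (Suc m) powr - (3 / 2)))"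
      using C by (cases p) simp
  qed simp
qed auto

text \<open>For \<open>a = (j + 1) * sqrt \<beta>\<close> the exponent
  \<open>a\<^sup>2 / (4 * pi * (k + 1))\<close> in \<open>damped_sine_sum\<close> is this scale
  times \<open>(j + 1)\<^sup>2\<close>, so each \<open>k\<close> leads to one Gaussian sum over
  \<open>j\<close>.\<close>

definition gauss_scale :: "real \<Rightarrow> nat \<Rightarrow> real" where
  "gauss_scale \<beta> k = \<beta> / (4 * pi) / real (Suc k)"

lemma gauss_scale_pos: "\<beta> > 0 \<Longrightarrow> gauss_scale \<beta> k > 0"
  by (simp add: gauss_scale_def)

lemma of_real_gauss_scale: "complex_of_real (gauss_scale \<beta> k) = of_real (\<beta> / (4 * pi)) * npow k (- 1)"
proof -
  have "npow k (- 1) = inverse (of_real (real (Suc k)))" by (simp add: npow_def powr_minus)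
  thus ?thesis by (simp only: gauss_scale_def of_real_divide[of "\<beta> / (4 * pi)"] divide_inverse[of "complex_of_real (\<beta> / (4 * pi))"])
qed

lemma inverse_sqrt_mult_gauss_scale:
  "of_real (1 / sqrt (real (Suc k))) * complex_of_real (gauss_scale \<beta> k) = of_real (\<beta> / (4 * pi)) * npow k (- (3 / 2))"
proof -
  have "- (3 / 2) = (1 / 2 - 1) + (- 1 :: complex)" by simp
  hence "npow k (- (3 / 2)) = of_real (1 / sqrt (real (Suc k))) * npow k (- 1)"
    unfolding npow_minus_half [symmetric] npow_add [symmetric] by (simp only:)
  thus ?thesis unfolding of_real_gauss_scale by (simp only: mult_ac)
qed

section \<open>The double series of remainders\<close>

definition right_term :: "real \<Rightarrow> complex \<Rightarrow> nat \<Rightarrow> nat \<Rightarrow> complex" where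
  "right_term \<beta> s k m = of_real (1 / sqrt (real (Suc k))) * rem_term s (gauss_scale \<beta> k) m"

definition right_sum :: "real \<Rightarrow> complex \<Rightarrow> complex" where
  "right_sum \<beta> s = (\<Sum>\<^sub>\<infinity>(k, m). right_term \<beta> s k m)"

text \<open>The square of the scale in \<open>rem_term_bound\<close> turns into
  \<open>(k + 1) powr - 2\<close>, so the sum over \<open>k\<close> imposes no restriction on
  \<open>s\<close>; \<open>Re s > -3\<close> comes from the frequencies.\<close>

lemma right_term_bound:
  assumes \<beta>: "\<beta> > 0" and a: "Re a > -3"
  shows "\<exists>r>0. \<exists>C. \<exists>e. e < -1 \<and> cball a r \<subseteq> {s. Re s > -3} \<and>
     (\<forall>z\<in>cball a r. \<forall>k m. norm (right_term \<beta> z k m) \<le> C * (real (Suc k) powr - 2 * real (Suc m) powr e))"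
proof -
  obtain r C e where r: "r > 0" "C \<ge> 0" "e < -1" "cball a r \<subseteq> {s. Re s > -3}"
      "\<And>z c m. z \<in> cball a r \<Longrightarrow> c > 0 \<Longrightarrow> norm (rem_term z c m) \<le> C * c\<^sup>2 * real (Suc m) powr e"
    using rem_term_bound[OF a] by metis
  have "norm (right_term \<beta> z k m) \<le> C * (\<beta> / (4 * pi))\<^sup>2 * (real (Suc k) powr - 2 * real (Suc m) powr e)"
    if z: "z \<in> cball a r" for z k m
  proof -
    let ?k = "real (Suc k)"
    have "norm (right_term \<beta> z k m) = 1 / sqrt ?k * norm (rem_term z (gauss_scale \<beta> k) m)"
      unfolding right_term_def norm_mult norm_of_real by simp
    also have "\<dots> \<le> 1 * (C * (gauss_scale \<beta> k)\<^sup>2 * real (Suc m) powr e)"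
      by (intro mult_mono r z gauss_scale_pos \<beta>) auto
    also have "(gauss_scale \<beta> k)\<^sup>2 = (\<beta> / (4 * pi))\<^sup>2 * ?k powr - 2"
    proof -
      have "?k powr - 2 = 1 / ?k\<^sup>2" by (simp add: powr_minus_divide)
      thus ?thesis by (simp only: gauss_scale_def power_divide times_divide_eq_right mult_1_right)
    qed
    finally show ?thesis by (simp only: mult_ac mult_1_left)
  qed
  thus ?thesis using r by blast
qed

lemma summable_on_right:
  assumes "\<beta> > 0" "Re s > -3"
  shows "(\<lambda>(k, m). right_term \<beta> s k m) summable_on UNIV"
proof -
  obtain r C e where "r > 0" "e < -1" "\<And>z k m. z \<in> cball s r \<Longrightarrow> norm (right_term \<beta> z k m) \<le> C * (real (Suc k) powr - 2 * real (Suc m) powr e)"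
    using right_term_bound[OF assms] by metis
  hence C: "e < -1" "\<And>k m. norm (right_term \<beta> s k m) \<le> C * (real (Suc k) powr - 2 * real (Suc m) powr e)" by auto
  have "(\<lambda>(k, m). C * (real (Suc k) powr - 2 * real (Suc m) powr e)) summable_on UNIV"
    by (rule summable_on_powr_product) (use C in auto)
  thus ?thesis by (rule abs_summable_on_norm_bound(2)) (use C(2) in auto)
qed

lemma holomorphic_right_sum:
  assumes \<beta>: "\<beta> > 0"
  shows "right_sum \<beta> holomorphic_on {s. Re s > -3}"
  unfolding right_sum_def [abs_def]
proof (rule holomorphic_on_infsum)
  show "(\<lambda>s. case p of (k, m) \<Rightarrow> right_term \<beta> s k m) holomorphic_on {s. Re s > -3}" for p
    by (cases p) (auto simp: right_term_def intro!: holomorphic_intros holomorphic_rem_term gauss_scale_pos \<beta>)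
  fix a assume "a \<in> {s. Re s > -3}"
  then obtain r C e where r: "r > 0" "e < -1" "cball a r \<subseteq> {s. Re s > -3}"
      "\<And>z k m. z \<in> cball a r \<Longrightarrow> norm (right_term \<beta> z k m) \<le> C * (real (Suc k) powr - 2 * real (Suc m) powr e)"
    using right_term_bound[OF \<beta>, of a] by (metis mem_Collect_eq)
  show "\<exists>r>0. \<exists>w. cball a r \<subseteq> {s. Re s > -3} \<and> w summable_on UNIV \<and>
     (\<forall>z\<in>cball a r. \<forall>p\<in>UNIV. norm (case p of (k, m) \<Rightarrow> right_term \<beta> z k m) \<le> w p)"
  proof (rule exI[of _ r], intro conjI r(1), rule exI, intro conjI ballI r(3))
    show "(\<lambda>(k, m). C * (real (Suc k) powr - 2 * real (Suc m) powr e)) summable_on UNIV"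
      by (rule summable_on_powr_product) (use r in auto)
    fix z p assume "z \<in> cball a r"
    thus "norm (case p of (k, m) \<Rightarrow> right_term \<beta> z k m) \<le> (case p of (k, m) \<Rightarrow> C * (real (Suc k) powr - 2 * real (Suc m) powr e))"
      using r(4) by (cases p) simp
  qed
qed (auto simp: open_halfspace_Re_gt)

lemma right_sum_iterated:
  assumes "\<beta> > 0" "Re s > -3"
  shows "((\<lambda>k. of_real (1 / sqrt (real (Suc k))) * rem_sum s (gauss_scale \<beta> k)) has_sum right_sum \<beta> s) UNIV"
proof -
  have "((\<lambda>(k, m). right_term \<beta> s k m) has_sum right_sum \<beta> s) (UNIV \<times> UNIV)"
    unfolding right_sum_def using summable_on_right[OF assms] by simp
  thus ?thesis
  proof (rule has_sum_SigmaD)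
    show "((\<lambda>m. case (k, m) of (k, m) \<Rightarrow> right_term \<beta> s k m) has_sum of_real (1 / sqrt (real (Suc k))) * rem_sum s (gauss_scale \<beta> k)) UNIV" for k
      unfolding right_term_def rem_sum_def prod.case
      by (intro has_sum_cmult_right has_sum_infsum summable_on_rem_term assms gauss_scale_pos)
  qed
qed

text \<open>Interpolates between the bounds \<open>x\<close> and 1. An intermediate exponent shares
  the decay between the two summation indices in \<open>left_sum_convergent_region\<close>.\<close>

lemma one_minus_exp_le_powr:
  assumes "x > 0" "0 \<le> t" "t \<le> (1::real)"
  shows "\<bar>exp (- x) - 1\<bar> \<le> x powr t"
proof (cases "x \<le> 1")
  case True
  have "\<bar>exp (- x) - 1\<bar> \<le> x powr 1" using one_minus_exp_bounds[of x] assms by simp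
  also have "\<dots> \<le> x powr t" using assms True by (intro powr_mono') auto
  finally show ?thesis .
next
  case False
  have "exp (- x) \<le> 1" "exp (- x) > 0" using assms by auto
  hence "\<bar>exp (- x) - 1\<bar> \<le> 1" by linarith
  also have "1 \<le> x powr t" using False assms by (intro ge_one_powr_ge_zero) auto
  finally show ?thesis .
qed

text \<open>After \<open>damped_sine_sum\<close> in each row and the swap of sums, the inner sum
  over \<open>j\<close> is \<open>gauss_sum s (gauss_scale \<beta> k) - zeta (1 - s)\<close>, which
  removes the constant term of \<open>gauss_sum_expansion\<close>. Against the weights
  \<open>1 / sqrt k\<close> the other terms sum to \<open>zeta ((1 - s) / 2)\<close>,
  \<open>zeta (3 / 2)\<close> and \<open>right_sum\<close>. The upper bound on \<open>Re s\<close>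
  serves the swap, the lower one the expansion.\<close>

lemma left_sum_convergent_region:
  assumes \<beta>: "\<beta> > 0" and s: "-2 < Re s" "Re s < -1"
  shows "of_real (sqrt 2) * left_sum \<beta> s = of_real (sqrt \<beta>) * zeta (- s) + zeta (1 / 2) * zeta (1 - s)
     + 1 / 2 * Gamma (s / 2) * of_real (\<beta> / (4 * pi)) powr (- s / 2) * zeta ((1 - s) / 2)
     - fe_factor (s + 2) * zeta (s + 2) * (of_real (\<beta> / (4 * pi)) * zeta (3 / 2)) + right_sum \<beta> s"
proof -
  let ?j = "\<lambda>j. real (Suc j)"
  define a where "a = (\<lambda>j. ?j j * sqrt \<beta>)"
  have a: "a j > 0" for j using \<beta> by (simp add: a_def)
  define b where "b = (\<lambda>j k. (exp (- (gauss_scale \<beta> k * ?j j ^ 2)) - 1) / sqrt (?j k))"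
  have sc: "(a j)\<^sup>2 / (4 * pi) / ?j k = gauss_scale \<beta> k * ?j j ^ 2" for j k
    using \<beta> by (simp add: a_def gauss_scale_def power_mult_distrib)
  define c where "c = \<beta> / (4 * pi)"
  have c: "c > 0" using \<beta> by (simp add: c_def)
  have b_bound: "norm (npow j (s - 1) * of_real (b j k)) \<le> c powr ((1 - Re s) / 4) * (?j j powr ((Re s - 1) / 2) * ?j k powr (- 1 / 2 - (1 - Re s) / 4))" for j k
  proof -
    \<comment> \<open>Summation over \<open>j\<close> wants an exponent below
      \<open>- Re s / 2\<close>, summation over \<open>k\<close> one above \<open>1 / 2\<close>.
      This is the midpoint; the interval is nonempty exactly for \<open>Re s < -1\<close>.\<close>
    let ?t = "(1 - Re s) / 4"
    have "\<bar>b j k\<bar> = \<bar>exp (- (gauss_scale \<beta> k * ?j j ^ 2)) - 1\<bar> / sqrt (?j k)" by (simp add: b_def)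
    also have "\<dots> \<le> (gauss_scale \<beta> k * ?j j ^ 2) powr ?t / sqrt (?j k)"
      using s gauss_scale_pos[OF \<beta>, of k] by (intro divide_right_mono one_minus_exp_le_powr) auto
    also have "(gauss_scale \<beta> k * ?j j ^ 2) powr ?t = c powr ?t * (?j k powr (- ?t) * ?j j powr (2 * ?t))"
    proof -
      have "(?j j ^ 2) powr ?t = ?j j powr (2 * ?t)" by (subst powr_powr [symmetric]) simp
      moreover have "gauss_scale \<beta> k powr ?t = c powr ?t * ?j k powr (- ?t)"
        unfolding gauss_scale_def c_def [symmetric] using c by (simp add: powr_divide powr_minus_divide)
      ultimately show ?thesis using gauss_scale_pos[OF \<beta>, of k] by (simp add: powr_mult)
    qed
    also have "c powr ?t * (?j k powr (- ?t) * ?j j powr (2 * ?t)) / sqrt (?j k) = c powr ?t * (?j j powr (2 * ?t) * (?j k powr (- ?t) * ?j k powr (- (1 / 2))))"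
      by (subst powr_minus_half) (auto simp: mult_ac)
    also have "?j k powr (- ?t) * ?j k powr (- (1 / 2)) = ?j k powr (- 1 / 2 - ?t)"
      by (simp only: powr_add [symmetric]) (simp add: algebra_simps)
    finally have 1: "\<bar>b j k\<bar> \<le> c powr ?t * (?j j powr (2 * ?t) * ?j k powr (- 1 / 2 - ?t))" .
    have "norm (npow j (s - 1) * of_real (b j k)) = ?j j powr (Re s - 1) * \<bar>b j k\<bar>"
      unfolding norm_mult norm_npow norm_of_real by simp
    also have "\<dots> \<le> ?j j powr (Re s - 1) * (c powr ?t * (?j j powr (2 * ?t) * ?j k powr (- 1 / 2 - ?t)))"
      by (intro mult_left_mono 1) auto
    also have "\<dots> = c powr ?t * ((?j j powr (Re s - 1) * ?j j powr (2 * ?t)) * ?j k powr (- 1 / 2 - ?t))"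
      by (simp only: mult_ac)
    also have "?j j powr (Re s - 1) * ?j j powr (2 * ?t) = ?j j powr ((Re s - 1) / 2)"
      by (simp only: powr_add [symmetric]) (rule arg_cong[where f = "\<lambda>x. ?j j powr x"], simp add: field_simps)
    finally show ?thesis .
  qed
  have exps1: "(Re s - 1) / 2 < -1" using s by (simp add: divide_less_eq)
  have "(1 - Re s) / 4 > 1 / 2" using s by (simp add: less_divide_eq)
  hence exps2: "- 1 / 2 - (1 - Re s) / 4 < -1" by (simp add: algebra_simps)
  have summ_b: "(\<lambda>(j, k). npow j (s - 1) * of_real (b j k)) summable_on UNIV \<times> UNIV"
    by (rule abs_summable_on_norm_bound(2)[where g = "\<lambda>(j, k). c powr ((1 - Re s) / 4) * (?j j powr ((Re s - 1) / 2) * ?j k powr (- 1 / 2 - (1 - Re s) / 4))"])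
       (unfold UNIV_Times_UNIV, rule summable_on_powr_product[OF exps1 exps2], use b_bound in auto)
  have inner: "of_real (sqrt 2) * (\<Sum>\<^sub>\<infinity>m. npow j (s - 1) * of_real (damped_sine \<beta> j m)) =
      of_real (sqrt \<beta>) * npow j s + zeta (1 / 2) * npow j (s - 1) + (\<Sum>\<^sub>\<infinity>k. npow j (s - 1) * of_real (b j k))" for j
  proof -
    have "of_real (sqrt 2) * (\<Sum>\<^sub>\<infinity>m. npow j (s - 1) * of_real (damped_sine \<beta> j m)) = npow j (s - 1) * (\<Sum>\<^sub>\<infinity>m. of_real (sqrt 2 * damped_sine \<beta> j m))"
      unfolding of_real_mult infsum_cmult_right' by (simp only: mult_ac)
    also have "(\<Sum>\<^sub>\<infinity>m. complex_of_real (sqrt 2 * damped_sine \<beta> j m)) = of_real (a j) + zeta (1 / 2) + (\<Sum>\<^sub>\<infinity>k. of_real (b j k))"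
      using damped_sine_sum[OF a[of j], unfolded sc] unfolding b_def damped_sine_def Let_def a_def .
    also have "npow j (s - 1) * (of_real (a j) + zeta (1 / 2) + (\<Sum>\<^sub>\<infinity>k. of_real (b j k))) =
        npow j (s - 1) * of_real (a j) + zeta (1 / 2) * npow j (s - 1) + (\<Sum>\<^sub>\<infinity>k. npow j (s - 1) * of_real (b j k))"
      unfolding infsum_cmult_right' by (simp add: algebra_simps)
    also have "npow j (s - 1) * of_real (a j) = of_real (sqrt \<beta>) * npow j s"
    proof -
      have "npow j 1 = of_real (?j j)" by (simp add: npow_def)
      thus ?thesis using npow_add[of j "s - 1" 1] by (simp add: a_def)
    qed
    finally show ?thesis .
  qed
  have row_b: "(\<lambda>j. \<Sum>\<^sub>\<infinity>k. npow j (s - 1) * of_real (b j k)) summable_on UNIV"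
    using summable_on_Sigma_banach[OF summ_b] by simp
  have zs: "((\<lambda>j. npow j s) has_sum zeta (- s)) UNIV" "((\<lambda>j. npow j (s - 1)) has_sum zeta (1 - s)) UNIV"
    using has_sum_zetaD[of "- s"] has_sum_zetaD[of "1 - s"] s by (simp_all add: zeta_eq_zetaD)
  have "of_real (sqrt 2) * left_sum \<beta> s = of_real (sqrt 2) * (\<Sum>\<^sub>\<infinity>j. \<Sum>\<^sub>\<infinity>m. npow j (s - 1) * of_real (damped_sine \<beta> j m))"
    unfolding left_sum_def using infsum_Sigma'_banach[of "\<lambda>j m. npow j (s - 1) * of_real (damped_sine \<beta> j m)" UNIV "\<lambda>_. UNIV"] summable_on_left[OF \<beta>, of s] by simp
  also have "\<dots> = (\<Sum>\<^sub>\<infinity>j. of_real (sqrt \<beta>) * npow j s + zeta (1 / 2) * npow j (s - 1) + (\<Sum>\<^sub>\<infinity>k. npow j (s - 1) * of_real (b j k)))"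
    unfolding inner [symmetric] by (rule infsum_cmult_right' [symmetric])
  also have "\<dots> = of_real (sqrt \<beta>) * zeta (- s) + zeta (1 / 2) * zeta (1 - s) + (\<Sum>\<^sub>\<infinity>j. \<Sum>\<^sub>\<infinity>k. npow j (s - 1) * of_real (b j k))"
    by (intro infsumI has_sum_add has_sum_cmult_right zs has_sum_infsum row_b)
  also have "(\<Sum>\<^sub>\<infinity>j. \<Sum>\<^sub>\<infinity>k. npow j (s - 1) * of_real (b j k)) = (\<Sum>\<^sub>\<infinity>k. \<Sum>\<^sub>\<infinity>j. npow j (s - 1) * of_real (b j k))"
    by (rule infsum_swap_banach[OF summ_b])
  also have "\<dots> = (\<Sum>\<^sub>\<infinity>k. of_real (1 / sqrt (?j k)) * (gauss_sum s (gauss_scale \<beta> k) - zeta (1 - s)))"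
  proof (rule infsum_cong)
    fix k
    have "((\<lambda>j. of_real (1 / sqrt (?j k)) * (npow j (s - 1) * of_real (exp (- gauss_scale \<beta> k * ?j j ^ 2)) - npow j (s - 1))) has_sum
        of_real (1 / sqrt (?j k)) * (gauss_sum s (gauss_scale \<beta> k) - zeta (1 - s))) UNIV"
      unfolding gauss_sum_def
      using has_sum_add[OF has_sum_infsum[OF summable_on_gauss_sum[OF gauss_scale_pos[OF \<beta>]]] has_sum_uminusI[OF zs(2)]]
      by (intro has_sum_cmult_right) simp
    also have "(\<lambda>j. of_real (1 / sqrt (?j k)) * (npow j (s - 1) * of_real (exp (- gauss_scale \<beta> k * ?j j ^ 2)) - npow j (s - 1))) = (\<lambda>j. npow j (s - 1) * of_real (b j k))"
    proof
      fix j
      have "complex_of_real (b j k) = of_real (1 / sqrt (?j k)) * (of_real (exp (- gauss_scale \<beta> k * ?j j ^ 2)) - 1)"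
        by (simp add: b_def)
      thus "of_real (1 / sqrt (?j k)) * (npow j (s - 1) * of_real (exp (- gauss_scale \<beta> k * ?j j ^ 2)) - npow j (s - 1)) = npow j (s - 1) * of_real (b j k)"
        by (simp only: right_diff_distrib mult_ac mult_1_left mult_1_right)
    qed
    finally show "(\<Sum>\<^sub>\<infinity>j. npow j (s - 1) * of_real (b j k)) = of_real (1 / sqrt (?j k)) * (gauss_sum s (gauss_scale \<beta> k) - zeta (1 - s))"
      by (rule infsumI)
  qed
  also have "\<dots> = 1 / 2 * Gamma (s / 2) * of_real c powr (- s / 2) * zeta ((1 - s) / 2)
     + (- (fe_factor (s + 2) * zeta (s + 2) * of_real c)) * zeta (3 / 2) + right_sum \<beta> s"
  proof (rule infsumI)
    have z1: "((\<lambda>k. npow k (- ((1 - s) / 2))) has_sum zeta ((1 - s) / 2)) UNIV" "((\<lambda>k. npow k (- (3 / 2))) has_sum zeta (3 / 2)) UNIV"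
      using has_sum_zetaD[of "(1 - s) / 2"] has_sum_zetaD[of "3 / 2"] s by (simp_all add: zeta_eq_zetaD)
    have "((\<lambda>k. (1 / 2 * Gamma (s / 2) * of_real c powr (- s / 2)) * npow k (- ((1 - s) / 2))
        + (- (fe_factor (s + 2) * zeta (s + 2) * of_real c)) * npow k (- (3 / 2)) + of_real (1 / sqrt (?j k)) * rem_sum s (gauss_scale \<beta> k)) has_sum
       (1 / 2 * Gamma (s / 2) * of_real c powr (- s / 2) * zeta ((1 - s) / 2)
       + (- (fe_factor (s + 2) * zeta (s + 2) * of_real c)) * zeta (3 / 2) + right_sum \<beta> s)) UNIV"
      using s by (intro has_sum_add has_sum_cmult_right z1 right_sum_iterated \<beta>) auto
    also have "(\<lambda>k. (1 / 2 * Gamma (s / 2) * of_real c powr (- s / 2)) * npow k (- ((1 - s) / 2))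
        + (- (fe_factor (s + 2) * zeta (s + 2) * of_real c)) * npow k (- (3 / 2)) + of_real (1 / sqrt (?j k)) * rem_sum s (gauss_scale \<beta> k))
       = (\<lambda>k. of_real (1 / sqrt (?j k)) * (gauss_sum s (gauss_scale \<beta> k) - zeta (1 - s)))"
    proof
      fix k
      have 1: "gauss_sum s (gauss_scale \<beta> k) - zeta (1 - s) = 1 / 2 * Gamma (s / 2) * of_real (gauss_scale \<beta> k) powr (- s / 2)
         - fe_factor (s + 2) * zeta (s + 2) * of_real (gauss_scale \<beta> k) + rem_sum s (gauss_scale \<beta> k)"
        using s by (subst gauss_sum_expansion) (auto intro!: gauss_scale_pos \<beta>)
      have 2: "of_real (1 / sqrt (?j k)) * of_real (gauss_scale \<beta> k) powr (- s / 2) = of_real c powr (- s / 2) * npow k (- ((1 - s) / 2))"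
      proof -
        have L: "ln (gauss_scale \<beta> k) = ln c - ln (?j k)"
          unfolding gauss_scale_def c_def [symmetric] using c by (simp add: ln_div)
        have "of_real (gauss_scale \<beta> k) powr (- s / 2) = exp (- s / 2 * of_real (ln c - ln (?j k)))"
          by (simp only: of_real_powr_exp[OF gauss_scale_pos[OF \<beta>]] L)
        also have "\<dots> = exp (- s / 2 * of_real (ln c)) * exp (s / 2 * of_real (ln (?j k)))"
          by (simp add: exp_add [symmetric] algebra_simps)
        also have "\<dots> = of_real c powr (- s / 2) * npow k (s / 2)"
          unfolding npow_def by (subst (1 2) of_real_powr_exp) (use c in auto)
        finally have g1: "of_real (gauss_scale \<beta> k) powr (- s / 2) = of_real c powr (- s / 2) * npow k (s / 2)" .
        have g2: "of_real (1 / sqrt (?j k)) * npow k (s / 2) = npow k (- ((1 - s) / 2))"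
          unfolding npow_minus_half [symmetric] npow_add [symmetric] by (rule arg_cong[where f = "npow k"]) (simp add: field_simps)
        show ?thesis unfolding g1 g2 [symmetric] by (simp only: mult_ac)
      qed
      note 3 = inverse_sqrt_mult_gauss_scale[of k \<beta>, folded c_def]
      have "of_real (1 / sqrt (?j k)) * (gauss_sum s (gauss_scale \<beta> k) - zeta (1 - s)) =
          1 / 2 * Gamma (s / 2) * (of_real (1 / sqrt (?j k)) * of_real (gauss_scale \<beta> k) powr (- s / 2))
          - fe_factor (s + 2) * zeta (s + 2) * (of_real (1 / sqrt (?j k)) * of_real (gauss_scale \<beta> k))
          + of_real (1 / sqrt (?j k)) * rem_sum s (gauss_scale \<beta> k)"
        unfolding 1 by (simp only: ring_distribs mult_ac)
      also have "\<dots> = (1 / 2 * Gamma (s / 2) * of_real c powr (- s / 2)) * npow k (- ((1 - s) / 2))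
        + (- (fe_factor (s + 2) * zeta (s + 2) * of_real c)) * npow k (- (3 / 2)) + of_real (1 / sqrt (?j k)) * rem_sum s (gauss_scale \<beta> k)"
        unfolding 2 3 by simp
      finally show "(1 / 2 * Gamma (s / 2) * of_real c powr (- s / 2)) * npow k (- ((1 - s) / 2))
        + (- (fe_factor (s + 2) * zeta (s + 2) * of_real c)) * npow k (- (3 / 2)) + of_real (1 / sqrt (?j k)) * rem_sum s (gauss_scale \<beta> k)
        = of_real (1 / sqrt (?j k)) * (gauss_sum s (gauss_scale \<beta> k) - zeta (1 - s))" ..
    qed
    finally show "((\<lambda>k. of_real (1 / sqrt (?j k)) * (gauss_sum s (gauss_scale \<beta> k) - zeta (1 - s))) has_sum
       (1 / 2 * Gamma (s / 2) * of_real c powr (- s / 2) * zeta ((1 - s) / 2)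
       + (- (fe_factor (s + 2) * zeta (s + 2) * of_real c)) * zeta (3 / 2) + right_sum \<beta> s)) UNIV" .
  qed
  finally show ?thesis by (simp add: c_def algebra_simps)
qed

text \<open>Single terms are singular at -1 (\<open>zeta (- s)\<close>,
  \<open>zeta ((1 - s) / 2)\<close>, \<open>zeta (s + 2)\<close>) and at 0
  (\<open>zeta (1 - s)\<close>, \<open>Gamma (s / 2)\<close>). Without these two points the
  half-plane is still connected, so the identity passes around them into
  \<open>Re s > 0\<close>.\<close>

theorem left_sum_continued:
  assumes \<beta>: "\<beta> > 0" and s: "Re s > -2" "s \<noteq> -1" "s \<noteq> 0"
  shows "of_real (sqrt 2) * left_sum \<beta> s = of_real (sqrt \<beta>) * zeta (- s) + zeta (1 / 2) * zeta (1 - s)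
     + 1 / 2 * Gamma (s / 2) * of_real (\<beta> / (4 * pi)) powr (- s / 2) * zeta ((1 - s) / 2)
     - fe_factor (s + 2) * zeta (s + 2) * (of_real (\<beta> / (4 * pi)) * zeta (3 / 2)) + right_sum \<beta> s"
proof (rule analytic_continuation_open[where f = "\<lambda>s. of_real (sqrt 2) * left_sum \<beta> s" and s = "{s. Re s > -2} \<inter> {s. Re s < -1}" and s' = "{s. Re s > -2} - {-1, 0}"
     and g = "\<lambda>s. of_real (sqrt \<beta>) * zeta (- s) + zeta (1 / 2) * zeta (1 - s)
     + 1 / 2 * Gamma (s / 2) * of_real (\<beta> / (4 * pi)) powr (- s / 2) * zeta ((1 - s) / 2)
     - fe_factor (s + 2) * zeta (s + 2) * (of_real (\<beta> / (4 * pi)) * zeta (3 / 2)) + right_sum \<beta> s"])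
  let ?U = "{s. Re s > -2} - {-1, 0 :: complex}"
  have "- 3 / 2 \<in> {s. Re s > -2} \<inter> {s. Re s < -1}" by simp
  thus "{s. Re s > -2} \<inter> {s. Re s < -1} \<noteq> {}" by blast
  have "left_sum \<beta> holomorphic_on ?U" "right_sum \<beta> holomorphic_on ?U"
    by (rule holomorphic_on_subset[OF holomorphic_left_sum[OF \<beta>]] holomorphic_on_subset[OF holomorphic_right_sum[OF \<beta>]]; auto)+
  moreover have "(\<lambda>s. fe_factor (s + 2)) holomorphic_on ?U"
    by (rule holomorphic_fe_factor) (auto intro!: holomorphic_intros)
  moreover have "z / 2 \<notin> \<int>\<^sub>\<le>\<^sub>0" if "z \<in> ?U" for z
    using that by (intro not_nonpos_Int_if_Re_gt) auto
  moreover have "z + 2 \<noteq> 1" "- z \<noteq> 1" "(1 - z) / 2 \<noteq> 1" "1 - z \<noteq> 1" if "z \<in> ?U" for z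
  proof -
    have z: "z \<noteq> -1" "z \<noteq> 0" using that by auto
    show "z + 2 \<noteq> 1"
    proof
      assume "z + 2 = 1"
      hence "z = 1 - 2" by (simp only: eq_diff_eq)
      thus False using z by simp
    qed
    show "- z \<noteq> 1" using z(1) by (metis minus_minus)
    show "1 - z \<noteq> 1" using z(2) by simp
    show "(1 - z) / 2 \<noteq> 1"
    proof
      assume "(1 - z) / 2 = 1"
      moreover have "z = 1 - 2 * ((1 - z) / 2)" by (simp add: diff_divide_distrib)
      ultimately have "z = 1 - 2 * 1" by (simp only:)
      thus False using z by simp
    qed
  qed
  ultimately show "(\<lambda>s. of_real (sqrt 2) * left_sum \<beta> s) holomorphic_on ?U"
    "(\<lambda>s. of_real (sqrt \<beta>) * zeta (- s) + zeta (1 / 2) * zeta (1 - s)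
     + 1 / 2 * Gamma (s / 2) * of_real (\<beta> / (4 * pi)) powr (- s / 2) * zeta ((1 - s) / 2)
     - fe_factor (s + 2) * zeta (s + 2) * (of_real (\<beta> / (4 * pi)) * zeta (3 / 2)) + right_sum \<beta> s) holomorphic_on ?U"
    using \<beta> by (auto intro!: holomorphic_intros)
  fix z assume "z \<in> {s. Re s > -2} \<inter> {s. Re s < -1}"
  thus "of_real (sqrt 2) * left_sum \<beta> z = of_real (sqrt \<beta>) * zeta (- z) + zeta (1 / 2) * zeta (1 - z)
     + 1 / 2 * Gamma (z / 2) * of_real (\<beta> / (4 * pi)) powr (- z / 2) * zeta ((1 - z) / 2)
     - fe_factor (z + 2) * zeta (z + 2) * (of_real (\<beta> / (4 * pi)) * zeta (3 / 2)) + right_sum \<beta> z"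
    by (intro left_sum_convergent_region \<beta>) auto
qed (use s \<beta> in \<open>auto intro!: connected_halfplane_minus_finite open_halfplane_minus_finite open_Int
      simp: open_halfspace_Re_gt open_halfspace_Re_lt\<close>)

text \<open>A scaled cosine transform minus its leading asymptotic term. That term does not depend
  on \<open>k\<close>, so left in place it would meet the non-summable weight
  \<open>1 / sqrt (k + 1)\<close>.\<close>

definition kummer_term :: "real \<Rightarrow> complex \<Rightarrow> nat \<Rightarrow> nat \<Rightarrow> complex" where
  "kummer_term \<beta> s k m = of_real (1 / sqrt (real (Suc k))) *
     (of_real (gauss_scale \<beta> k) powr (- s / 2) * cos_transform s (2 * pi * real (Suc m) / sqrt (gauss_scale \<beta> k)) - fe_factor s * npow m (- s))"

text \<open>For \<open>Re s > 0\<close> the expansion of the cosine transform holds again and is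
  read backwards: the second asymptotic term factors over \<open>k\<close> and \<open>m\<close> into
  \<open>zeta (3 / 2) * zeta (s + 2)\<close>, and together with the remainder it restores the
  transform.\<close>

lemma has_sum_kummer_term:
  assumes \<beta>: "\<beta> > 0" and s: "Re s > 0"
  shows "((\<lambda>(k, m). kummer_term \<beta> s k m) has_sum
     (- (fe_factor (s + 2) * zeta (s + 2) * (of_real (\<beta> / (4 * pi)) * zeta (3 / 2))) + right_sum \<beta> s)) (UNIV \<times> UNIV)"
proof -
  let ?K = "- (fe_factor (s + 2) * of_real (\<beta> / (4 * pi)))"
  have eq: "kummer_term \<beta> s k m = ?K * (npow k (- (3 / 2)) * npow m (- (s + 2))) + right_term \<beta> s k m" for k m
  proof -
    note 3 = inverse_sqrt_mult_gauss_scale[of k \<beta>]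
    have "kummer_term \<beta> s k m = - fe_factor (s + 2) * (of_real (1 / sqrt (real (Suc k))) * of_real (gauss_scale \<beta> k)) * npow m (- (s + 2)) + right_term \<beta> s k m"
      unfolding kummer_term_def right_term_def scaled_cos_transform_eq[OF gauss_scale_pos[OF \<beta>] s] by (simp add: algebra_simps)
    thus ?thesis unfolding 3 by (simp only: mult_ac mult_minus_left mult_minus_right)
  qed
  have z: "((\<lambda>k. npow k (- (3 / 2))) has_sum zeta (3 / 2)) UNIV" "((\<lambda>m. npow m (- (s + 2))) has_sum zeta (s + 2)) UNIV"
    using has_sum_zetaD[of "3 / 2"] has_sum_zetaD[of "s + 2"] s by (simp_all add: zeta_eq_zetaD)
  have "((\<lambda>(k, m). npow k (- (3 / 2)) * npow m (- (s + 2))) has_sum (zeta (3 / 2) * zeta (s + 2))) (UNIV \<times> UNIV)"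
  proof (rule has_sum_SigmaI)
    show "((\<lambda>m. case (k, m) of (k, m) \<Rightarrow> npow k (- (3 / 2)) * npow m (- (s + 2))) has_sum npow k (- (3 / 2)) * zeta (s + 2)) UNIV" for k
      unfolding prod.case by (intro has_sum_cmult_right z)
    show "((\<lambda>k. npow k (- (3 / 2)) * zeta (s + 2)) has_sum zeta (3 / 2) * zeta (s + 2)) UNIV"
      by (intro has_sum_cmult_left z)
    have "(\<lambda>(k, m). 1 * (real (Suc k) powr - (3 / 2) * real (Suc m) powr (- (Re s + 2)))) summable_on UNIV"
      using s by (intro summable_on_powr_product) auto
    thus "(\<lambda>(k, m). npow k (- (3 / 2)) * npow m (- (s + 2))) summable_on UNIV \<times> UNIV"
      unfolding UNIV_Times_UNIV
      by (rule abs_summable_on_norm_bound(2)) (auto simp: norm_mult norm_npow)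
  qed
  moreover have "((\<lambda>(k, m). right_term \<beta> s k m) has_sum right_sum \<beta> s) (UNIV \<times> UNIV)"
    unfolding right_sum_def using summable_on_right[OF \<beta>, of s] s by simp
  ultimately have "((\<lambda>p. ?K * (case p of (k, m) \<Rightarrow> npow k (- (3 / 2)) * npow m (- (s + 2))) + (case p of (k, m) \<Rightarrow> right_term \<beta> s k m)) has_sum
     (?K * (zeta (3 / 2) * zeta (s + 2)) + right_sum \<beta> s)) (UNIV \<times> UNIV)"
    by (intro has_sum_add has_sum_cmult_right)
  also have "(\<lambda>p. ?K * (case p of (k, m) \<Rightarrow> npow k (- (3 / 2)) * npow m (- (s + 2))) + (case p of (k, m) \<Rightarrow> right_term \<beta> s k m)) = (\<lambda>(k, m). kummer_term \<beta> s k m)"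
    unfolding eq by (auto simp: fun_eq_iff)
  finally show ?thesis by (simp add: mult_ac)
qed

theorem left_sum_eq:
  assumes \<beta>: "\<beta> > 0" and s: "Re s > 0"
  shows "of_real (sqrt 2) * left_sum \<beta> s = of_real (sqrt \<beta>) * zeta (- s) + zeta (1 / 2) * zeta (1 - s)
     + 1 / 2 * Gamma (s / 2) * of_real (\<beta> / (4 * pi)) powr (- s / 2) * zeta ((1 - s) / 2)
     + (\<Sum>\<^sub>\<infinity>(k, m). kummer_term \<beta> s k m)"
proof -
  have "s \<noteq> -1" "s \<noteq> 0" using s by auto
  thus ?thesis using left_sum_continued[OF \<beta>, of s] infsumI[OF has_sum_kummer_term[OF assms]] s
    by simp
qed

section \<open>Grouping by square divisors\<close>

lemma finite_square_divisors: "finite {j::nat. 0 < j \<and> j\<^sup>2 dvd Suc n}"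
proof (rule finite_subset)
  show "{j. 0 < j \<and> j\<^sup>2 dvd Suc n} \<subseteq> {..Suc n}"
  proof
    fix j assume "j \<in> {j. 0 < j \<and> j\<^sup>2 dvd Suc n}"
    hence "j\<^sup>2 \<le> Suc n" "0 < j" by (auto dest: dvd_imp_le)
    moreover have "j \<le> j\<^sup>2" by (rule power2_nat_le_imp_le) simp
    ultimately show "j \<in> {..Suc n}" by simp
  qed
qed simp

text \<open>Summation over pairs is unconditional, hence may be regrouped along the bijection
  between pairs and numbers with a marked square divisor.\<close>

lemma sums_square_divisors:
  fixes f :: "nat \<Rightarrow> nat \<Rightarrow> complex"
  assumes "((\<lambda>(j, m). f j m) has_sum S) (UNIV \<times> UNIV)"
  shows "(\<lambda>n. \<Sum>j | 0 < j \<and> j\<^sup>2 dvd Suc n. f (j - 1) (Suc n div j\<^sup>2 - 1)) sums S"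
proof -
  \<comment> \<open>The summation indices and \<open>n\<close> count from 0 while the divisor in
    \<open>?A\<close> is genuine: \<open>(j, m)\<close> corresponds to
    \<open>Suc n = Suc m * (Suc j)\<^sup>2\<close> with divisor \<open>Suc j\<close>.\<close>
  let ?h = "\<lambda>(n, j). (j - 1, Suc n div j\<^sup>2 - 1)" and ?g = "\<lambda>(j, m). (Suc m * (Suc j)\<^sup>2 - 1, Suc j)"
  let ?A = "SIGMA n:UNIV. {j::nat. 0 < j \<and> j\<^sup>2 dvd Suc n}"
  have "bij_betw ?h ?A (UNIV \<times> UNIV)"
  proof (rule bij_betw_byWitness[where f' = ?g])
    show "\<forall>p\<in>?A. ?g (?h p) = p"
    proof
      fix p assume "p \<in> ?A"
      then obtain n j where p: "p = (n, j)" "0 < j" "j\<^sup>2 dvd Suc n" by blast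
      have "Suc n div j\<^sup>2 \<noteq> 0" using p(2,3) by (auto simp: dvd_div_eq_0_iff)
      hence "Suc (Suc n div j\<^sup>2 - 1) = Suc n div j\<^sup>2" "Suc (j - 1) = j" using p(2) by linarith+
      hence "?g (?h p) = (Suc n div j\<^sup>2 * j\<^sup>2 - 1, j)" unfolding p(1) prod.case by (simp only:)
      also have "\<dots> = p" using p by simp
      finally show "?g (?h p) = p" .
    qed
    have S: "Suc (Suc m * (Suc j)\<^sup>2 - 1) = Suc m * (Suc j)\<^sup>2" for j m by simp
    show "\<forall>p\<in>UNIV \<times> UNIV. ?h (?g p) = p"
    proof
      fix p :: "nat \<times> nat"
      obtain j m where p: "p = (j, m)" by fastforce
      have "Suc m * (Suc j)\<^sup>2 div (Suc j)\<^sup>2 = Suc m" by (rule nonzero_mult_div_cancel_right) simp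
      thus "?h (?g p) = p" unfolding p prod.case S by simp
    qed
    show "?g ` (UNIV \<times> UNIV) \<subseteq> ?A"
    proof
      fix q assume "q \<in> ?g ` (UNIV \<times> UNIV)"
      then obtain j m where q: "q = (Suc m * (Suc j)\<^sup>2 - 1, Suc j)" by auto
      have "(Suc j)\<^sup>2 dvd Suc (Suc m * (Suc j)\<^sup>2 - 1)" unfolding S by (rule dvd_triv_right)
      thus "q \<in> ?A" unfolding q by blast
    qed
  qed simp
  from has_sum_reindex_bij_betw[OF this, of "\<lambda>(j, m). f j m" S] assms
  have "((\<lambda>(n, j). f (j - 1) (Suc n div j\<^sup>2 - 1)) has_sum S) ?A"
    by (simp add: case_prod_unfold)
  hence "((\<lambda>n. \<Sum>j | 0 < j \<and> j\<^sup>2 dvd Suc n. f (j - 1) (Suc n div j\<^sup>2 - 1)) has_sum S) UNIV"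
    by (rule has_sum_SigmaD) (simp add: finite_square_divisors)
  thus ?thesis by (rule has_sum_imp_sums)
qed

lemma square_divisor_props:
  assumes "0 < j" "j\<^sup>2 dvd Suc n"
  shows "real (Suc (j - 1)) = real j"
    and "real (Suc n) = real (Suc (Suc n div j\<^sup>2 - 1)) * (real j)\<^sup>2"
proof -
  show "real (Suc (j - 1)) = real j" using assms by simp
  have "Suc n div j\<^sup>2 > 0" using assms by (simp add: div_greater_zero_iff dvd_imp_le)
  hence "Suc (Suc n div j\<^sup>2 - 1) = Suc n div j\<^sup>2" by simp
  moreover have "Suc n = Suc n div j\<^sup>2 * j\<^sup>2" using assms by simp
  hence "real (Suc n) = real (Suc n div j\<^sup>2) * (real j)\<^sup>2" by (metis of_nat_mult of_nat_power)
  ultimately show "real (Suc n) = real (Suc (Suc n div j\<^sup>2 - 1)) * (real j)\<^sup>2" by (simp only:)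
qed

lemma lhs_term_eq_sum:
  assumes \<beta>: "\<beta> > 0"
  shows "lhs_term s \<beta> (Suc n) = (\<Sum>j | 0 < j \<and> j\<^sup>2 dvd Suc n. npow (j - 1) (s - 1) * of_real (damped_sine \<beta> (j - 1) (Suc n div j\<^sup>2 - 1)))"
proof -
  let ?e = "of_real (exp (- sqrt (real (Suc n) * \<beta>)) * sin (pi / 4 - sqrt (real (Suc n) * \<beta>))) :: complex"
  have "lhs_term s \<beta> (Suc n) = (\<Sum>j | 0 < j \<and> j\<^sup>2 dvd Suc n. of_nat j powr s / of_real (sqrt (real (Suc n))) * ?e)"
    unfolding lhs_term_def psi_def by (simp only: sum_divide_distrib sum_distrib_right)
  also have "\<dots> = (\<Sum>j | 0 < j \<and> j\<^sup>2 dvd Suc n. npow (j - 1) (s - 1) * of_real (damped_sine \<beta> (j - 1) (Suc n div j\<^sup>2 - 1)))"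
  proof (rule sum.cong[OF refl])
    fix j assume "j \<in> {j. 0 < j \<and> j\<^sup>2 dvd Suc n}"
    hence j: "0 < j" "j\<^sup>2 dvd Suc n" by auto
    note p = square_divisor_props[OF j]
    define J where "J = real j"
    define M where "M = real (Suc (Suc n div j\<^sup>2 - 1))"
    have pos: "J > 0" "M > 0" using j by (auto simp: J_def M_def)
    have n: "real (Suc n) = M * J\<^sup>2" using p(2) by (simp add: J_def M_def)
    have sq: "sqrt (real (Suc n)) = J * sqrt M" "sqrt (real (Suc n) * \<beta>) = J * sqrt \<beta> * sqrt M"
      unfolding n using pos by (simp_all add: real_sqrt_mult)
    have "npow (j - 1) (s - 1) = of_real J powr s / of_real J"
      unfolding npow_def p(1) using pos by (simp add: powr_diff J_def)
    moreover have "damped_sine \<beta> (j - 1) (Suc n div j\<^sup>2 - 1) = exp (- (J * sqrt \<beta>) * sqrt M) * sin (pi / 4 - J * sqrt \<beta> * sqrt M) / sqrt M"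
      unfolding damped_sine_def Let_def p(1) by (simp only: J_def M_def)
    ultimately show "of_nat j powr s / of_real (sqrt (real (Suc n))) * ?e = npow (j - 1) (s - 1) * of_real (damped_sine \<beta> (j - 1) (Suc n div j\<^sup>2 - 1))"
      unfolding sq by (simp add: J_def)
  qed
  finally show ?thesis .
qed

lemma sums_lhs_term:
  assumes "\<beta> > 0"
  shows "(\<lambda>n. lhs_term s \<beta> (Suc n)) sums left_sum \<beta> s"
proof -
  have "((\<lambda>(j, m). npow j (s - 1) * of_real (damped_sine \<beta> j m)) has_sum left_sum \<beta> s) (UNIV \<times> UNIV)"
    unfolding left_sum_def using summable_on_left[OF assms, of s] by simp
  from sums_square_divisors[OF this] show ?thesis unfolding lhs_term_eq_sum[OF assms] .
qed

section \<open>Limiting values\<close>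

lemma limiting_value_eqI:
  assumes "isCont G s" "\<forall>\<^sub>F w in at s. F w = G w"
  shows "limiting_value F s = G s"
proof -
  have "(G \<longlongrightarrow> G s) (at s)" using assms(1) by (simp add: isCont_def)
  moreover have "\<forall>\<^sub>F w in at s. G w = F w" using assms(2) by eventually_elim simp
  ultimately have "(F \<longlongrightarrow> G s) (at s)" by (rule Lim_transform_eventually)
  thus ?thesis unfolding limiting_value_def by (intro tendsto_Lim) auto
qed

lemma eventually_at_Re_gt: "Re s > a \<Longrightarrow> \<forall>\<^sub>F w in at s. Re w > a"
  using eventually_at_in_open'[of "{w. Re w > a}" s] by (simp add: open_halfspace_Re_gt)

text \<open>The reflection formula with
  \<open>sin (pi * w) = 2 * sin (pi * w / 2) * cos (pi * w / 2)\<close> rewrites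
  \<open>1 / (Gamma (1 - w) * sin (pi * w / 2))\<close> as
  \<open>2 * Gamma w * cos (pi * w / 2) / pi\<close>, which is regular for
  \<open>Re w > 0\<close>.\<close>

lemma limiting_value_reflection:
  assumes s: "Re s > 0"
  shows "limiting_value (\<lambda>w. of_real (- (pi ^ 3) * x) / (of_real y * Gamma (1 - w) * sin (of_real pi * w / 2))) s
     = - (of_real (2 * pi\<^sup>2 * x / y) * (Gamma s * cos (of_real pi * s / 2)))"
proof (rule limiting_value_eqI)
  show "isCont (\<lambda>s. - (of_real (2 * pi\<^sup>2 * x / y) * (Gamma s * cos (of_real pi * s / 2)))) s"
    using not_nonpos_Int_if_Re_pos[OF s] by (intro continuous_intros) auto
  \<comment> \<open>Every integer other than \<open>s\<close> is removed, so the punctured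
    neighbourhood contains no integer and the division is genuine there.\<close>
  have "closed (\<int> - {s} :: complex set)" by (rule closed_subset_Ints) auto
  hence "open (- (\<int> - {s}))" by (rule open_Compl)
  hence "\<forall>\<^sub>F w in at s. w \<in> - (\<int> - {s}) - {s}" by (rule eventually_at_in_open) blast
  thus "\<forall>\<^sub>F w in at s. of_real (- (pi ^ 3) * x) / (of_real y * Gamma (1 - w) * sin (of_real pi * w / 2)) = - (of_real (2 * pi\<^sup>2 * x / y) * (Gamma w * cos (of_real pi * w / 2)))"
  proof eventually_elim
    case (elim w)
    hence w: "w \<notin> \<int>" by auto
    define S where "S = sin (of_real pi * w / 2)"
    define K where "K = cos (of_real pi * w / 2)"
    define P where "P = Gamma (1 - w)"
    have "sin (of_real pi * w) \<noteq> 0"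
    proof
      assume "sin (of_real pi * w) = 0"
      then obtain k :: int where "of_real pi * w = of_real (of_int k * pi)" by (auto simp: sin_eq_0)
      hence "w = of_int k" by simp
      thus False using w by simp
    qed
    moreover have sd: "sin (of_real pi * w) = 2 * S * K"
      using sin_double[of "of_real pi * w / 2"] by (simp add: S_def K_def)
    ultimately have nz: "S \<noteq> 0" "K \<noteq> 0" by auto
    have "1 - w \<notin> \<int>\<^sub>\<le>\<^sub>0" using w by (metis Ints_1 Ints_diff diff_diff_eq2 add_diff_cancel_left' nonpos_Ints_Int)
    hence P: "P \<noteq> 0" by (simp add: P_def Gamma_eq_zero_iff)
    have "Gamma w * P = of_real pi / (2 * S * K)"
      using Gamma_reflection_complex[of w] sd by (simp add: P_def)
    hence G: "Gamma w = of_real pi / (2 * S * K * P)" using P by (metis divide_divide_eq_left nonzero_mult_div_cancel_right)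
    show ?case unfolding S_def [symmetric] K_def [symmetric] P_def [symmetric] G
      using nz P by (simp add: power2_eq_square power3_eq_cube mult_ac)
  qed
qed

text \<open>Collects the powers of 2, \<open>pi\<close> and \<open>\<beta>\<close> left over by the
  functional equation and the duplication formula in \<open>limiting_value_zeta\<close>.\<close>

lemma two_pi_scale_powr:
  fixes \<beta> :: real and w :: complex
  assumes "\<beta> > 0"
  shows "of_real (\<beta> / (4 * pi)) powr (- w / 2) * (2 powr (1 - w) * of_real (2 * pi) powr (- ((1 + w) / 2)) * of_real (sqrt pi))
     = of_real (sqrt 2) * of_real (2 * \<beta>) powr (- (1 / 2) * w)"
proof -
  define l2 where "l2 = complex_of_real (ln 2)"
  define lp where "lp = complex_of_real (ln pi)"
  define lb where "lb = complex_of_real (ln \<beta>)"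
  have sqrt: "complex_of_real (sqrt x) = exp (of_real (ln x) / 2)" if "x > 0" for x
  proof -
    have "sqrt x = exp (ln x / 2)" using that by (simp add: powr_half_sqrt [symmetric] powr_def)
    thus ?thesis by (simp add: exp_of_real [symmetric])
  qed
  have 1: "complex_of_real (\<beta> / (4 * pi)) powr (- w / 2) = exp (- w / 2 * (lb - 2 * l2 - lp))"
  proof -
    have "ln (\<beta> / (4 * pi)) = ln \<beta> - 2 * ln 2 - ln pi" using assms ln_realpow[of 2 2] by (simp add: ln_div ln_mult)
    thus ?thesis using assms by (subst of_real_powr_exp) (auto simp: lb_def l2_def lp_def)
  qed
  have 2: "(2::complex) powr (1 - w) = exp ((1 - w) * l2)" using of_real_powr_exp[of 2 "1 - w"] by (simp add: l2_def)
  have 3: "complex_of_real (2 * pi) powr (- ((1 + w) / 2)) = exp (- ((1 + w) / 2) * (l2 + lp))"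
    by (subst of_real_powr_exp) (auto simp: ln_mult l2_def lp_def)
  have 4: "complex_of_real (2 * \<beta>) powr (- (1 / 2) * w) = exp (- (1 / 2) * w * (l2 + lb))"
    using assms by (subst of_real_powr_exp) (auto simp: ln_mult l2_def lb_def)
  show ?thesis
    unfolding 1 2 3 4 sqrt[OF pi_gt_zero, folded lp_def] sqrt[of 2, simplified, folded l2_def] exp_add [symmetric]
    by (rule arg_cong[where f = exp]) (simp add: field_simps)
qed

text \<open>The functional equation at \<open>(1 + w) / 2\<close> and Legendre's duplication formula
  lead to \<open>Gamma (w / 2) * zeta ((1 - w) / 2)\<close>, regular for \<open>Re w > 0\<close>.
  The pole of zeta at \<open>w = 1\<close> is only apparent, because the cosine vanishes
  there.\<close>

lemma limiting_value_zeta: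
  assumes \<beta>: "\<beta> > 0" and s: "Re s > 0"
  shows "limiting_value (\<lambda>w. Gamma w * cos (of_real pi / 4 + of_real pi * w / 4) * zeta ((1 + w) / 2) * of_real (2 * \<beta>) powr (- (1 / 2) * w)) s
     = 1 / of_real (sqrt 2) * (1 / 2 * Gamma (s / 2) * of_real (\<beta> / (4 * pi)) powr (- s / 2) * zeta ((1 - s) / 2))"
proof (rule limiting_value_eqI)
  let ?G = "\<lambda>s. 1 / of_real (sqrt 2) * (1 / 2 * Gamma (s / 2) * of_real (\<beta> / (4 * pi)) powr (- s / 2) * zeta ((1 - s) / 2))"
  have "z / 2 \<notin> \<int>\<^sub>\<le>\<^sub>0" "(1 - z) / 2 \<noteq> 1" if "Re z > 0" for z
  proof -
    show "z / 2 \<notin> \<int>\<^sub>\<le>\<^sub>0" using that by (intro not_nonpos_Int_if_Re_pos) simp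
    have "Re ((1 - z) / 2) < Re 1" using that by simp
    thus "(1 - z) / 2 \<noteq> 1" by (metis less_irrefl)
  qed
  hence "?G holomorphic_on {z. Re z > 0}" using \<beta> by (intro holomorphic_intros) auto
  hence "continuous_on {z. Re z > 0} ?G" by (rule holomorphic_on_imp_continuous_on)
  thus "isCont ?G s" using s by (simp add: continuous_on_eq_continuous_at open_halfspace_Re_gt)
  have "\<forall>\<^sub>F w in at s. w \<noteq> 1"
  proof -
    have "open (- ({1} - {s}))" by (intro open_Compl finite_imp_closed) simp
    hence "\<forall>\<^sub>F w in at s. w \<in> - ({1} - {s}) - {s}" by (rule eventually_at_in_open) blast
    thus ?thesis by eventually_elim auto
  qed
  with eventually_at_Re_gt[OF s]
  show "\<forall>\<^sub>F w in at s. Gamma w * cos (of_real pi / 4 + of_real pi * w / 4) * zeta ((1 + w) / 2) * of_real (2 * \<beta>) powr (- (1 / 2) * w) = ?G w"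
  proof eventually_elim
    case (elim w)
    have 1: "(1 - w) / 2 = 1 - (1 + w) / 2" by (simp add: field_simps)
    have fe: "zeta ((1 - w) / 2) = fe_factor ((1 + w) / 2) * zeta ((1 + w) / 2)"
    proof -
      have "(1 + w) / 2 \<noteq> 1" using elim(2) by (simp add: divide_eq_eq)
      thus ?thesis unfolding 1 using elim(1) by (intro zeta_functional_equation) auto
    qed
    have dup: "Gamma (w / 2) * Gamma ((1 + w) / 2) = 2 powr (1 - w) * of_real (sqrt pi) * Gamma w"
    proof -
      have e: "(1 + w) / 2 = w / 2 + 1 / 2" by (simp add: field_simps)
      have "w / 2 \<notin> \<int>\<^sub>\<le>\<^sub>0" "w / 2 + 1 / 2 \<notin> \<int>\<^sub>\<le>\<^sub>0" using elim(1) by (auto intro!: not_nonpos_Int_if_Re_pos)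
      moreover have "(2::complex) powr (1 - w) = exp ((1 - 2 * (w / 2)) * of_real (ln 2))"
        using of_real_powr_exp[of 2 "1 - w"] by simp
      ultimately show ?thesis unfolding e using Gamma_legendre_duplication[of "w / 2"] by simp
    qed
    have c: "cos (of_real pi * ((1 + w) / 2) / 2) = cos (of_real pi / 4 + of_real pi * w / 4)"
      by (rule arg_cong[where f = cos]) (simp add: field_simps)
    have "?G w = 1 / of_real (sqrt 2) * (Gamma (w / 2) * Gamma ((1 + w) / 2)) * of_real (\<beta> / (4 * pi)) powr (- w / 2)
        * cos (of_real pi / 4 + of_real pi * w / 4) * of_real (2 * pi) powr (- ((1 + w) / 2)) * zeta ((1 + w) / 2)"
      unfolding fe fe_factor_def c by simp
    also have "\<dots> = 1 / of_real (sqrt 2) * Gamma w * cos (of_real pi / 4 + of_real pi * w / 4) * zeta ((1 + w) / 2) *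
        (of_real (\<beta> / (4 * pi)) powr (- w / 2) * (2 powr (1 - w) * of_real (2 * pi) powr (- ((1 + w) / 2)) * of_real (sqrt pi)))"
      unfolding dup by (simp only: mult_ac)
    also have "\<dots> = Gamma w * cos (of_real pi / 4 + of_real pi * w / 4) * zeta ((1 + w) / 2) * of_real (2 * \<beta>) powr (- (1 / 2) * w)"
      unfolding two_pi_scale_powr[OF \<beta>] by simp
    finally show ?case ..
  qed
qed

section \<open>The main identity\<close>

text \<open>The two identities match the two summands in the braces: the Kummer part and the
  subtracted part. Writing each positive quantity as the exponential of its logarithm reduces them
  to linear identities between exponents.\<close>

lemma prefactor_identities:
  fixes M J \<beta> :: real and s :: complex
  assumes "M > 0" "J > 0" "\<beta> > 0"
  defines "K \<equiv> 2 powr (- s - 1 / 2) * of_real pi powr (- s - 2) * of_real (sqrt \<beta>) * (of_real J powr (1 - s) / of_real (M * J\<^sup>2))"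
  shows "K * (2 powr (2 * s) * of_real pi powr (3 / 2 * s + 2) * of_real (M * J\<^sup>2 / \<beta>) powr ((s + 1) / 2))
       = of_real (1 / sqrt 2) * (of_real (1 / sqrt M) * of_real (\<beta> / (4 * pi) / M) powr (- s / 2))"
    and "K * of_real (2 * pi\<^sup>2 * sqrt (M * J\<^sup>2) / sqrt \<beta>)
       = of_real (1 / sqrt 2) * (of_real (1 / sqrt M) * (2 * of_real (2 * pi) powr (- s) * of_real J powr (- s)))"
proof -
  define l2 where "l2 = complex_of_real (ln 2)"
  define lp where "lp = complex_of_real (ln pi)"
  define lb where "lb = complex_of_real (ln \<beta>)"
  define lJ where "lJ = complex_of_real (ln J)"
  define lM where "lM = complex_of_real (ln M)"
  note ls = l2_def lp_def lb_def lJ_def lM_def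
  have e: "complex_of_real x = exp (of_real (ln x))" if "x > 0" for x
    using that by (simp add: exp_of_real)
  have ln4: "ln (4::real) = 2 * ln 2" using ln_realpow[of 2 2] by simp
  have lnsqrt: "ln (sqrt x) = ln x / 2" if "x > 0" for x :: real using that by (simp add: ln_sqrt)
  have 1: "(2::complex) powr z = exp (z * l2)" for z using of_real_powr_exp[of 2 z] by (simp add: l2_def)
  have 2: "complex_of_real pi powr z = exp (z * lp)" for z by (subst of_real_powr_exp) (auto simp: lp_def)
  have 3: "complex_of_real J powr z = exp (z * lJ)" for z using assms by (subst of_real_powr_exp) (auto simp: lJ_def)
  have 4: "complex_of_real (sqrt \<beta>) = exp (lb / 2)" using assms by (subst e) (auto simp: lnsqrt lb_def)
  have 5: "complex_of_real (M * J\<^sup>2) = exp (lM + 2 * lJ)"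
    using assms by (subst e) (auto simp: ln_mult ln_realpow lM_def lJ_def)
  have 6: "complex_of_real (M * J\<^sup>2 / \<beta>) powr z = exp (z * (lM + 2 * lJ - lb))" for z
    using assms by (subst of_real_powr_exp) (auto simp: ln_mult ln_div ln_realpow ls)
  have 7: "complex_of_real (1 / sqrt 2) = exp (- l2 / 2)" by (subst e) (auto simp: ln_div lnsqrt l2_def)
  have 8: "complex_of_real (1 / sqrt M) = exp (- lM / 2)" using assms by (subst e) (auto simp: ln_div lnsqrt lM_def)
  have 9: "complex_of_real (\<beta> / (4 * pi) / M) powr z = exp (z * (lb - (2 * l2 + lp) - lM))" for z
  proof -
    have "ln (\<beta> / (4 * pi) / M) = ln \<beta> - (2 * ln 2 + ln pi) - ln M" using assms by (simp add: ln_mult ln_div ln4)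
    thus ?thesis using assms by (subst of_real_powr_exp) (auto simp: ls)
  qed
  have 10: "complex_of_real (2 * pi\<^sup>2 * sqrt (M * J\<^sup>2) / sqrt \<beta>) = exp (l2 + 2 * lp + (lM / 2 + lJ) - lb / 2)"
    using assms by (subst e) (auto simp: ln_mult ln_div ln_realpow lnsqrt real_sqrt_mult ls)
  have 11: "complex_of_real (2 * pi) powr z = exp (z * (l2 + lp))" for z
    by (subst of_real_powr_exp) (auto simp: ln_mult l2_def lp_def)
  \<comment> \<open>Applied only at the end and backwards: as a left-to-right rule it would also
    rewrite the numerals inside the exponents.\<close>
  have 12: "(2::complex) = exp l2" using e[of 2] by (simp add: l2_def)
  show "K * (2 powr (2 * s) * of_real pi powr (3 / 2 * s + 2) * of_real (M * J\<^sup>2 / \<beta>) powr ((s + 1) / 2))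
       = of_real (1 / sqrt 2) * (of_real (1 / sqrt M) * of_real (\<beta> / (4 * pi) / M) powr (- s / 2))"
    unfolding K_def 1 2 3 4 5 6 7 8 9 exp_add [symmetric] exp_diff [symmetric]
    by (rule arg_cong[where f = exp]) (simp add: field_simps)
  have "K * of_real (2 * pi\<^sup>2 * sqrt (M * J\<^sup>2) / sqrt \<beta>)
       = of_real (1 / sqrt 2) * (of_real (1 / sqrt M) * (exp l2 * of_real (2 * pi) powr (- s) * of_real J powr (- s)))"
    unfolding K_def 1 2 3 4 5 7 8 10 11 exp_add [symmetric] exp_diff [symmetric]
    by (rule arg_cong[where f = exp]) (simp add: field_simps)
  thus "K * of_real (2 * pi\<^sup>2 * sqrt (M * J\<^sup>2) / sqrt \<beta>)
       = of_real (1 / sqrt 2) * (of_real (1 / sqrt M) * (2 * of_real (2 * pi) powr (- s) * of_real J powr (- s)))"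
    unfolding 12 [symmetric] .
qed

text \<open>Here the square divisor is the Poisson frequency and the cofactor is the index of the
  Gaussian scale. The weight \<open>j powr (1 - s)\<close> over \<open>n\<close> supplies the
  \<open>j powr (- s)\<close> of the leading asymptotic term.\<close>

lemma rhs_term_eq_sum:
  assumes \<alpha>: "\<alpha> * \<beta> = 4 * pi ^ 3" and \<beta>: "\<beta> > 0" and s: "Re s > 0"
  shows "2 powr (- s - 1 / 2) * of_real pi powr (- s - 2) * of_real (sqrt \<beta>) * rhs_term s \<alpha> \<beta> (Suc n) =
     (\<Sum>j | 0 < j \<and> j\<^sup>2 dvd Suc n. of_real (1 / sqrt 2) * kummer_term \<beta> s (Suc n div j\<^sup>2 - 1) (j - 1))"
proof -
  let ?K = "2 powr (- s - 1 / 2) * of_real pi powr (- s - 2) * of_real (sqrt \<beta>) :: complex"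
  define Q where "Q = - (of_real (2 * pi\<^sup>2 * sqrt (real (Suc n)) / sqrt \<beta>) * (Gamma s * cos (of_real pi * s / 2)))
      + 2 powr (2 * s) * of_real pi powr (3 / 2 * s + 2)
        * of_real (real (Suc n) / \<beta>) powr ((s + 1) / 2)
        * Gamma (s / 2) * kummer_1F1 (s / 2) (1 / 2) (- of_real (real (Suc n) * \<alpha>))"
  have "rhs_term s \<alpha> \<beta> (Suc n) = psi (1 - s) (Suc n) / of_nat (Suc n) * Q"
    unfolding rhs_term_def limiting_value_reflection[OF s] Q_def ..
  also have "?K * \<dots> = (\<Sum>j | 0 < j \<and> j\<^sup>2 dvd Suc n. ?K * (of_nat j powr (1 - s) / of_nat (Suc n)) * Q)"
    unfolding psi_def by (simp only: sum_divide_distrib sum_distrib_right sum_distrib_left mult.assoc)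
  also have "\<dots> = (\<Sum>j | 0 < j \<and> j\<^sup>2 dvd Suc n. of_real (1 / sqrt 2) * kummer_term \<beta> s (Suc n div j\<^sup>2 - 1) (j - 1))"
  proof (rule sum.cong[OF refl])
    fix j assume "j \<in> {j. 0 < j \<and> j\<^sup>2 dvd Suc n}"
    hence j: "0 < j" "j\<^sup>2 dvd Suc n" by auto
    note p = square_divisor_props[OF j]
    define J where "J = real j"
    define M where "M = real (Suc (Suc n div j\<^sup>2 - 1))"
    have pos: "J > 0" "M > 0" using j by (auto simp: J_def M_def)
    have n: "real (Suc n) = M * J\<^sup>2" using p(2) by (simp add: J_def M_def)
    have nc: "(of_nat (Suc n) :: complex) = of_real (M * J\<^sup>2)" unfolding n [symmetric] by simp
    define g where "g = \<beta> / (4 * pi) / M"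
    have g: "g > 0" using \<beta> pos by (simp add: g_def)
    \<comment> \<open>The place where \<open>\<alpha> * \<beta> = 4 * pi ^ 3\<close> enters: the
      Kummer argument for frequency \<open>J\<close> and scale \<open>g\<close> becomes
      \<open>n * \<alpha>\<close>.\<close>
    have arg: "(2 * pi * J / sqrt g)\<^sup>2 / 4 = M * J\<^sup>2 * \<alpha>"
    proof -
      have "\<alpha> = 4 * pi ^ 3 / \<beta>" using \<alpha> \<beta> by (simp add: field_simps)
      moreover have "(2 * pi * J / sqrt g)\<^sup>2 = (2 * pi * J)\<^sup>2 / g" using g by (simp add: power_divide)
      ultimately show ?thesis using \<beta> pos by (simp add: g_def field_simps power2_eq_square power3_eq_cube)
    qed
    define F where "F = Gamma (s / 2) * kummer_1F1 (s / 2) (1 / 2) (- of_real (M * J\<^sup>2 * \<alpha>))"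
    have ct: "cos_transform s (2 * pi * J / sqrt g) = F"
      unfolding F_def cos_transform_kummer[OF s] arg ..
    have kt: "kummer_term \<beta> s (Suc n div j\<^sup>2 - 1) (j - 1) = of_real (1 / sqrt M) * (of_real g powr (- s / 2) * F - fe_factor s * of_real J powr (- s))"
      unfolding kummer_term_def npow_def p(1) gauss_scale_def M_def [symmetric] J_def [symmetric] g_def [symmetric] ct ..
    let ?L = "?K * (of_real J powr (1 - s) / of_real (M * J\<^sup>2))"
    note P = prefactor_identities[OF pos(2,1) \<beta>, of s, folded g_def]
    have "?K * (of_nat j powr (1 - s) / of_nat (Suc n)) * Q = ?L * Q"
      unfolding nc by (simp add: J_def)
    also have "\<dots> = ?L * (2 powr (2 * s) * of_real pi powr (3 / 2 * s + 2) * of_real (M * J\<^sup>2 / \<beta>) powr ((s + 1) / 2)) * F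
        - ?L * of_real (2 * pi\<^sup>2 * sqrt (M * J\<^sup>2) / sqrt \<beta>) * (Gamma s * cos (of_real pi * s / 2))"
      unfolding Q_def n F_def by (simp only: ring_distribs mult.assoc mult_minus_right) (simp only: diff_conv_add_uminus add.commute)
    also have "\<dots> = of_real (1 / sqrt 2) * kummer_term \<beta> s (Suc n div j\<^sup>2 - 1) (j - 1)"
      unfolding P kt fe_factor_def by (simp only: ring_distribs mult_ac)
    finally show "?K * (of_nat j powr (1 - s) / of_nat (Suc n)) * Q = of_real (1 / sqrt 2) * kummer_term \<beta> s (Suc n div j\<^sup>2 - 1) (j - 1)" .
  qed
  finally show ?thesis .
qed

theorem theorem10p1:
  fixes \<alpha> \<beta> :: real and s :: complex
  assumes "\<alpha> > 0" and "\<beta> > 0" and "\<alpha> * \<beta> = 4 * pi ^ 3" and "Re s > 0"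
  shows "summable (\<lambda>n. lhs_term s \<beta> (Suc n)) \<and>
    summable (\<lambda>n. rhs_term s \<alpha> \<beta> (Suc n)) \<and>
    (\<Sum>n. lhs_term s \<beta> (Suc n)) =
           of_real (sqrt \<beta> / sqrt 2) * zeta (- s)
         + limiting_value (\<lambda>w. Gamma w * cos (of_real pi / 4 + of_real pi * w / 4)
             * zeta ((1 + w) / 2) * of_real (2 * \<beta>) powr (- (1 / 2) * w)) s
         + 1 / of_real (sqrt 2) * zeta (1 / 2) * zeta (1 - s)
         + 2 powr (- s - 1 / 2) * of_real pi powr (- s - 2) * of_real (sqrt \<beta>)
           * (\<Sum>n. rhs_term s \<alpha> \<beta> (Suc n))"
proof -
  let ?K = "2 powr (- s - 1 / 2) * of_real pi powr (- s - 2) * of_real (sqrt \<beta>) :: complex"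
  let ?T = "\<Sum>\<^sub>\<infinity>(k, m). kummer_term \<beta> s k m"
  have K: "?K \<noteq> 0" using assms(2) by simp
  have "((\<lambda>(k, m). kummer_term \<beta> s k m) has_sum ?T) (UNIV \<times> UNIV)"
    using has_sum_imp_summable[OF has_sum_kummer_term[OF assms(2,4)]] has_sum_infsum by fastforce
  \<comment> \<open>The indices are exchanged because \<open>sums_square_divisors\<close> expects
    the square divisor first, and that is the frequency index.\<close>
  hence "((\<lambda>(j, k). kummer_term \<beta> s k j) has_sum ?T) (UNIV \<times> UNIV)"
    by (subst (asm) has_sum_swap) simp
  from sums_mult[OF sums_square_divisors[OF this], of "of_real (1 / sqrt 2)"]
  have rhs: "(\<lambda>n. ?K * rhs_term s \<alpha> \<beta> (Suc n)) sums (of_real (1 / sqrt 2) * ?T)"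
    unfolding rhs_term_eq_sum[OF assms(3,2,4)] sum_distrib_left .
  have summ: "summable (\<lambda>n. rhs_term s \<alpha> \<beta> (Suc n))"
    using sums_summable[OF rhs] K by (simp only: summable_cmult_iff simp_thms)
  have R: "?K * (\<Sum>n. rhs_term s \<alpha> \<beta> (Suc n)) = of_real (1 / sqrt 2) * ?T"
    using suminf_mult[OF summ, of ?K] sums_unique[OF rhs] by (simp only:)
  have "left_sum \<beta> s = 1 / of_real (sqrt 2) * (of_real (sqrt 2) * left_sum \<beta> s)" by simp
  also have "\<dots> = of_real (sqrt \<beta> / sqrt 2) * zeta (- s)
       + 1 / of_real (sqrt 2) * (1 / 2 * Gamma (s / 2) * of_real (\<beta> / (4 * pi)) powr (- s / 2) * zeta ((1 - s) / 2))
       + 1 / of_real (sqrt 2) * zeta (1 / 2) * zeta (1 - s) + of_real (1 / sqrt 2) * ?T"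
    unfolding left_sum_eq[OF assms(2,4)] by (simp add: ring_distribs)
  finally have L: "left_sum \<beta> s = of_real (sqrt \<beta> / sqrt 2) * zeta (- s)
         + limiting_value (\<lambda>w. Gamma w * cos (of_real pi / 4 + of_real pi * w / 4)
             * zeta ((1 + w) / 2) * of_real (2 * \<beta>) powr (- (1 / 2) * w)) s
         + 1 / of_real (sqrt 2) * zeta (1 / 2) * zeta (1 - s)
         + ?K * (\<Sum>n. rhs_term s \<alpha> \<beta> (Suc n))"
    unfolding limiting_value_zeta[OF assms(2,4)] R .
  note lhs = sums_lhs_term[OF assms(2), of s]
  show ?thesis using sums_summable[OF lhs] summ L unfolding sums_unique[OF lhs, symmetric] by blast
qed

end
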